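(* Let $f\in L^p(\Omega)$ with $\frac{2Q}{Q+2}\le p<\frac Q2$. Then the (weak) solution $u$ of $$X^*(A(x)Xu)=f\ \text{ in }\Omega,\qquad u=0\ \text{ on }\partial\Omega$$ belongs to $L^{p^{**}}(\Omega)$, with $p^{**}=\frac{pQ}{Q-2p}$, and there exists a constant $C$, only depending on $Q,\Omega,p$ and $\alpha$ (the family $X$ being fixed), such that $$\|u\|_{L^{p^{**}}(\Omega)}\le C\|f\|_{L^p(\Omega)} .$$
   Context: Setting. $N\ge2$, $\Omega\subset\mathbb R^N$ is open and bounded, and $X=\{X_1,\dots,X_m\}$ is a fixed family of locally Lipschitz vector fields on $\mathbb R^N$, $X_j=\sum_{k=1}^N c_{jk}\partial_{x_k}$; for $u\in C^1$, $Xu=(X_1u,\dots,X_mu)$ is the $X$-gradient. An absolutely continuous path $\gamma:[0,T]\to\mathbb R^N$ is $X$-subunit if $\dot\gamma(t)=\sum_{j}\theta_j(t)X_j(\gamma(t))$ with $\sum_j\theta_j^2(t)\le1$ for a.e. $t$. It is assumed that any two points of $\Omega$ are joined by an $X$-subunit path in $\Omega$; $d_X(x,y)$ is the infimum of all $T>0$ for which there is an $X$-subunit $\gamma:[0,T]\to\mathbb R^N$ with $\gamma(0)=x$, $\gamma(T)=y$; $B_r$ denotes a $d_X$-ball of radius $r$ and $B_{cr}$ the concentric ball of radius $cr$. Standing assumptions: (i) $|y-x|\to0$ implies $d_X(x,y)\to0$; (ii) $(\Omega,d_X,\mathcal L^N)$ is doubling: there is $Q>2$ with $0<\mathcal L^N(B_{2r})\le2^Q\mathcal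 L^N(B_r)$; (iii) there are $C_P,\nu>0$ such that $\frac1{|B_r|}\int_{B_r}|u-u_r|\,dx\le C_P\,r\,\frac1{|B_{\nu r}|}\int_{B_{\nu r}}|Xu|\,dx$ for every $d_X$-ball $B_r$ and $u\in C^1(\overline{B_{\nu r}})$, with $u_r=\frac1{|B_r|}\int_{B_r}u\,dx$. $W^{1,p}_0(\Omega,X)$ is the closure of $C^\infty_c(\Omega)$ under the norm $\|Xu\|_{L^p(\Omega)}$ (with $Xu$ the $L^p$-limit of the $X$-gradients of approximating functions). Known fact (Sobolev inequality): for $1\le p<Q$ there is a constant $\mathcal S_p$ with $\|u\|_{L^{p^*}(\Omega)}\le\mathcal S_p\|Xu\|_{L^p(\Omega)}$ for all $u\in W^{1,p}_0(\Omega,X)$, $p^*=\frac{pQ}{Q-p}$. $A:\Omega\to\mathbb R^{m\times m}$ is measurable with bounded entries (not necessarily symmetric) and there are $0<\alpha<\beta$ with $\alpha|\eta|^2\le A(x)\eta\cdot\eta\le\beta|\eta|^2$ for all $\eta\in\mathbb R^m$. $X^*$ is the formal adjoint: $\langle X^*F,v\rangle=\int_\Omega F\cdot Xv$. Weak solution. For $h\in L^{\frac{2Q}{Q+2}}(\Omega)$, the weak solution of $X^*(AXu)=h$ in $\Omega$, $u=0$ on $\partial\Omega$, is the unique (Lax–Milgram) $u\in W^{1,2}_0(\Omega,X)$ with $\int_\Omega A\,Xu\cdot Xv=\int_\Omega h\,v$ for all $v\in W^{1,2}_0(\Omega,X)$. *)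

theory Defs
  imports "HOL-Analysis.Analysis"
begin

text \<open>
  A family of \<open>m\<close> vector fields on \<open>N\<close>-dimensional Euclidean space is
  \<open>X :: 'm \<Rightarrow> real^'n \<Rightarrow> real^'n\<close>, where \<open>X j x\<close> is the coefficient vector
  \<open>(c_j1(x), ..., c_jN(x))\<close>.
\<close>

definition locally_lipschitz :: "(real^'n \<Rightarrow> real^'n) \<Rightarrow> bool" where
  "locally_lipschitz F \<longleftrightarrow> (\<forall>x. \<exists>e>0. \<exists>L. L-lipschitz_on (cball x e) F)"

text \<open>The derivative of \<open>u\<close> at \<open>x\<close> in direction \<open>X j x\<close> is \<open>\<Sum>k. c_jk(x) * \<partial>_k u(x)\<close>.\<close>

definition X_gradient :: "('m \<Rightarrow> real^'n \<Rightarrow> real^'n) \<Rightarrow> (real^'n \<Rightarrow> real) \<Rightarrow> real^'n \<Rightarrow> real^'m" where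
  "X_gradient X u x = (\<chi> j. frechet_derivative u (at x) (X j x))"


subsection \<open>The control distance\<close>

text \<open>The library's \<open>absolutely_continuous\<close> is about measures; this is the notion for functions.\<close>

definition abs_continuous_on :: "real \<Rightarrow> real \<Rightarrow> (real \<Rightarrow> 'a::metric_space) \<Rightarrow> bool" where
  "abs_continuous_on a b f \<longleftrightarrow>
    (\<forall>\<epsilon>>0. \<exists>\<delta>>0. \<forall>P. finite P
        \<and> (\<forall>(s,t)\<in>P. a \<le> s \<and> s \<le> t \<and> t \<le> b)
        \<and> disjoint_family_on (\<lambda>(s,t). {s<..<t}) P
        \<and> (\<Sum>(s,t)\<in>P. t - s) < \<delta>
      \<longrightarrow> (\<Sum>(s,t)\<in>P. dist (f s) (f t)) < \<epsilon>)"

definition subunit :: "('m::finite \<Rightarrow> real^'n \<Rightarrow> real^'n) \<Rightarrow> real \<Rightarrow> (real \<Rightarrow> real^'n) \<Rightarrow> bool" where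
  "subunit X T \<gamma> \<longleftrightarrow> abs_continuous_on 0 T \<gamma> \<and>
    (\<exists>\<theta> :: 'm \<Rightarrow> real \<Rightarrow> real. AE t in lebesgue_on {0..T}.
        (\<gamma> has_vector_derivative (\<Sum>j\<in>UNIV. \<theta> j t *\<^sub>R X j (\<gamma> t))) (at t within {0..T})
        \<and> (\<Sum>j\<in>UNIV. (\<theta> j t)\<^sup>2) \<le> 1)"

definition subunit_connected :: "('m::finite \<Rightarrow> real^'n \<Rightarrow> real^'n) \<Rightarrow> (real^'n) set \<Rightarrow> bool" where
  "subunit_connected X \<Omega> \<longleftrightarrow> (\<forall>x\<in>\<Omega>. \<forall>y\<in>\<Omega>. \<exists>T>0. \<exists>\<gamma>.
      subunit X T \<gamma> \<and> \<gamma> 0 = x \<and> \<gamma> T = y \<and> \<gamma> ` {0..T} \<subseteq> \<Omega>)"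

text \<open>
  The competing paths may leave \<open>\<Omega>\<close>. The infimum is over a nonempty set whenever
  \<open>x\<close> and \<open>y\<close> lie in a set \<open>\<Omega>\<close> with \<open>subunit_connected X \<Omega>\<close>; only such values are used.
\<close>

definition cc_dist :: "('m::finite \<Rightarrow> real^'n \<Rightarrow> real^'n) \<Rightarrow> real^'n \<Rightarrow> real^'n \<Rightarrow> real" where
  "cc_dist X x y = Inf {T. T > 0 \<and> (\<exists>\<gamma>. subunit X T \<gamma> \<and> \<gamma> 0 = x \<and> \<gamma> T = y)}"

text \<open>Balls are those of the metric space \<open>(\<Omega>, cc_dist X)\<close>.\<close>

definition cc_ball ::
  "('m::finite \<Rightarrow> real^'n \<Rightarrow> real^'n) \<Rightarrow> (real^'n) set \<Rightarrow> real^'n \<Rightarrow> real \<Rightarrow> (real^'n) set" where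
  "cc_ball X \<Omega> x r = {y\<in>\<Omega>. cc_dist X x y < r}"

definition cc_continuous :: "('m::finite \<Rightarrow> real^'n \<Rightarrow> real^'n) \<Rightarrow> (real^'n) set \<Rightarrow> bool" where
  "cc_continuous X \<Omega> \<longleftrightarrow> (\<forall>x\<in>\<Omega>. (cc_dist X x \<longlongrightarrow> 0) (at x within \<Omega>))"

definition cc_doubling ::
  "('m::finite \<Rightarrow> real^'n \<Rightarrow> real^'n) \<Rightarrow> (real^'n) set \<Rightarrow> real \<Rightarrow> bool" where
  "cc_doubling X \<Omega> Q \<longleftrightarrow> (\<forall>x\<in>\<Omega>. \<forall>r>0.
      0 < measure lebesgue (cc_ball X \<Omega> x (2 * r)) \<and>
      measure lebesgue (cc_ball X \<Omega> x (2 * r)) \<le> 2 powr Q * measure lebesgue (cc_ball X \<Omega> x r))"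


subsection \<open>Function spaces and the Poincare inequality\<close>

definition mean_on :: "(real^'n) set \<Rightarrow> (real^'n \<Rightarrow> real) \<Rightarrow> real" where
  "mean_on B u = (LINT x:B|lebesgue. u x) / measure lebesgue B"

definition C1_on :: "(real^'n) set \<Rightarrow> (real^'n \<Rightarrow> real) \<Rightarrow> bool" where
  "C1_on U u \<longleftrightarrow> u differentiable_on U \<and>
    (\<forall>v. continuous_on U (\<lambda>x. frechet_derivative u (at x) v))"

text \<open>
  \<open>C\<^sup>1\<close> up to the boundary of a ball is read as: \<open>C\<^sup>1\<close> on some open neighbourhood of its closure.
  The left-hand side needs \<open>u\<close> on the ball of radius \<open>r\<close>; including that ball in the requirement
  on \<open>U\<close> only matters if \<open>\<nu> < 1\<close>.
\<close>

definition cc_poincare :: "('m::finite \<Rightarrow> real^'n \<Rightarrow> real^'n) \<Rightarrow> (real^'n) set \<Rightarrow> bool" where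
  "cc_poincare X \<Omega> \<longleftrightarrow> (\<exists>C\<^sub>P>0. \<exists>\<nu>>0. \<forall>x\<in>\<Omega>. \<forall>r>0. \<forall>u U.
      open U \<and> closure (cc_ball X \<Omega> x r \<union> cc_ball X \<Omega> x (\<nu> * r)) \<subseteq> U \<and> C1_on U u \<longrightarrow>
      mean_on (cc_ball X \<Omega> x r) (\<lambda>y. \<bar>u y - mean_on (cc_ball X \<Omega> x r) u\<bar>)
        \<le> C\<^sub>P * r * mean_on (cc_ball X \<Omega> x (\<nu> * r)) (\<lambda>y. norm (X_gradient X u y)))"

fun Ck :: "nat \<Rightarrow> (real^'n \<Rightarrow> real) \<Rightarrow> bool" where
  "Ck 0 u \<longleftrightarrow> continuous_on UNIV u"
| "Ck (Suc k) u \<longleftrightarrow> u differentiable_on UNIV \<and> (\<forall>v. Ck k (\<lambda>x. frechet_derivative u (at x) v))"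

text \<open>Test functions on \<open>\<Omega>\<close>, extended by zero.\<close>

definition Cc_infinity :: "(real^'n) set \<Rightarrow> (real^'n \<Rightarrow> real) set" where
  "Cc_infinity \<Omega> = {u. (\<forall>k. Ck k u) \<and> compact (closure {x. u x \<noteq> 0}) \<and> closure {x. u x \<noteq> 0} \<subseteq> \<Omega>}"

definition Lp_on :: "(real^'n) set \<Rightarrow> real \<Rightarrow> (real^'n \<Rightarrow> 'b::euclidean_space) set" where
  "Lp_on \<Omega> p = {f. f \<in> borel_measurable (lebesgue_on \<Omega>) \<and>
     integrable (lebesgue_on \<Omega>) (\<lambda>x. norm (f x) powr p)}"

definition Lp_norm :: "(real^'n) set \<Rightarrow> real \<Rightarrow> (real^'n \<Rightarrow> 'b::euclidean_space) \<Rightarrow> real" where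
  "Lp_norm \<Omega> p f = (LINT x|lebesgue_on \<Omega>. norm (f x) powr p) powr (1 / p)"

text \<open>
  \<open>W0_gradient X \<Omega> p u G\<close>: \<open>u\<close> belongs to \<open>W\<^sub>0\<^sup>1\<^sup>,\<^sup>p(\<Omega>,X)\<close> and its \<open>X\<close>-gradient is \<open>G\<close>, the
  \<open>L\<^sup>p\<close>-limit of the \<open>X\<close>-gradients of test functions. An element of the closure in the norm
  \<open>\<parallel>Xu\<parallel>\<^sub>p\<close> is identified with the function \<open>u\<close> that is the \<open>L\<^sup>p\<close>-limit of the test functions
  themselves; by the Sobolev inequality, for bounded \<open>\<Omega>\<close> and \<open>1 \<le> p < Q\<close>, convergence of the
  gradients already forces this convergence.
\<close>

definition W0_gradient :: "('m::finite \<Rightarrow> real^'n \<Rightarrow> real^'n) \<Rightarrow> (real^'n) set \<Rightarrow> real \<Rightarrow>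
    (real^'n \<Rightarrow> real) \<Rightarrow> (real^'n \<Rightarrow> real^'m) \<Rightarrow> bool" where
  "W0_gradient X \<Omega> p u G \<longleftrightarrow> u \<in> Lp_on \<Omega> p \<and> G \<in> Lp_on \<Omega> p \<and>
    (\<exists>\<phi>. (\<forall>k::nat. \<phi> k \<in> Cc_infinity \<Omega>) \<and>
      (\<lambda>k. Lp_norm \<Omega> p (\<lambda>x. \<phi> k x - u x)) \<longlonglongrightarrow> 0 \<and>
      (\<lambda>k. Lp_norm \<Omega> p (\<lambda>x. X_gradient X (\<phi> k) x - G x)) \<longlonglongrightarrow> 0)"


subsection \<open>The equation\<close>

definition elliptic_coefficients ::
  "(real^'n) set \<Rightarrow> real \<Rightarrow> real \<Rightarrow> (real^'n \<Rightarrow> real^'m^'m) \<Rightarrow> bool" where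
  "elliptic_coefficients \<Omega> \<alpha> \<beta> A \<longleftrightarrow>
    A \<in> borel_measurable (lebesgue_on \<Omega>) \<and>
    (\<exists>M. \<forall>x\<in>\<Omega>. \<forall>i j. \<bar>A x $ i $ j\<bar> \<le> M) \<and>
    (\<forall>x\<in>\<Omega>. \<forall>\<eta>. \<alpha> * (norm \<eta>)\<^sup>2 \<le> (A x *v \<eta>) \<bullet> \<eta> \<and> (A x *v \<eta>) \<bullet> \<eta> \<le> \<beta> * (norm \<eta>)\<^sup>2)"

text \<open>Weak solutions of \<open>X\<^sup>*(A X u) = h\<close> in \<open>\<Omega>\<close>, \<open>u = 0\<close> on the boundary of \<open>\<Omega>\<close>.\<close>

definition weak_solution :: "('m::finite \<Rightarrow> real^'n \<Rightarrow> real^'n) \<Rightarrow> (real^'n) set \<Rightarrow>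
    (real^'n \<Rightarrow> real^'m^'m) \<Rightarrow> (real^'n \<Rightarrow> real) \<Rightarrow> (real^'n \<Rightarrow> real) \<Rightarrow> bool" where
  "weak_solution X \<Omega> A h u \<longleftrightarrow> (\<exists>G. W0_gradient X \<Omega> 2 u G \<and>
    (\<forall>v H. W0_gradient X \<Omega> 2 v H \<longrightarrow>
      (LINT x|lebesgue_on \<Omega>. (A x *v G x) \<bullet> H x) = (LINT x|lebesgue_on \<Omega>. h x * v x)))"

end

theory Submission
  imports Defs
begin

text \<open>
  The estimate is a Stampacchia--Moser argument: the equation is tested with a power of its own
  solution. Put \<open>2\<^sup>* = 2 Q / (Q - 2)\<close>, \<open>r = p Q / (Q - 2 p)\<close>, and let \<open>s = r / 2\<^sup>*\<close>; the lower bound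
  on \<open>p\<close> says exactly that \<open>s \<ge> 1\<close>. Testing with the odd power of \<open>u\<close> of exponent \<open>2 s - 1\<close> and using
  ellipticity bounds the energy \<open>\<integral> |X (|u|\<^sup>s)|\<^sup>2\<close> by a multiple of \<open>\<integral> |f| |u| powr (2 s - 1)\<close>. By the
  Sobolev inequality on the left and the Hoelder inequality on the right, where
  \<open>(2 s - 1) p / (p - 1) = r\<close>, both sides become powers of \<open>\<integral> |u| powr r\<close>, and the one on the left has
  the larger exponent. To make all integrals finite, \<open>u\<close> is first replaced by the bounded smooth
  truncation \<open>n arctan (u / n)\<close>; Fatou's lemma then removes the truncation. That the powers are
  admissible test functions is the chain rule \<open>W0_gradient_chain_rule\<close>, proved by composing test
  functions with polynomials that approximate the outer function in \<open>C\<^sup>1\<close>.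

  The Sobolev inequality itself has to be derived from doubling and the Poincare inequality.
  Doubling gives a Vitali covering lemma, hence the maximal theorem in \<open>L\<^sup>2\<close>
  (\<open>maximal_L2_bound\<close>); moreover a doubling measure of finite mass forces the control distance to be
  bounded and balls of radius \<open>r\<close>, up to the diameter, to have measure at least a multiple of
  \<open>r powr Q\<close>. Telescoping the
  Poincare inequality over shrinking balls and splitting the sum as Hedberg does bounds
  \<open>|u - mean u|\<close> pointwise by \<open>(M |X u|) powr (1 - 2/Q)\<close> times a power of the \<open>L\<^sup>2\<close> norm of \<open>X u\<close>,
  where \<open>M\<close> is the maximal operator; this yields \<open>sobolev_poincare\<close>, the Sobolev inequality up to
  the mean of \<open>u\<close> over \<open>\<Omega>\<close>.

  The mean is controlled because test functions vanish outside \<open>\<Omega>\<close>, and this is where the geometry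
  enters. If test functions could be close to a nonzero constant with small \<open>X\<close>-gradient, then all
  fields would be tangent to the exterior of \<open>\<Omega>\<close>. But tangent Lipschitz fields cannot carry a path
  close to the exterior in bounded time, since the distance to the exterior changes at most
  exponentially along the path, whereas the control distance is bounded on \<open>\<Omega>\<close>. So some field
  is transversal to the exterior at some point of contact (\<open>transversal_contact_point\<close>), and
  integrating the derivative along this field of a function concentrated near that point bounds
  the constant (\<open>constant_bound_at_contact_point\<close>).
\<close>

section \<open>Absolutely continuous functions\<close>

text \<open>Sums over tagged partitions are indexed by tags and may contain degenerate intervals, so they are
  not sums over sets of pairs of end points; this form of absolute continuity applies to them
  directly.\<close>
lemma abs_continuous_on_indexed:
  fixes f :: "real \<Rightarrow> 'a::metric_space"
  assumes ac: "abs_continuous_on a b f" and "\<epsilon> > 0"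
  shows "\<exists>\<delta>>0. \<forall>(I::'i set) l u. finite I \<longrightarrow> (\<forall>i\<in>I. a \<le> l i \<and> l i \<le> u i \<and> u i \<le> b) \<longrightarrow>
       disjoint_family_on (\<lambda>i. {l i<..<u i}) I \<longrightarrow> (\<Sum>i\<in>I. u i - l i) < \<delta>
       \<longrightarrow> (\<Sum>i\<in>I. dist (f (l i)) (f (u i))) < \<epsilon>"
proof -
  obtain \<delta> where "\<delta> > 0" and \<delta>: "\<And>P. finite P
        \<Longrightarrow> (\<forall>(s,t)\<in>P. a \<le> s \<and> s \<le> t \<and> t \<le> b)
        \<Longrightarrow> disjoint_family_on (\<lambda>(s,t). {s<..<t}) P
        \<Longrightarrow> (\<Sum>(s,t)\<in>P. t - s) < \<delta> \<Longrightarrow> (\<Sum>(s,t)\<in>P. dist (f s) (f t)) < \<epsilon>"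
    using ac \<open>\<epsilon> > 0\<close> unfolding abs_continuous_on_def by meson
  show ?thesis
  proof (intro exI[of _ \<delta>] conjI \<open>\<delta> > 0\<close> allI impI)
    fix I :: "'i set" and l u :: "'i \<Rightarrow> real"
    assume fin: "finite I" and lu': "\<forall>i\<in>I. a \<le> l i \<and> l i \<le> u i \<and> u i \<le> b"
      and disj: "disjoint_family_on (\<lambda>i. {l i<..<u i}) I" and sum: "(\<Sum>i\<in>I. u i - l i) < \<delta>"
    have lu: "a \<le> l i \<and> l i \<le> u i \<and> u i \<le> b" if "i \<in> I" for i
      using lu' that by blast
    define J where "J = {i\<in>I. l i < u i}"
    have J: "J \<subseteq> I" "finite J" using fin by (auto simp: J_def)
    have *: "l i = l j \<Longrightarrow> u i = u j \<Longrightarrow> i = j" if "i \<in> J" "j \<in> J" for i j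
    proof (rule ccontr)
      assume "i \<noteq> j" and eq: "l i = l j" "u i = u j"
      then have "{l i<..<u i} \<inter> {l j<..<u j} = {}"
        using disj that unfolding disjoint_family_on_def J_def by blast
      moreover have "(l i + u i) / 2 \<in> {l i<..<u i} \<inter> {l j<..<u j}"
        using that eq by (auto simp: J_def)
      ultimately show False by blast
    qed
    then have inj: "inj_on (\<lambda>i. (l i, u i)) J" by (auto simp: inj_on_def)
    define P where "P = (\<lambda>i. (l i, u i)) ` J"
    have "(\<Sum>(s,t)\<in>P. dist (f s) (f t)) < \<epsilon>"
    proof (rule \<delta>)
      show "finite P" using J by (simp add: P_def)
      show "\<forall>(s, t)\<in>P. a \<le> s \<and> s \<le> t \<and> t \<le> b" using lu J by (auto simp: P_def)
      show "disjoint_family_on (\<lambda>(s, t). {s<..<t}) P"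
        unfolding disjoint_family_on_def
      proof (intro ballI impI)
        fix p q assume "p \<in> P" "q \<in> P" "p \<noteq> q"
        then obtain i j where "i \<in> J" "j \<in> J" "i \<noteq> j" "p = (l i, u i)" "q = (l j, u j)"
          by (auto simp: P_def)
        then show "(case p of (s, t) \<Rightarrow> {s<..<t}) \<inter> (case q of (s, t) \<Rightarrow> {s<..<t}) = {}"
          using disj J unfolding disjoint_family_on_def by (auto simp del: greaterThanLessThan_iff)
      qed
      have "(\<Sum>(s,t)\<in>P. t - s) = (\<Sum>i\<in>J. u i - l i)"
        using inj by (simp add: P_def sum.reindex)
      also have "\<dots> \<le> (\<Sum>i\<in>I. u i - l i)"
        using lu J fin by (intro sum_mono2) auto
      finally show "(\<Sum>(s,t)\<in>P. t - s) < \<delta>" using sum by simp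
    qed
    moreover have "(\<Sum>(s,t)\<in>P. dist (f s) (f t)) = (\<Sum>i\<in>J. dist (f (l i)) (f (u i)))"
      using inj by (simp add: P_def sum.reindex)
    moreover have "\<dots> = (\<Sum>i\<in>I. dist (f (l i)) (f (u i)))"
    proof (rule sum.mono_neutral_left[OF fin J(1)], rule ballI)
      fix i assume "i \<in> I - J"
      then have "l i = u i" using lu[of i] by (auto simp: J_def)
      then show "dist (f (l i)) (f (u i)) = 0" by simp
    qed
    ultimately show "(\<Sum>i\<in>I. dist (f (l i)) (f (u i))) < \<epsilon>" by simp
  qed
qed

text \<open>A one-sided substitute for the fundamental theorem of calculus that avoids derivatives almost
  everywhere of \<open>g\<close>. Choose a fine tagged partition: intervals whose tag lies off \<open>N\<close> contribute
  at most \<open>C + \<epsilon>\<close> times their length, and the others, contained in an open set of small measure,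
  contribute little by absolute continuity.\<close>
lemma abs_continuous_growth_bound:
  fixes g :: "real \<Rightarrow> real"
  assumes "a \<le> b" and ac: "abs_continuous_on a b g" and "negligible N" and "C \<ge> 0"
    and growth: "\<And>t \<epsilon>. \<lbrakk>t \<in> {a..b} - N; \<epsilon> > 0\<rbrakk> \<Longrightarrow>
      \<exists>\<delta>>0. \<forall>s s'. a \<le> s \<and> s \<le> t \<and> t \<le> s' \<and> s' \<le> b \<and> s' - s < \<delta> \<longrightarrow> g s' - g s \<le> (C + \<epsilon>) * (s' - s)"
  shows "g b - g a \<le> C * (b - a)"
proof -
  have main: "g b - g a \<le> (C + \<epsilon>) * (b - a) + \<epsilon>" if "\<epsilon> > 0" for \<epsilon>
  proof -
    obtain \<delta> where "\<delta> > 0" and \<delta>: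
      "\<forall>(I::(real \<times> real set) set) l u. finite I \<longrightarrow> (\<forall>i\<in>I. a \<le> l i \<and> l i \<le> u i \<and> u i \<le> b) \<longrightarrow>
       disjoint_family_on (\<lambda>i. {l i<..<u i}) I \<longrightarrow> (\<Sum>i\<in>I. u i - l i) < \<delta>
       \<longrightarrow> (\<Sum>i\<in>I. dist (g (l i)) (g (u i))) < \<epsilon>"
      using abs_continuous_on_indexed[OF ac \<open>\<epsilon> > 0\<close>] by blast
    have Nsets: "N \<in> sets lebesgue" using \<open>negligible N\<close> by (simp add: negligible_imp_sets)
    obtain W where W: "open W" "N \<subseteq> W" "W - N \<in> lmeasurable" "emeasure lebesgue (W - N) < ennreal \<delta>"
      using sets_lebesgue_outer_open[OF Nsets \<open>\<delta> > 0\<close>] by metis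
    have "emeasure lebesgue W \<le> emeasure lebesgue (W - N) + emeasure lebesgue N"
    proof -
      have "emeasure lebesgue W \<le> emeasure lebesgue ((W - N) \<union> N)"
        using W Nsets by (intro emeasure_mono) auto
      also have "\<dots> \<le> emeasure lebesgue (W - N) + emeasure lebesgue N"
        using W Nsets by (intro emeasure_subadditive) auto
      finally show ?thesis .
    qed
    also have "emeasure lebesgue N = 0"
      using \<open>negligible N\<close> negligible_iff_emeasure0 Nsets by blast
    finally have We: "emeasure lebesgue W < ennreal \<delta>" using W by simp
    then have Wl: "W \<in> lmeasurable"
      using W(1) by (intro fmeasurableI) (auto simp: top.extremum_strict borel_open intro: less_trans[of _ "ennreal \<delta>"])
    have Wm: "measure lebesgue W < \<delta>"
      using We Wl \<open>\<delta> > 0\<close> by (simp add: emeasure_eq_measure2 ennreal_less_iff)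
    have "\<exists>r>0. (t \<in> N \<longrightarrow> ball t r \<subseteq> W) \<and> (t \<in> {a..b} - N \<longrightarrow>
        (\<forall>s s'. a \<le> s \<and> s \<le> t \<and> t \<le> s' \<and> s' \<le> b \<and> s' - s < 2 * r \<longrightarrow> g s' - g s \<le> (C + \<epsilon>) * (s' - s)))" for t
    proof (cases "t \<in> N")
      case True
      then show ?thesis using W(1,2) by (metis DiffD2 open_contains_ball subsetD)
    next
      case False
      show ?thesis
      proof (cases "t \<in> {a..b}")
        case True
        then obtain d where "d > 0" "\<forall>s s'. a \<le> s \<and> s \<le> t \<and> t \<le> s' \<and> s' \<le> b \<and> s' - s < d \<longrightarrow> g s' - g s \<le> (C + \<epsilon>) * (s' - s)"
          using growth[of t \<epsilon>] False \<open>\<epsilon> > 0\<close> by auto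
        then show ?thesis using False by (intro exI[of _ "d/2"]) auto
      next
        case False
        then show ?thesis using \<open>t \<notin> N\<close> by (intro exI[of _ 1]) auto
      qed
    qed
    then obtain r where r: "\<And>t. r t > 0" "\<And>t. t \<in> N \<Longrightarrow> ball t (r t) \<subseteq> W"
      "\<And>t s s'. \<lbrakk>t \<in> {a..b} - N; a \<le> s; s \<le> t; t \<le> s'; s' \<le> b; s' - s < 2 * r t\<rbrakk> \<Longrightarrow> g s' - g s \<le> (C + \<epsilon>) * (s' - s)"
      by metis
    \<comment> \<open>Around a tag in \<open>N\<close> the gauge stays in \<open>W\<close>; around any other tag it is so fine that the
      growth hypothesis applies.\<close>
    have "gauge (\<lambda>t. ball t (r t))" using r(1) by (auto intro: gauge_ball_dependent)
    then obtain p where p: "p tagged_division_of {a..b}" "(\<lambda>t. ball t (r t)) fine p"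
      using fine_division_exists_real by metis
    have finp: "finite p" using p by blast
    have interval: "k = {Inf k..Sup k}" "Inf k \<le> t" "t \<le> Sup k" "a \<le> Inf k" "Sup k \<le> b"
        "k \<subseteq> ball t (r t)" "t \<in> {a..b}" "measure lborel k = Sup k - Inf k" if tk0: "(t, k) \<in> p" for t k
    proof -
      obtain c d where "k = cbox c d" using tagged_division_ofD(4)[OF p(1) tk0] by (elim exE)
      then have k: "k = {c..d}" by simp
      have tk: "t \<in> k" "k \<subseteq> {a..b}" using tagged_division_ofD(2,3)[OF p(1) tk0] by simp_all
      have cd: "c \<le> d" using tk(1) k by simp
      then have IS: "Inf k = c" "Sup k = d" using k by simp_all
      show "k = {Inf k..Sup k}" using k IS by simp
      show "Inf k \<le> t" "t \<le> Sup k" using tk(1) k IS by simp_all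
      show "a \<le> Inf k" "Sup k \<le> b" using tk(2) k IS cd by simp_all
      show "measure lborel k = Sup k - Inf k" using k IS cd by simp
      show "k \<subseteq> ball t (r t)" using p(2) that unfolding fine_def by blast
      show "t \<in> {a..b}" using tk by auto
    qed
    define p1 where "p1 = {(t,k)\<in>p. t \<in> N}"
    have p1: "p1 \<subseteq> p" "finite p1" using finp by (auto simp: p1_def intro: finite_subset)
    have disj: "disjoint_family_on (\<lambda>i. {Inf (snd i)<..<Sup (snd i)}) p"
      unfolding disjoint_family_on_def
    proof (intro ballI impI)
      fix i j assume ij: "i \<in> p" "j \<in> p" "i \<noteq> j"
      then have "interior (snd i) \<inter> interior (snd j) = {}"
        using p(1) by (metis prod.collapse tagged_division_ofD(5))
      moreover have "interior (snd i) = {Inf (snd i)<..<Sup (snd i)}" if "i \<in> p" for i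
        using interval(1)[of "fst i" "snd i"] that by (metis interior_atLeastAtMost_real prod.collapse)
      ultimately show "{Inf (snd i)<..<Sup (snd i)} \<inter> {Inf (snd j)<..<Sup (snd j)} = {}"
        using ij by metis
    qed
    have "(\<Sum>i\<in>p1. Sup (snd i) - Inf (snd i)) = measure lebesgue (\<Union>i\<in>p1. {Inf (snd i)<..<Sup (snd i)})"
    proof -
      have "measure lebesgue (\<Union>i\<in>p1. {Inf (snd i)<..<Sup (snd i)}) = (\<Sum>i\<in>p1. measure lebesgue {Inf (snd i)<..<Sup (snd i)})"
      proof (intro measure_finite_Union disjoint_family_on_mono[OF p1(1) disj] p1(2))
        show "emeasure lebesgue {Inf (snd i)<..<Sup (snd i)} \<noteq> \<infinity>" for i :: "real \<times> real set"
          by (cases "Inf (snd i) \<le> Sup (snd i)") simp_all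
      qed auto
      also have "\<dots> = (\<Sum>i\<in>p1. Sup (snd i) - Inf (snd i))"
      proof (rule sum.cong)
        fix i assume "i \<in> p1"
        then have "Inf (snd i) \<le> Sup (snd i)" using interval(2,3)[of "fst i" "snd i"] p1 by force
        then show "measure lebesgue {Inf (snd i)<..<Sup (snd i)} = Sup (snd i) - Inf (snd i)"
          by simp
      qed simp
      finally show ?thesis by simp
    qed
    also have "\<dots> \<le> measure lebesgue W"
    proof (rule measure_mono_fmeasurable[OF _ _ Wl])
      show "(\<Union>i\<in>p1. {Inf (snd i)<..<Sup (snd i)}) \<subseteq> W"
      proof clarsimp
        fix t k x assume tk: "(t, k) \<in> p1" and x: "Inf k < x" "x < Sup k"
        then have "x \<in> k" using interval(1)[of t k] p1 by (metis atLeastAtMost_iff less_imp_le subsetD)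
        then show "x \<in> W" using interval(6)[of t k] tk r(2)[of t] by (auto simp: p1_def)
      qed
    qed (auto intro!: sets.finite_UN p1)
    finally have "(\<Sum>i\<in>p1. Sup (snd i) - Inf (snd i)) < \<delta>" using Wm by simp
    then have bad: "(\<Sum>i\<in>p1. dist (g (Inf (snd i))) (g (Sup (snd i)))) < \<epsilon>"
    proof (intro \<delta>[rule_format, of p1 "\<lambda>i. Inf (snd i)" "\<lambda>i. Sup (snd i)"])
      show "finite p1" by (rule p1(2))
      show "disjoint_family_on (\<lambda>i. {Inf (snd i)<..<Sup (snd i)}) p1"
        using disj p1(1) by (rule disjoint_family_on_mono[rotated])
      fix i assume "i \<in> p1"
      then have "(fst i, snd i) \<in> p" using p1 by auto
      from interval(2-5)[OF this]
      show "a \<le> Inf (snd i) \<and> Inf (snd i) \<le> Sup (snd i) \<and> Sup (snd i) \<le> b" by linarith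
    qed
    have "g b - g a = (\<Sum>(t,k)\<in>p. g (Sup k) - g (Inf k))"
      using additive_tagged_division_1[OF \<open>a \<le> b\<close> p(1), of g] by simp
    also have "\<dots> \<le> (\<Sum>(t,k)\<in>p. (C + \<epsilon>) * measure lborel k + (if t \<in> N then dist (g (Inf k)) (g (Sup k)) else 0))"
    proof (rule sum_mono, clarify)
      fix t k assume tk: "(t, k) \<in> p"
      note i = interval[OF tk]
      show "g (Sup k) - g (Inf k) \<le> (C + \<epsilon>) * measure lborel k + (if t \<in> N then dist (g (Inf k)) (g (Sup k)) else 0)"
      proof (cases "t \<in> N")
        case True
        have "0 \<le> (C + \<epsilon>) * measure lborel k" using \<open>C \<ge> 0\<close> \<open>\<epsilon> > 0\<close> by simp
        moreover have "g (Sup k) - g (Inf k) \<le> dist (g (Inf k)) (g (Sup k))"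
          by (simp add: dist_real_def)
        ultimately show ?thesis using True by simp
      next
        case False
        have ends: "Inf k \<in> k" "Sup k \<in> k" using i(1-3) by (metis atLeastAtMost_iff order_refl order_trans)+
        then have "dist t (Inf k) < r t" "dist t (Sup k) < r t" using i(6) by auto
        then have "Sup k - Inf k < 2 * r t" by (auto simp: dist_real_def)
        then show ?thesis using r(3)[of t "Inf k" "Sup k"] False i by simp
      qed
    qed
    also have "\<dots> = (\<Sum>(t,k)\<in>p. (C + \<epsilon>) * measure lborel k) + (\<Sum>(t,k)\<in>p. if t \<in> N then dist (g (Inf k)) (g (Sup k)) else 0)"
      by (simp add: case_prod_unfold sum.distrib)
    also have "(\<Sum>(t,k)\<in>p. (C + \<epsilon>) * measure lborel k) = (C + \<epsilon>) * (b - a)"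
    proof -
      have "(\<Sum>(t,k)\<in>p. measure lborel k) = b - a"
        using additive_content_tagged_division[of p a b] p(1) \<open>a \<le> b\<close> by simp
      then show ?thesis by (simp add: case_prod_unfold sum_distrib_left[symmetric])
    qed
    also have "(\<Sum>(t,k)\<in>p. if t \<in> N then dist (g (Inf k)) (g (Sup k)) else 0) = (\<Sum>i\<in>p1. dist (g (Inf (snd i))) (g (Sup (snd i))))"
      using finp by (intro sum.mono_neutral_cong_right) (auto simp: p1_def split: if_splits)
    finally show ?thesis using bad by simp
  qed
  show ?thesis
  proof (rule field_le_epsilon)
    fix e :: real assume "e > 0"
    define \<epsilon> where "\<epsilon> = e / (b - a + 1)"
    have "\<epsilon> > 0" using \<open>e > 0\<close> \<open>a \<le> b\<close> by (simp add: \<epsilon>_def)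
    have "\<epsilon> * (b - a + 1) = e" using \<open>a \<le> b\<close> by (simp add: \<epsilon>_def)
    then show "g b - g a \<le> C * (b - a) + e"
      using main[OF \<open>\<epsilon> > 0\<close>] by (simp add: algebra_simps)
  qed
qed

text \<open>Used for projections of a path to a line and for the logarithm of the distance from a path to a
  set.\<close>
lemma abs_continuous_on_dominated:
  fixes f :: "real \<Rightarrow> 'a::metric_space" and g :: "real \<Rightarrow> 'b::metric_space"
  assumes ac: "abs_continuous_on a b f" and "K \<ge> 0"
    and le: "\<And>s t. \<lbrakk>a \<le> s; s \<le> t; t \<le> b\<rbrakk> \<Longrightarrow> dist (g s) (g t) \<le> K * dist (f s) (f t)"
  shows "abs_continuous_on a b g"
  unfolding abs_continuous_on_def
proof (intro allI impI)
  fix \<epsilon> :: real assume "\<epsilon> > 0"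
  then have "\<epsilon> / (K + 1) > 0" using \<open>K \<ge> 0\<close> by simp
  then obtain \<delta> where "\<delta> > 0" and \<delta>: "\<And>P. \<lbrakk>finite P; \<forall>(s,t)\<in>P. a \<le> s \<and> s \<le> t \<and> t \<le> b;
      disjoint_family_on (\<lambda>(s,t). {s<..<t}) P; (\<Sum>(s,t)\<in>P. t - s) < \<delta>\<rbrakk>
      \<Longrightarrow> (\<Sum>(s,t)\<in>P. dist (f s) (f t)) < \<epsilon> / (K + 1)"
    using ac unfolding abs_continuous_on_def by meson
  show "\<exists>\<delta>>0. \<forall>P. finite P \<and> (\<forall>(s,t)\<in>P. a \<le> s \<and> s \<le> t \<and> t \<le> b) \<and>
      disjoint_family_on (\<lambda>(s,t). {s<..<t}) P \<and> (\<Sum>(s,t)\<in>P. t - s) < \<delta>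
      \<longrightarrow> (\<Sum>(s,t)\<in>P. dist (g s) (g t)) < \<epsilon>"
  proof (intro exI[of _ \<delta>] conjI \<open>\<delta> > 0\<close> allI impI, elim conjE)
    fix P assume P: "finite P" "\<forall>(s,t)\<in>P. a \<le> s \<and> s \<le> t \<and> t \<le> b"
      "disjoint_family_on (\<lambda>(s,t). {s<..<t}) P" "(\<Sum>(s,t)\<in>P. t - s) < \<delta>"
    have "(\<Sum>(s,t)\<in>P. dist (g s) (g t)) \<le> (\<Sum>(s,t)\<in>P. (K + 1) * dist (f s) (f t))"
    proof (rule sum_mono, clarify)
      fix s t assume "(s, t) \<in> P"
      then have "dist (g s) (g t) \<le> K * dist (f s) (f t)" using P(2) le by blast
      then show "dist (g s) (g t) \<le> (K + 1) * dist (f s) (f t)"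
        by (simp add: distrib_right add_increasing2)
    qed
    also have "\<dots> = (K + 1) * (\<Sum>(s,t)\<in>P. dist (f s) (f t))"
      by (simp add: case_prod_unfold sum_distrib_left)
    also have "\<dots> < (K + 1) * (\<epsilon> / (K + 1))"
      using \<delta>[OF P] \<open>K \<ge> 0\<close> by (intro mult_strict_left_mono) auto
    finally show "(\<Sum>(s,t)\<in>P. dist (g s) (g t)) < \<epsilon>" using \<open>K \<ge> 0\<close> by simp
  qed
qed

lemma lipschitz_imp_abs_continuous_on:
  assumes "L-lipschitz_on {a..b} f"
  shows "abs_continuous_on a b f"
proof (rule abs_continuous_on_dominated[of a b "\<lambda>t::real. t" L])
  show "abs_continuous_on a b (\<lambda>t. t)"
    unfolding abs_continuous_on_def
  proof (intro allI impI)
    fix \<epsilon> :: real assume "\<epsilon> > 0"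
    have *: "(\<Sum>(s,t)\<in>P. dist s t) = (\<Sum>(s,t)\<in>P. t - s)"
      if "\<forall>(s,t)\<in>P. a \<le> s \<and> s \<le> t \<and> t \<le> b" for P :: "(real \<times> real) set"
      using that by (intro sum.cong) (auto simp: dist_real_def)
    show "\<exists>\<delta>>0. \<forall>P. finite P \<and> (\<forall>(s,t)\<in>P. a \<le> s \<and> s \<le> t \<and> t \<le> b) \<and>
      disjoint_family_on (\<lambda>(s,t). {s<..<t}) P \<and> (\<Sum>(s,t)\<in>P. t - s) < \<delta>
      \<longrightarrow> (\<Sum>(s,t)\<in>P. dist s t) < \<epsilon>"
      using \<open>\<epsilon> > 0\<close> * by (intro exI[of _ \<epsilon>]) simp
  qed
  show "L \<ge> 0" using assms by (rule lipschitz_on_nonneg)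
  show "dist (f s) (f t) \<le> L * dist s t" if "a \<le> s" "s \<le> t" "t \<le> b" for s t
    using lipschitz_onD[OF assms] that by simp
qed

lemma abs_continuous_on_imp_continuous_on:
  assumes "abs_continuous_on a b f"
  shows "continuous_on {a..b} f"
  unfolding continuous_on_iff
proof (intro ballI allI impI)
  fix x \<epsilon> :: real assume x: "x \<in> {a..b}" and "\<epsilon> > 0"
  then obtain \<delta> where "\<delta> > 0" and \<delta>: "\<And>P. \<lbrakk>finite P; \<forall>(s,t)\<in>P. a \<le> s \<and> s \<le> t \<and> t \<le> b;
      disjoint_family_on (\<lambda>(s,t). {s<..<t}) P; (\<Sum>(s,t)\<in>P. t - s) < \<delta>\<rbrakk>
      \<Longrightarrow> (\<Sum>(s,t)\<in>P. dist (f s) (f t)) < \<epsilon>"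
    using assms unfolding abs_continuous_on_def by meson
  have *: "dist (f s) (f t) < \<epsilon>" if "a \<le> s" "s \<le> t" "t \<le> b" "t - s < \<delta>" for s t
    using \<delta>[of "{(s,t)}"] that by (simp add: disjoint_family_on_def)
  show "\<exists>d>0. \<forall>x'\<in>{a..b}. dist x' x < d \<longrightarrow> dist (f x') (f x) < \<epsilon>"
  proof (intro exI[of _ \<delta>] conjI \<open>\<delta> > 0\<close> ballI impI)
    fix y assume "y \<in> {a..b}" "dist y x < \<delta>"
    then show "dist (f y) (f x) < \<epsilon>"
      using *[of x y] *[of y x] x by (cases "x \<le> y") (auto simp: dist_real_def dist_commute)
  qed
qed

lemma abs_continuous_on_subset:
  assumes "abs_continuous_on a b f" "a \<le> c" "d \<le> b"
  shows "abs_continuous_on c d f"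
  unfolding abs_continuous_on_def
proof (intro allI impI)
  fix \<epsilon> :: real assume "\<epsilon> > 0"
  then obtain \<delta> where "\<delta> > 0" and \<delta>: "\<forall>P. finite P \<and> (\<forall>(s,t)\<in>P. a \<le> s \<and> s \<le> t \<and> t \<le> b) \<and>
      disjoint_family_on (\<lambda>(s,t). {s<..<t}) P \<and> (\<Sum>(s,t)\<in>P. t - s) < \<delta>
      \<longrightarrow> (\<Sum>(s,t)\<in>P. dist (f s) (f t)) < \<epsilon>"
    using assms(1) unfolding abs_continuous_on_def by meson
  then show "\<exists>\<delta>>0. \<forall>P. finite P \<and> (\<forall>(s,t)\<in>P. c \<le> s \<and> s \<le> t \<and> t \<le> d) \<and>
      disjoint_family_on (\<lambda>(s,t). {s<..<t}) P \<and> (\<Sum>(s,t)\<in>P. t - s) < \<delta>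
      \<longrightarrow> (\<Sum>(s,t)\<in>P. dist (f s) (f t)) < \<epsilon>"
    using assms(2,3) by (intro exI[of _ \<delta>]) (fastforce simp: case_prod_unfold)
qed

lemma has_vector_derivative_straddle:
  fixes f :: "real \<Rightarrow> 'a::real_normed_vector"
  assumes "(f has_vector_derivative v) (at t within {a..b})" and "\<epsilon> > 0"
  obtains \<delta> where "\<delta> > 0" "\<And>s s'. \<lbrakk>a \<le> s; s \<le> t; t \<le> s'; s' \<le> b; s' - s < \<delta>\<rbrakk>
     \<Longrightarrow> norm (f s' - f s - (s' - s) *\<^sub>R v) \<le> \<epsilon> * (s' - s)"
proof -
  obtain \<delta> where "\<delta> > 0" and \<delta>: "\<And>y. y \<in> {a..b} \<Longrightarrow> norm (y - t) < \<delta> \<Longrightarrow>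
      norm (f y - f t - (y - t) *\<^sub>R v) \<le> \<epsilon> * norm (y - t)"
    using assms unfolding has_vector_derivative_def has_derivative_within_alt by meson
  show thesis
  proof (rule that[OF \<open>\<delta> > 0\<close>])
    fix s s' assume s: "a \<le> s" "s \<le> t" "t \<le> s'" "s' \<le> b" "s' - s < \<delta>"
    have "norm (f s' - f s - (s' - s) *\<^sub>R v)
        = norm ((f s' - f t - (s' - t) *\<^sub>R v) - (f s - f t - (s - t) *\<^sub>R v))"
      by (rule arg_cong[where f=norm]) (simp add: algebra_simps)
    also have "\<dots> \<le> norm (f s' - f t - (s' - t) *\<^sub>R v) + norm (f s - f t - (s - t) *\<^sub>R v)"
      by (rule norm_triangle_ineq4)
    also have "\<dots> \<le> \<epsilon> * norm (s' - t) + \<epsilon> * norm (s - t)"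
      using s by (intro add_mono \<delta>) auto
    also have "\<dots> = \<epsilon> * (s' - s)" using s by (simp add: algebra_simps)
    finally show "norm (f s' - f s - (s' - s) *\<^sub>R v) \<le> \<epsilon> * (s' - s)" .
  qed
qed

text \<open>Project to the direction of \<open>f b - f a\<close>.\<close>
lemma abs_continuous_speed_bound:
  fixes f :: "real \<Rightarrow> 'a::real_inner"
  assumes "a \<le> b" and ac: "abs_continuous_on a b f" and "negligible N" and "M \<ge> 0"
    and deriv: "\<And>t. t \<in> {a..b} - N \<Longrightarrow>
      \<exists>v. (f has_vector_derivative v) (at t within {a..b}) \<and> norm v \<le> M"
  shows "norm (f b - f a) \<le> M * (b - a)"
proof -
  define e where "e = sgn (f b - f a)"
  have e: "norm e \<le> 1" by (simp add: e_def norm_sgn)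
  have ie: "z \<bullet> e \<le> norm z" for z
    using norm_cauchy_schwarz[of z e] mult_left_mono[OF e norm_ge_zero[of z]] by linarith
  define g where "g = (\<lambda>t. f t \<bullet> e)"
  have "g b - g a \<le> M * (b - a)"
  proof (rule abs_continuous_growth_bound[OF \<open>a \<le> b\<close> _ \<open>negligible N\<close> \<open>M \<ge> 0\<close>])
    have "dist (g s) (g t) \<le> 1 * dist (f s) (f t)" for s t
      using Cauchy_Schwarz_ineq2[of "f s - f t" e] mult_left_mono[OF e norm_ge_zero[of "f s - f t"]]
      by (simp add: g_def dist_norm inner_diff_left)
    then show "abs_continuous_on a b g"
      using abs_continuous_on_dominated[OF ac, of 1 g] by simp
    fix t \<epsilon> :: real assume t: "t \<in> {a..b} - N" and "\<epsilon> > 0"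
    obtain v where v: "(f has_vector_derivative v) (at t within {a..b})" "norm v \<le> M"
      using deriv[OF t] by blast
    obtain \<delta> where "\<delta> > 0" and \<delta>: "\<And>s s'. \<lbrakk>a \<le> s; s \<le> t; t \<le> s'; s' \<le> b; s' - s < \<delta>\<rbrakk>
       \<Longrightarrow> norm (f s' - f s - (s' - s) *\<^sub>R v) \<le> \<epsilon> * (s' - s)"
      using has_vector_derivative_straddle[OF v(1) \<open>\<epsilon> > 0\<close>] by metis
    have "g s' - g s \<le> (M + \<epsilon>) * (s' - s)"
      if s: "a \<le> s" "s \<le> t" "t \<le> s'" "s' \<le> b" "s' - s < \<delta>" for s s'
    proof -
      have "g s' - g s \<le> norm (f s' - f s)" using ie[of "f s' - f s"] by (simp add: g_def inner_diff_left)
      also have "\<dots> = norm ((f s' - f s - (s' - s) *\<^sub>R v) + (s' - s) *\<^sub>R v)" by simp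
      also have "\<dots> \<le> norm (f s' - f s - (s' - s) *\<^sub>R v) + norm ((s' - s) *\<^sub>R v)" by (rule norm_triangle_ineq)
      also have "\<dots> \<le> \<epsilon> * (s' - s) + (s' - s) * M"
        using \<delta>[OF s] s v(2) by (intro add_mono) (auto intro: mult_left_mono)
      finally show ?thesis by (simp add: algebra_simps)
    qed
    then show "\<exists>\<delta>>0. \<forall>s s'. a \<le> s \<and> s \<le> t \<and> t \<le> s' \<and> s' \<le> b \<and> s' - s < \<delta> \<longrightarrow>
       g s' - g s \<le> (M + \<epsilon>) * (s' - s)" using \<open>\<delta> > 0\<close> by blast
  qed
  moreover have "z \<bullet> sgn z = norm z" for z :: 'a
    by (cases "z = 0") (simp_all add: sgn_div_norm power2_norm_eq_inner[symmetric] power2_eq_square)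
  ultimately show ?thesis unfolding g_def e_def inner_diff_left[symmetric] by simp
qed

section \<open>Subunit paths\<close>

lemma locally_lipschitz_continuous:
  assumes "locally_lipschitz F"
  shows "continuous_on UNIV F"
proof (rule continuous_at_imp_continuous_on, rule ballI)
  fix x
  obtain e L where "e > 0" "L-lipschitz_on (cball x e) F"
    using assms unfolding locally_lipschitz_def by meson
  then have "continuous_on (cball x e) F" using lipschitz_on_continuous_on by blast
  then show "isCont F x" using \<open>e > 0\<close>
    by (metis centre_in_ball continuous_on_interior interior_cball)
qed

text \<open>A field is a time-dependent family that is constant in time, and for such families local
  Lipschitz constants are uniform on compact sets.\<close>
lemma locally_lipschitz_on_cball:
  fixes F :: "real^'n \<Rightarrow> real^'n"
  assumes "locally_lipschitz F"
  obtains L where "L-lipschitz_on (cball z R) F"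
proof -
  have "local_lipschitz {0::real} (UNIV :: (real^'n) set) (\<lambda>_. F)"
    unfolding local_lipschitz_def
  proof (intro ballI)
    fix x :: "real^'n" and t :: real
    obtain e L where "e > 0" "L-lipschitz_on (cball x e) F"
      using assms unfolding locally_lipschitz_def by meson
    then show "\<exists>u>0. \<exists>L. \<forall>t\<in>cball t u \<inter> {0}. L-lipschitz_on (cball x u \<inter> UNIV) F" by auto
  qed
  then have ll: "local_lipschitz {0::real} (cball z R) (\<lambda>_. F)"
    by (rule local_lipschitz_subset) auto
  obtain L where "\<And>t::real. t \<in> {0} \<Longrightarrow> L-lipschitz_on (cball z R) F"
    by (rule local_lipschitz_compact_implies_lipschitz[OF ll]) auto
  then show thesis using that by auto
qed

lemma subunit_velocity_bound:
  fixes X :: "'m::finite \<Rightarrow> real^'n \<Rightarrow> real^'n" and \<theta> :: "'m \<Rightarrow> real" and M :: real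
  assumes "(\<Sum>j\<in>UNIV. (\<theta> j)\<^sup>2) \<le> (1::real)" and "\<And>j. norm (X j x) \<le> (M::real)"
  shows "norm (\<Sum>j\<in>UNIV. \<theta> j *\<^sub>R X j x) \<le> CARD('m) * M"
proof -
  have "\<bar>\<theta> j\<bar> \<le> 1" for j
  proof -
    have "(\<theta> j)\<^sup>2 \<le> (\<Sum>j\<in>UNIV. (\<theta> j)\<^sup>2)" by (rule member_le_sum) auto
    then show ?thesis using assms(1) by (simp add: abs_square_le_1[symmetric])
  qed
  then have "norm (\<theta> j *\<^sub>R X j x) \<le> M" for j
    using assms(2)[of j] mult_left_le_one_le[of "norm (X j x)" "\<bar>\<theta> j\<bar>"] by simp
  then show ?thesis using sum_norm_bound[of UNIV "\<lambda>j. \<theta> j *\<^sub>R X j x" M] by simp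
qed

definition velocity_condition where
  "velocity_condition X T \<gamma> t \<longleftrightarrow> (\<exists>c::'m::finite \<Rightarrow> real. (\<Sum>j\<in>UNIV. (c j)\<^sup>2) \<le> 1 \<and>
     (\<gamma> has_vector_derivative (\<Sum>j\<in>UNIV. c j *\<^sub>R X j (\<gamma> t))) (at t within {0..T}))"

lemma AE_lebesgue_on_iff_negligible:
  fixes a b :: real
  shows "(AE t in lebesgue_on {a..b}. P t) \<longleftrightarrow> (\<exists>N. negligible N \<and> (\<forall>t\<in>{a..b}-N. P t))"
proof -
  have "(AE t in lebesgue_on {a..b}. P t) \<longleftrightarrow> (AE t in lebesgue. t \<in> {a..b} \<longrightarrow> P t)"
    by (subst AE_restrict_space_iff) auto
  also have "\<dots> \<longleftrightarrow> (\<exists>N. negligible N \<and> (\<forall>t\<in>{a..b}-N. P t))"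
  proof
    assume "AE t in lebesgue. t \<in> {a..b} \<longrightarrow> P t"
    then obtain N where "N \<in> null_sets lebesgue" "{t \<in> space lebesgue. \<not> (t \<in> {a..b} \<longrightarrow> P t)} \<subseteq> N"
      unfolding eventually_ae_filter by blast
    then show "\<exists>N. negligible N \<and> (\<forall>t\<in>{a..b}-N. P t)"
      by (intro exI[of _ N]) (auto simp: negligible_iff_null_sets)
  next
    assume "\<exists>N. negligible N \<and> (\<forall>t\<in>{a..b}-N. P t)"
    then obtain N where "negligible N" "\<forall>t\<in>{a..b}-N. P t" by blast
    then show "AE t in lebesgue. t \<in> {a..b} \<longrightarrow> P t"
      by (intro AE_I'[of N]) (auto simp: negligible_iff_null_sets)
  qed
  finally show ?thesis .
qed

text \<open>Since the vector fields are bounded on the compact range of a subunit path, such a path is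
  Lipschitz; this form is stable under reversing and joining paths.\<close>
lemma subunit_iff_lipschitz:
  fixes X :: "'m::finite \<Rightarrow> real^'n \<Rightarrow> real^'n"
  assumes X: "\<And>j. continuous_on UNIV (X j)"
  shows "subunit X T \<gamma> \<longleftrightarrow> (\<exists>L. L-lipschitz_on {0..T} \<gamma>) \<and>
     (\<exists>N. negligible N \<and> (\<forall>t\<in>{0..T}-N. velocity_condition X T \<gamma> t))"
    (is "?L \<longleftrightarrow> ?R")
proof
  assume ?L
  then obtain \<theta> where ac: "abs_continuous_on 0 T \<gamma>" and "AE t in lebesgue_on {0..T}.
        (\<gamma> has_vector_derivative (\<Sum>j\<in>UNIV. \<theta> j t *\<^sub>R X j (\<gamma> t))) (at t within {0..T})
        \<and> (\<Sum>j\<in>UNIV. (\<theta> j t)\<^sup>2) \<le> 1"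
    unfolding subunit_def by blast
  then obtain N where N: "negligible N"
    and \<theta>: "\<And>t. t \<in> {0..T}-N \<Longrightarrow> (\<gamma> has_vector_derivative (\<Sum>j\<in>UNIV. \<theta> j t *\<^sub>R X j (\<gamma> t))) (at t within {0..T})
        \<and> (\<Sum>j\<in>UNIV. (\<theta> j t)\<^sup>2) \<le> 1"
    unfolding AE_lebesgue_on_iff_negligible by blast
  have "compact (\<gamma> ` {0..T})"
    by (intro compact_continuous_image abs_continuous_on_imp_continuous_on[OF ac] compact_Icc)
  then have "compact (X j ` \<gamma> ` {0..T})" for j
    by (rule compact_continuous_image[OF continuous_on_subset[OF X subset_UNIV]])
  then have "compact (\<Union>j. X j ` \<gamma> ` {0..T})" by (intro compact_UN) auto
  then obtain M where "M > 0" and M: "\<And>j t. t \<in> {0..T} \<Longrightarrow> norm (X j (\<gamma> t)) \<le> M"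
    by (auto dest!: compact_imp_bounded simp: bounded_pos)
  have bd: "norm (\<Sum>j\<in>UNIV. \<theta> j t *\<^sub>R X j (\<gamma> t)) \<le> CARD('m) * M" if "t \<in> {0..T}-N" for t
    using subunit_velocity_bound[where \<theta>="\<lambda>j. \<theta> j t" and X=X and x="\<gamma> t" and M=M] \<theta>[OF that] M that by auto
  have le: "norm (\<gamma> t - \<gamma> s) \<le> (CARD('m) * M) * (t - s)" if "0 \<le> s" "s \<le> t" "t \<le> T" for s t
  proof (rule abs_continuous_speed_bound[OF \<open>s \<le> t\<close> _ N])
    show "abs_continuous_on s t \<gamma>" by (rule abs_continuous_on_subset[OF ac]) (use that in auto)
    fix r assume "r \<in> {s..t} - N"
    then have r: "r \<in> {0..T} - N" using that by auto
    have "{s..t} \<subseteq> {0..T}" using that by auto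
    then show "\<exists>v. (\<gamma> has_vector_derivative v) (at r within {s..t}) \<and> norm v \<le> CARD('m) * M"
      using \<theta>[OF r] bd[OF r] has_vector_derivative_within_subset by blast
  qed (use \<open>M > 0\<close> in auto)
  have "(CARD('m) * M)-lipschitz_on {0..T} \<gamma>"
  proof (rule lipschitz_onI)
    fix s t assume "s \<in> {0..T}" "t \<in> {0..T}"
    then show "dist (\<gamma> s) (\<gamma> t) \<le> CARD('m) * M * dist s t"
      using le[of s t] le[of t s] by (cases "s \<le> t") (auto simp: dist_norm norm_minus_commute)
  qed (use \<open>M > 0\<close> in auto)
  moreover have "velocity_condition X T \<gamma> t" if "t \<in> {0..T}-N" for t
    using \<theta>[OF that] unfolding velocity_condition_def by (intro exI[of _ "\<lambda>j. \<theta> j t"]) blast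
  ultimately show ?R using N by blast
next
  assume ?R
  then obtain L N where L: "L-lipschitz_on {0..T} \<gamma>" and N: "negligible N"
    and v: "\<forall>t\<in>{0..T}-N. velocity_condition X T \<gamma> t" by blast
  then obtain c where "\<And>t. t \<in> {0..T}-N \<Longrightarrow> (\<Sum>j\<in>UNIV. (c t j)\<^sup>2) \<le> 1 \<and>
     (\<gamma> has_vector_derivative (\<Sum>j\<in>UNIV. c t j *\<^sub>R X j (\<gamma> t))) (at t within {0..T})"
    unfolding velocity_condition_def by metis
  then have "AE t in lebesgue_on {0..T}.
        (\<gamma> has_vector_derivative (\<Sum>j\<in>UNIV. (\<lambda>j t. c t j) j t *\<^sub>R X j (\<gamma> t))) (at t within {0..T})
        \<and> (\<Sum>j\<in>UNIV. ((\<lambda>j t. c t j) j t)\<^sup>2) \<le> 1"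
    unfolding AE_lebesgue_on_iff_negligible using N by blast
  then show ?L using lipschitz_imp_abs_continuous_on[OF L]
    unfolding subunit_def by (intro conjI exI[of _ "\<lambda>j t. c t j"])
qed

lemma subunit_const:
  fixes X :: "'m::finite \<Rightarrow> real^'n \<Rightarrow> real^'n"
  assumes X: "\<And>j. continuous_on UNIV (X j)"
  shows "subunit X T (\<lambda>_. x)"
proof -
  have "velocity_condition X T (\<lambda>_. x) t" for t
    unfolding velocity_condition_def by (intro exI[of _ "\<lambda>_. 0"]) auto
  moreover have "0-lipschitz_on {0..T} (\<lambda>_. x)" by (intro lipschitz_onI) auto
  ultimately show ?thesis using subunit_iff_lipschitz[of X, OF X] negligible_empty by blast
qed

lemma subunit_reverse:
  fixes X :: "'m::finite \<Rightarrow> real^'n \<Rightarrow> real^'n"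
  assumes X: "\<And>j. continuous_on UNIV (X j)" and "subunit X T \<gamma>"
  shows "subunit X T (\<lambda>t. \<gamma> (T - t))"
proof -
  obtain L N where L: "L-lipschitz_on {0..T} \<gamma>" and N: "negligible N"
    and v: "\<And>t. t\<in>{0..T}-N \<Longrightarrow> velocity_condition X T \<gamma> t"
    using assms(2) unfolding subunit_iff_lipschitz[of X, OF X] by blast
  have "L-lipschitz_on {0..T} (\<lambda>t. \<gamma> (T - t))"
  proof (rule lipschitz_onI)
    fix s t assume "s \<in> {0..T}" "t \<in> {0..T}"
    then show "dist (\<gamma> (T - s)) (\<gamma> (T - t)) \<le> L * dist s t"
      using lipschitz_onD[OF L, of "T - s" "T - t"] by (auto simp: dist_real_def abs_minus_commute)
  qed (use L lipschitz_on_nonneg in blast)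
  moreover have "velocity_condition X T (\<lambda>t. \<gamma> (T - t)) t" if "t \<in> {0..T} - (\<lambda>t. T - t) ` N" for t
  proof -
    have "T - t \<in> {0..T} - N" using that by (auto simp: image_iff)
    then obtain c where c: "(\<Sum>j\<in>UNIV. (c j)\<^sup>2) \<le> 1"
     "(\<gamma> has_vector_derivative (\<Sum>j\<in>UNIV. c j *\<^sub>R X j (\<gamma> (T - t)))) (at (T - t) within {0..T})"
      using v unfolding velocity_condition_def by blast
    have im: "(\<lambda>t. T - t) ` {0..T} = {0..T}" by (auto simp: image_iff intro: bexI[of _ "T - _"])
    have "((\<lambda>t. T - t) has_vector_derivative - 1) (at t within {0..T})"
      by (auto intro!: derivative_eq_intros)
    from vector_diff_chain_within[OF this, of \<gamma>] c(2)
    have "((\<gamma> \<circ> (\<lambda>t. T - t)) has_vector_derivative (- 1) *\<^sub>R (\<Sum>j\<in>UNIV. c j *\<^sub>R X j (\<gamma> (T - t)))) (at t within {0..T})"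
      unfolding im by blast
    moreover have "(- 1) *\<^sub>R (\<Sum>j\<in>UNIV. c j *\<^sub>R X j (\<gamma> (T - t))) = (\<Sum>j\<in>UNIV. (- c j) *\<^sub>R X j (\<gamma> (T - t)))"
      by (simp add: sum_negf)
    ultimately show ?thesis using c(1) unfolding velocity_condition_def
      by (intro exI[of _ "\<lambda>j. - c j"]) (auto simp: o_def)
  qed
  moreover have "negligible ((\<lambda>t. T - t) ` N)"
    using N by (intro negligible_differentiable_image_negligible) (auto intro!: derivative_intros)
  ultimately show ?thesis using subunit_iff_lipschitz[of X, OF X] by blast
qed

lemma subunit_join:
  fixes X :: "'m::finite \<Rightarrow> real^'n \<Rightarrow> real^'n"
  assumes X: "\<And>j. continuous_on UNIV (X j)" and 1: "subunit X S \<gamma>" and 2: "subunit X T \<eta>"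
    and "S > 0" "T > 0" and eq: "\<gamma> S = \<eta> 0"
  shows "subunit X (S + T) (\<lambda>t. if t \<le> S then \<gamma> t else \<eta> (t - S))" (is "subunit X _ ?f")
proof -
  obtain L N where L: "L-lipschitz_on {0..S} \<gamma>" and N: "negligible N"
    and v: "\<And>t. t\<in>{0..S}-N \<Longrightarrow> velocity_condition X S \<gamma> t"
    using 1 unfolding subunit_iff_lipschitz[of X, OF X] by blast
  obtain L' N' where L': "L'-lipschitz_on {0..T} \<eta>" and N': "negligible N'"
    and v': "\<And>t. t\<in>{0..T}-N' \<Longrightarrow> velocity_condition X T \<eta> t"
    using 2 unfolding subunit_iff_lipschitz[of X, OF X] by blast
  define K where "K = max L L'"
  have K: "K-lipschitz_on {0..S} \<gamma>" "K-lipschitz_on {0..T} \<eta>"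
    using L L' by (auto simp: K_def intro: lipschitz_on_le)
  have "K-lipschitz_on {S..S+T} (\<lambda>t. \<eta> (t - S))"
  proof (rule lipschitz_onI)
    fix s t assume "s \<in> {S..S+T}" "t \<in> {S..S+T}"
    then show "dist (\<eta> (s - S)) (\<eta> (t - S)) \<le> K * dist s t"
      using lipschitz_onD[OF K(2), of "s - S" "t - S"] by (auto simp: dist_real_def)
  qed (use K lipschitz_on_nonneg in blast)
  then have lip: "K-lipschitz_on {0..S+T} ?f"
    using lipschitz_on_concat[OF K(1)] eq by simp
  define Z where "Z = N \<union> (\<lambda>t. t + S) ` N' \<union> {S}"
  have "negligible ((\<lambda>t. t + S) ` N')"
    using N' by (intro negligible_differentiable_image_negligible) (auto intro!: derivative_intros)
  then have Z: "negligible Z" using N by (auto simp: Z_def)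
  have "velocity_condition X (S + T) ?f t" if t: "t \<in> {0..S+T} - Z" for t
  proof (cases "t < S")
    case True
    then have "velocity_condition X S \<gamma> t" using t v by (auto simp: Z_def)
    then obtain c where c: "(\<Sum>j\<in>UNIV. (c j)\<^sup>2) \<le> 1"
     "(\<gamma> has_vector_derivative (\<Sum>j\<in>UNIV. c j *\<^sub>R X j (\<gamma> t))) (at t within {0..S})"
      unfolding velocity_condition_def by blast
    have "at t within {0..S} = at t within {0..S+T}"
      by (rule at_within_nhd[of _ "{..<S}"]) (use True \<open>T > 0\<close> in auto)
    then have "(\<gamma> has_vector_derivative (\<Sum>j\<in>UNIV. c j *\<^sub>R X j (\<gamma> t))) (at t within {0..S+T})"
      using c(2) by simp
    then have "(?f has_vector_derivative (\<Sum>j\<in>UNIV. c j *\<^sub>R X j (\<gamma> t))) (at t within {0..S+T})"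
      by (rule has_vector_derivative_transform_within[where d="S - t"])
         (use True t in \<open>auto simp: dist_real_def\<close>)
    then show ?thesis using c(1) True unfolding velocity_condition_def by auto
  next
    case False
    then have tS: "t > S" using t by (auto simp: Z_def)
    then have "t - S \<in> {0..T} - N'" using t by (auto simp: Z_def image_iff)
    then have "velocity_condition X T \<eta> (t - S)" using v' by auto
    then obtain c where c: "(\<Sum>j\<in>UNIV. (c j)\<^sup>2) \<le> 1"
     "(\<eta> has_vector_derivative (\<Sum>j\<in>UNIV. c j *\<^sub>R X j (\<eta> (t - S)))) (at (t - S) within {0..T})"
      unfolding velocity_condition_def by blast
    have im: "(\<lambda>t. t - S) ` {S..S+T} = {0..T}" by (auto simp: image_iff intro: bexI[of _ "_ + S"])
    have "((\<lambda>t. t - S) has_vector_derivative 1) (at t within {S..S+T})"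
      by (auto intro!: derivative_eq_intros)
    from vector_diff_chain_within[OF this, of \<eta>] c(2)
    have "((\<eta> \<circ> (\<lambda>t. t - S)) has_vector_derivative (\<Sum>j\<in>UNIV. c j *\<^sub>R X j (\<eta> (t - S)))) (at t within {S..S+T})"
      unfolding im by simp
    moreover have "at t within {S..S+T} = at t within {0..S+T}"
      by (rule at_within_nhd[of _ "{S<..}"]) (use tS \<open>S > 0\<close> in auto)
    ultimately have "((\<lambda>t. \<eta> (t - S)) has_vector_derivative (\<Sum>j\<in>UNIV. c j *\<^sub>R X j (\<eta> (t - S)))) (at t within {0..S+T})"
      by (simp add: o_def)
    then have "(?f has_vector_derivative (\<Sum>j\<in>UNIV. c j *\<^sub>R X j (\<eta> (t - S)))) (at t within {0..S+T})"
      by (rule has_vector_derivative_transform_within[where d="t - S"])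
         (use tS t in \<open>auto simp: dist_real_def\<close>)
    then show ?thesis using c(1) tS unfolding velocity_condition_def by auto
  qed
  then show ?thesis using lip Z subunit_iff_lipschitz[of X, OF X] by blast
qed

section \<open>The control metric\<close>

text \<open>The standing assumptions. The empty set, for which all integrals vanish, is set aside.\<close>
locale cc_space =
  fixes X :: "'m::finite \<Rightarrow> real^'n \<Rightarrow> real^'n" and \<Omega> :: "(real^'n) set" and Q :: real
  assumes open_domain: "open \<Omega>" and bounded_domain: "bounded \<Omega>" and nonempty_domain: "\<Omega> \<noteq> {}"
    and lipschitz_fields: "\<And>j. locally_lipschitz (X j)"
    and connected_by_subunit: "subunit_connected X \<Omega>"
    and dist_continuous: "cc_continuous X \<Omega>"
    and dimension_gt_2: "Q > 2"
    and doubling: "cc_doubling X \<Omega> Q"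
    and poincare: "cc_poincare X \<Omega>"
begin

abbreviation "d \<equiv> cc_dist X"
abbreviation "B \<equiv> cc_ball X \<Omega>"

lemma continuous_fields: "continuous_on UNIV (X j)"
  using lipschitz_fields locally_lipschitz_continuous by blast

lemma subunit_path_ex:
  assumes "x \<in> \<Omega>" "y \<in> \<Omega>"
  shows "{T. T > 0 \<and> (\<exists>\<gamma>. subunit X T \<gamma> \<and> \<gamma> 0 = x \<and> \<gamma> T = y)} \<noteq> {}"
  using connected_by_subunit assms unfolding subunit_connected_def by blast

lemma bdd_below_times: "bdd_below {T::real. T > 0 \<and> P T}"
  by (rule bdd_belowI[of _ 0]) auto

lemma dist_le_time:
  assumes "T > 0" "subunit X T \<gamma>" "\<gamma> 0 = x" "\<gamma> T = y"
  shows "d x y \<le> T"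
  unfolding cc_dist_def using assms by (intro cInf_lower bdd_below_times) blast

lemma dist_lessD:
  assumes "x \<in> \<Omega>" "y \<in> \<Omega>" "d x y < r"
  obtains T \<gamma> where "0 < T" "T < r" "subunit X T \<gamma>" "\<gamma> 0 = x" "\<gamma> T = y"
  using cInf_lessD[OF subunit_path_ex[OF assms(1,2)]] assms(3) unfolding cc_dist_def by blast

lemma dist_nonneg: "x \<in> \<Omega> \<Longrightarrow> y \<in> \<Omega> \<Longrightarrow> 0 \<le> d x y"
  unfolding cc_dist_def by (intro cInf_greatest subunit_path_ex) auto

lemma dist_self:
  assumes "x \<in> \<Omega>" shows "d x x = 0"
proof (rule antisym)
  show "d x x \<le> 0"
  proof (rule field_le_epsilon)
    fix e :: real assume "e > 0"
    then show "d x x \<le> 0 + e"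
      using dist_le_time[OF _ subunit_const[of X, OF continuous_fields], of e x x x] by simp
  qed
qed (use assms dist_nonneg in blast)

lemma dist_sym: "d x y = d y x"
proof -
  have "{T. T > 0 \<and> (\<exists>\<gamma>. subunit X T \<gamma> \<and> \<gamma> 0 = x \<and> \<gamma> T = y)}
     \<subseteq> {T. T > 0 \<and> (\<exists>\<gamma>. subunit X T \<gamma> \<and> \<gamma> 0 = y \<and> \<gamma> T = x)}" for x y
  proof clarify
    fix T \<gamma> assume "subunit X T \<gamma>"
    then have "subunit X T (\<lambda>t. \<gamma> (T - t))" by (rule subunit_reverse[of X, OF continuous_fields])
    then show "\<exists>\<eta>. subunit X T \<eta> \<and> \<eta> 0 = \<gamma> T \<and> \<eta> T = \<gamma> 0"
      by (intro exI[of _ "\<lambda>t. \<gamma> (T - t)"]) simp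
  qed
  then have "{T. T > 0 \<and> (\<exists>\<gamma>. subunit X T \<gamma> \<and> \<gamma> 0 = x \<and> \<gamma> T = y)}
     = {T. T > 0 \<and> (\<exists>\<gamma>. subunit X T \<gamma> \<and> \<gamma> 0 = y \<and> \<gamma> T = x)}" by blast
  then show ?thesis unfolding cc_dist_def by simp
qed

lemma dist_triangle_cc:
  assumes x: "x \<in> \<Omega>" and y: "y \<in> \<Omega>" and z: "z \<in> \<Omega>"
  shows "d x z \<le> d x y + d y z"
proof (rule field_le_epsilon)
  fix e :: real assume "e > 0"
  have "d x y < d x y + e/2" "d y z < d y z + e/2" using \<open>e > 0\<close> by auto
  obtain S \<gamma> where S: "0 < S" "S < d x y + e/2" "subunit X S \<gamma>" "\<gamma> 0 = x" "\<gamma> S = y"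
    using dist_lessD[OF x y \<open>d x y < d x y + e/2\<close>] .
  obtain T \<eta> where T: "0 < T" "T < d y z + e/2" "subunit X T \<eta>" "\<eta> 0 = y" "\<eta> T = z"
    using dist_lessD[OF y z \<open>d y z < d y z + e/2\<close>] .
  have "d x z \<le> S + T"
    using dist_le_time[OF _ subunit_join[of X, OF continuous_fields S(3) T(3)], of x z] S T by simp
  then show "d x z \<le> d x y + d y z + e" using S T by simp
qed

lemma mem_ball_cc: "y \<in> B x r \<longleftrightarrow> y \<in> \<Omega> \<and> d x y < r"
  by (simp add: cc_ball_def)

lemma ball_subset_domain: "B x r \<subseteq> \<Omega>"
  by (auto simp: mem_ball_cc)

lemma ball_mono: "r \<le> s \<Longrightarrow> B x r \<subseteq> B x s"
  by (auto simp: mem_ball_cc)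

lemma centre_in_ball_cc: "x \<in> \<Omega> \<Longrightarrow> r > 0 \<Longrightarrow> x \<in> B x r"
  by (simp add: mem_ball_cc dist_self)

text \<open>Control balls are Borel sets because the control distance is continuous for the Euclidean
  topology.\<close>
lemma open_ball_cc:
  assumes x: "x \<in> \<Omega>"
  shows "open (B x r)"
  unfolding open_contains_ball
proof
  fix y assume "y \<in> B x r"
  then have y: "y \<in> \<Omega>" "r - d x y > 0" by (auto simp: mem_ball_cc)
  have "(d y \<longlongrightarrow> 0) (at y within \<Omega>)" using dist_continuous y unfolding cc_continuous_def by blast
  then have "\<forall>\<^sub>F z in at y within \<Omega>. dist (d y z) 0 < r - d x y" using y(2) by (rule tendstoD)
  then obtain \<delta> where "\<delta> > 0" and \<delta>: "\<And>z. z \<in> \<Omega> \<Longrightarrow> z \<noteq> y \<Longrightarrow> dist z y < \<delta> \<Longrightarrow> dist (d y z) 0 < r - d x y"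
    unfolding eventually_at by blast
  obtain \<epsilon> where "\<epsilon> > 0" and \<epsilon>: "ball y \<epsilon> \<subseteq> \<Omega>" using open_domain y(1) open_contains_ball by blast
  have "ball y (min \<delta> \<epsilon>) \<subseteq> B x r"
  proof
    fix z assume "z \<in> ball y (min \<delta> \<epsilon>)"
    then have z: "z \<in> \<Omega>" "dist z y < \<delta>" using \<epsilon> by (auto simp: dist_commute)
    show "z \<in> B x r"
    proof (cases "z = y")
      case False
      then have "d y z < r - d x y" using \<delta>[OF z(1) _ z(2)] by (simp add: dist_real_def)
      then show ?thesis using z dist_triangle_cc[OF x y(1) z(1)] by (simp add: mem_ball_cc)
    qed (use \<open>y \<in> B x r\<close> in simp)
  qed
  then show "\<exists>e>0. ball y e \<subseteq> B x r" using \<open>\<delta> > 0\<close> \<open>\<epsilon> > 0\<close> by (intro exI[of _ "min \<delta> \<epsilon>"]) auto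
qed

text \<open>A subunit path needs time proportional to the Euclidean distance that it covers, because it
  moves with bounded speed as long as it has not left a fixed neighbourhood.\<close>
lemma small_ball_in_euclidean_ball:
  assumes x: "x \<in> \<Omega>" and "\<eta> > 0"
  obtains r where "r > 0" "B x r \<subseteq> ball x \<eta>"
proof -
  have "compact (X j ` cball x \<eta>)" for j
    by (intro compact_continuous_image continuous_on_subset[OF continuous_fields subset_UNIV] compact_cball)
  then have "compact (\<Union>j. X j ` cball x \<eta>)" by (intro compact_UN) auto
  then obtain M where "M > 0" and M: "\<And>j y. y \<in> cball x \<eta> \<Longrightarrow> norm (X j y) \<le> M"
    by (auto dest!: compact_imp_bounded simp: bounded_pos)
  define K where "K = CARD('m) * M"
  have "K > 0" using \<open>M > 0\<close> by (simp add: K_def)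
  have "B x (\<eta> / K) \<subseteq> ball x \<eta>"
  proof
    fix y assume "y \<in> B x (\<eta> / K)"
    then have y: "y \<in> \<Omega>" "d x y < \<eta> / K" by (auto simp: mem_ball_cc)
    obtain T \<gamma> where T: "0 < T" "T < \<eta> / K" "subunit X T \<gamma>" "\<gamma> 0 = x" "\<gamma> T = y"
      using dist_lessD[OF x y] .
    obtain N where N: "negligible N" and v: "\<And>t. t\<in>{0..T}-N \<Longrightarrow> velocity_condition X T \<gamma> t"
      using T(3) unfolding subunit_iff_lipschitz[of X, OF continuous_fields] by blast
    have ac: "abs_continuous_on 0 T \<gamma>" using T(3) unfolding subunit_def by blast
    show "y \<in> ball x \<eta>"
    proof (rule ccontr)
      assume "y \<notin> ball x \<eta>"
      define S where "S = {t\<in>{0..T}. dist x (\<gamma> t) \<in> {\<eta>..}}"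
      have "continuous_on {0..T} (\<lambda>t. dist x (\<gamma> t))"
        using abs_continuous_on_imp_continuous_on[OF ac] by (intro continuous_intros)
      then have "closed S"
        unfolding S_def using continuous_closed_preimage[of "{0..T}" _ "{\<eta>..}"]
        by (simp add: vimage_def Int_def)
      then have "compact S" by (auto simp: compact_eq_bounded_closed S_def intro: bounded_subset[of "{0..T}"])
      moreover have "T \<in> S" using T \<open>y \<notin> ball x \<eta>\<close> by (simp add: S_def)
      ultimately obtain t1 where t1: "t1 \<in> S" "\<And>t. t \<in> S \<Longrightarrow> t1 \<le> t"
        using compact_attains_inf[of S] by blast
      have before: "\<gamma> t \<in> cball x \<eta>" if "0 \<le> t" "t < t1" for t
      proof -
        have "t \<notin> S" using t1(2)[of t] that by auto
        then show ?thesis using that t1(1) by (auto simp: S_def)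
      qed
      have "norm (\<gamma> t1 - \<gamma> 0) \<le> K * (t1 - 0)"
      proof (rule abs_continuous_speed_bound)
        show "0 \<le> t1" using t1 by (simp add: S_def)
        show "abs_continuous_on 0 t1 \<gamma>" by (rule abs_continuous_on_subset[OF ac]) (use t1(1) in \<open>auto simp: S_def\<close>)
        show "negligible (insert t1 N)" using N by simp
        show "K \<ge> 0" using \<open>K > 0\<close> by simp
        fix t assume "t \<in> {0..t1} - insert t1 N"
        then have t: "t \<in> {0..T} - N" "0 \<le> t" "t < t1" using t1 by (auto simp: S_def)
        obtain c where c: "(\<Sum>j\<in>UNIV. (c j)\<^sup>2) \<le> 1"
          "(\<gamma> has_vector_derivative (\<Sum>j\<in>UNIV. c j *\<^sub>R X j (\<gamma> t))) (at t within {0..T})"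
          using v[OF t(1)] unfolding velocity_condition_def by blast
        have "norm (\<Sum>j\<in>UNIV. c j *\<^sub>R X j (\<gamma> t)) \<le> K"
          unfolding K_def using c(1) M before[OF t(2,3)] by (intro subunit_velocity_bound) auto
        moreover have "{0..t1} \<subseteq> {0..T}" using t1(1) by (auto simp: S_def)
        ultimately show "\<exists>v. (\<gamma> has_vector_derivative v) (at t within {0..t1}) \<and> norm v \<le> K"
          using c(2) has_vector_derivative_within_subset by blast
      qed
      moreover have "\<eta> \<le> norm (\<gamma> t1 - \<gamma> 0)" using t1(1) T(4) by (simp add: S_def dist_norm norm_minus_commute)
      moreover have "K * t1 \<le> K * T" using t1(1) \<open>K > 0\<close> by (simp add: S_def)
      moreover have "K * T < \<eta>" using T(2) \<open>K > 0\<close> by (simp add: field_simps)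
      ultimately show False by simp
    qed
  qed
  then show thesis using that[of "\<eta> / K"] \<open>\<eta> > 0\<close> \<open>K > 0\<close> by simp
qed

lemma domain_lmeasurable: "\<Omega> \<in> lmeasurable"
  using open_domain bounded_domain by (simp add: bounded_set_imp_lmeasurable borel_open)

lemma ball_lmeasurable: "x \<in> \<Omega> \<Longrightarrow> B x r \<in> lmeasurable"
  by (intro bounded_set_imp_lmeasurable bounded_subset[OF bounded_domain ball_subset_domain])
     (simp add: open_ball_cc borel_open)

lemma ball_measure_pos: "x \<in> \<Omega> \<Longrightarrow> r > 0 \<Longrightarrow> 0 < measure lebesgue (B x r)"
  using doubling unfolding cc_doubling_def by (auto dest!: bspec[of _ _ x] spec[of _ "r/2"])

lemma ball_doubling:
  "x \<in> \<Omega> \<Longrightarrow> r > 0 \<Longrightarrow> measure lebesgue (B x (2 * r)) \<le> 2 powr Q * measure lebesgue (B x r)"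
  using doubling unfolding cc_doubling_def by blast

lemma domain_measure_pos: "0 < measure lebesgue \<Omega>"
proof -
  obtain x where x: "x \<in> \<Omega>" using nonempty_domain by blast
  have "measure lebesgue (B x 1) \<le> measure lebesgue \<Omega>"
    using ball_subset_domain ball_lmeasurable[OF x] domain_lmeasurable
    by (intro measure_mono_fmeasurable) auto
  then show ?thesis using ball_measure_pos[OF x, of 1] by simp
qed

text \<open>A doubling measure of finite mass lives on a bounded space: a ball around a far away point
  would have a fixed share of the mass but be contained in the complement of a huge ball.\<close>
lemma dist_bounded:
  obtains D where "D > 0" "\<And>x y. x \<in> \<Omega> \<Longrightarrow> y \<in> \<Omega> \<Longrightarrow> d x y < D"
proof -
  obtain x0 where x0: "x0 \<in> \<Omega>" using nonempty_domain by blast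
  define K where "K = 2 powr Q"
  have "K > 0" by (simp add: K_def)
  define c where "c = measure lebesgue (B x0 1)"
  have "c > 0" using ball_measure_pos[OF x0, of 1] by (simp add: c_def)
  have "(\<lambda>n::nat. measure lebesgue (B x0 (real n))) \<longlonglongrightarrow> measure lebesgue (\<Union>n::nat. B x0 (real n))"
  proof (rule Lim_measure_incseq)
    show "range (\<lambda>n::nat. B x0 (real n)) \<subseteq> sets lebesgue"
      using ball_lmeasurable[OF x0] by auto
    show "incseq (\<lambda>n::nat. B x0 (real n))" by (auto simp: incseq_def mem_ball_cc)
    have "emeasure lebesgue (\<Union>n::nat. B x0 (real n)) \<le> emeasure lebesgue \<Omega>"
      using ball_subset_domain domain_lmeasurable by (intro emeasure_mono) auto
    then show "emeasure lebesgue (\<Union>n::nat. B x0 (real n)) \<noteq> \<infinity>"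
      using domain_lmeasurable by (auto simp: fmeasurable_def top.extremum_strict less_top[symmetric] top_unique)
  qed
  moreover have "(\<Union>n::nat. B x0 (real n)) = \<Omega>"
    using reals_Archimedean2 by (auto simp: mem_ball_cc)
  ultimately have "\<forall>\<^sub>F n in sequentially. dist (measure lebesgue (B x0 (real n))) (measure lebesgue \<Omega>) < c / K\<^sup>2"
    using tendstoD \<open>c > 0\<close> \<open>K > 0\<close> by fastforce
  then obtain n :: nat where n: "n \<ge> 1" "dist (measure lebesgue (B x0 (real n))) (measure lebesgue \<Omega>) < c / K\<^sup>2"
    unfolding eventually_sequentially by (metis nat_le_linear order_refl)
  have near: "d x0 y < 2 * n" if y: "y \<in> \<Omega>" for y
  proof (rule ccontr)
    assume "\<not> d x0 y < 2 * n"
    define \<rho> where "\<rho> = d x0 y"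
    have \<rho>: "\<rho> \<ge> 2 * n" "\<rho> > 1" "\<rho> > 0" using \<open>\<not> d x0 y < 2 * n\<close> n(1) by (auto simp: \<rho>_def)
    have sub: "B y (\<rho>/2) \<subseteq> \<Omega> - B x0 n"
    proof
      fix z assume "z \<in> B y (\<rho>/2)"
      then have z: "z \<in> \<Omega>" "d y z < \<rho>/2" by (auto simp: mem_ball_cc)
      have "\<rho> \<le> d x0 z + d y z" using dist_triangle_cc[OF x0 z(1) y] by (simp add: \<rho>_def dist_sym)
      then show "z \<in> \<Omega> - B x0 n" using z \<rho> by (auto simp: mem_ball_cc)
    qed
    have "measure lebesgue (B y (\<rho>/2)) \<le> measure lebesgue (\<Omega> - B x0 n)"
      using sub ball_lmeasurable[OF x0] ball_lmeasurable[OF y] domain_lmeasurable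
      by (intro measure_mono_fmeasurable) (auto simp: fmeasurable.Diff)
    also have "\<dots> = measure lebesgue \<Omega> - measure lebesgue (B x0 n)"
      using ball_lmeasurable[OF x0] domain_lmeasurable ball_subset_domain
      by (intro measurable_measure_Diff) auto
    finally have 1: "measure lebesgue (B y (\<rho>/2)) < c / K\<^sup>2" using n(2) by (auto simp: dist_real_def)
    have "B x0 1 \<subseteq> B y (2 * \<rho>)"
    proof
      fix z assume "z \<in> B x0 1"
      then have z: "z \<in> \<Omega>" "d x0 z < 1" by (auto simp: mem_ball_cc)
      have "d y z \<le> \<rho> + d x0 z" using dist_triangle_cc[OF y x0 z(1)] by (simp add: \<rho>_def dist_sym)
      then show "z \<in> B y (2 * \<rho>)" using z \<rho> by (auto simp: mem_ball_cc)
    qed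
    then have "c \<le> measure lebesgue (B y (2 * \<rho>))"
      unfolding c_def using ball_lmeasurable[OF x0] ball_lmeasurable[OF y]
      by (intro measure_mono_fmeasurable) auto
    also have "\<dots> \<le> K * measure lebesgue (B y \<rho>)" using ball_doubling[OF y \<rho>(3)] by (simp add: K_def)
    also have "\<dots> \<le> K * (K * measure lebesgue (B y (\<rho>/2)))"
      using ball_doubling[OF y, of "\<rho>/2"] \<rho>(3) \<open>K > 0\<close> by (intro mult_left_mono) (auto simp: K_def)
    finally show False using 1 \<open>K > 0\<close> by (simp add: power2_eq_square field_simps)
  qed
  show thesis
  proof (rule that[of "4 * real n"])
    show "d x y < 4 * real n" if "x \<in> \<Omega>" "y \<in> \<Omega>" for x y
      using dist_triangle_cc[OF that(1) x0 that(2)] near[OF that(1)] near[OF that(2)] by (simp add: dist_sym)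
  qed (use n in auto)
qed

text \<open>The lower bound \<open>|B(x,r)| \<ge> c r powr Q\<close> on the measure of balls, which makes \<open>Q\<close> the dimension:
  double the radius until the ball is all of \<open>\<Omega>\<close>, which takes about \<open>log 2 (R / r)\<close> steps.\<close>
lemma domain_measure_le_ball:
  assumes x: "x \<in> \<Omega>" and r: "0 < r" "r \<le> R" and R: "B x R = \<Omega>"
  shows "measure lebesgue \<Omega> \<le> (2 * R / r) powr Q * measure lebesgue (B x r)"
proof -
  define k where "k = nat \<lceil>log 2 (R / r)\<rceil>"
  have iter: "measure lebesgue (B x (2 ^ k * r)) \<le> (2 powr Q) ^ k * measure lebesgue (B x r)" for k
  proof (induction k)
    case (Suc k)
    have "measure lebesgue (B x (2 ^ Suc k * r)) \<le> 2 powr Q * measure lebesgue (B x (2 ^ k * r))"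
      using ball_doubling[OF x, of "2 ^ k * r"] r by (simp add: mult.assoc)
    also have "\<dots> \<le> 2 powr Q * ((2 powr Q) ^ k * measure lebesgue (B x r))"
      using Suc by (intro mult_left_mono) auto
    finally show ?case by (simp add: mult.assoc)
  qed simp
  have log0: "0 \<le> log 2 (R / r)" using r by (simp add: zero_le_log_cancel_iff)
  have kl: "log 2 (R / r) \<le> real k" "real k < log 2 (R / r) + 1" using log0 unfolding k_def by linarith+
  have "R / r = 2 powr log 2 (R / r)" using r by simp
  also have "\<dots> \<le> 2 powr real k" using kl by (intro powr_mono) auto
  finally have "R \<le> 2 ^ k * r" using r by (simp add: powr_realpow field_simps)
  then have full: "B x (2 ^ k * r) = \<Omega>" using R ball_mono[of R "2^k*r" x] ball_subset_domain[of x] by auto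
  have "2 powr real k \<le> 2 powr (log 2 (R / r) + 1)" using kl by (intro powr_mono) auto
  also have "\<dots> = 2 * R / r" using r by (simp add: powr_add)
  finally have "2 powr real k \<le> 2 * R / r" .
  then have "(2 powr real k) powr Q \<le> (2 * R / r) powr Q"
    using dimension_gt_2 by (intro powr_mono2) auto
  moreover have "(2 powr real k) powr Q = (2 powr Q) ^ k"
    by (simp add: powr_powr powr_realpow[symmetric] mult.commute)
  ultimately show ?thesis using iter[of k] full mult_right_mono[of "(2 powr Q) ^ k" "(2 * R / r) powr Q" "measure lebesgue (B x r)"]
    by simp
qed

end

section \<open>Coverings and the maximal function\<close>

text \<open>For finite \<open>t\<close> this is the fundamental theorem of calculus for \<open>\<lambda>l. l\<^sup>2\<close>; for infinite \<open>t\<close> the right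
  hand side is at least \<open>n\<^sup>2\<close> for every \<open>n\<close>.\<close>
lemma nn_integral_layer_cake_square:
  fixes t :: ennreal
  shows "t * t \<le> (\<integral>\<^sup>+l. ennreal (2 * l) * indicator {l. 0 < l \<and> ennreal l < t} l \<partial>lborel)"
proof -
  have fin: "ennreal (r * r) \<le> (\<integral>\<^sup>+l. ennreal (2 * l) * indicator {l. 0 < l \<and> ennreal l < t} l \<partial>lborel)"
    if "r \<ge> 0" "ennreal r \<le> t" for r
  proof -
    have "ennreal (r * r) = (\<integral>\<^sup>+l. ennreal (2 * l) * indicator {0..r} l \<partial>lborel)"
    proof -
      have "((\<lambda>x. x * x) has_real_derivative 2 * x) (at x)" for x :: real
        by (auto intro!: derivative_eq_intros)
      then show ?thesis
        using nn_integral_FTC_Icc[of "\<lambda>x::real. 2 * x" 0 r "\<lambda>x. x * x"] \<open>r \<ge> 0\<close> by simp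
    qed
    also have "\<dots> \<le> (\<integral>\<^sup>+l. ennreal (2 * l) * indicator {l. 0 < l \<and> ennreal l < t} l \<partial>lborel)"
    proof (rule nn_integral_mono_AE)
      have "AE l in lborel. l \<noteq> r" by (rule AE_lborel_singleton)
      then show "AE l in lborel. ennreal (2 * l) * indicator {0..r} l \<le> ennreal (2 * l) * indicator {l. 0 < l \<and> ennreal l < t} l"
      proof (eventually_elim)
        fix l assume "l \<noteq> r"
        have "ennreal l < t" if "0 \<le> l" "l \<le> r"
        proof -
          have "ennreal l < ennreal r" using that \<open>l \<noteq> r\<close> by (intro ennreal_lessI) auto
          then show ?thesis using \<open>ennreal r \<le> t\<close> by simp
        qed
        then show "ennreal (2 * l) * indicator {0..r} l \<le> ennreal (2 * l) * indicator {l. 0 < l \<and> ennreal l < t} l"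
          by (cases "l = 0") (auto simp: indicator_def)
      qed
    qed
    finally show ?thesis .
  qed
  show ?thesis
  proof (cases t)
    case (real r)
    then show ?thesis using fin[of r] by (simp add: ennreal_mult)
  next
    case top
    define J where "J = (\<integral>\<^sup>+l. ennreal (2 * l) * indicator {l. 0 < l \<and> ennreal l < t} l \<partial>lborel)"
    have nJ: "of_nat n \<le> J" for n
    proof -
      have "real n \<le> real n * real n" by (cases n) (auto simp: algebra_simps)
      then have "of_nat n \<le> ennreal (real n * real n)"
        by (metis ennreal_leI ennreal_of_nat_eq_real_of_nat)
      also have "\<dots> \<le> J" unfolding J_def by (rule fin) (use top in auto)
      finally show ?thesis .
    qed
    have "J = top"
    proof (rule ccontr)
      assume "J \<noteq> top"
      then obtain n where "J < of_nat n" using ennreal_Ex_less_of_nat[of J] by (auto simp: less_top)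
      then show False using nJ[of n] by simp
    qed
    then show ?thesis by (simp add: J_def)
  qed
qed

context cc_space begin

text \<open>Greedy choice: keep a ball of maximal radius, discard the balls that meet it, and repeat. A
  discarded ball lies in the triple of the larger ball that it meets.\<close>
lemma vitali_selection:
  fixes x :: "'i \<Rightarrow> real^'n"
  assumes "finite I" and x: "\<And>i. i \<in> I \<Longrightarrow> x i \<in> \<Omega>" and r: "\<And>i. i \<in> I \<Longrightarrow> r i > 0"
  shows "\<exists>J\<subseteq>I. disjoint_family_on (\<lambda>i. B (x i) (r i)) J \<and>
     (\<forall>i\<in>I. \<exists>j\<in>J. B (x i) (r i) \<subseteq> B (x j) (3 * r j))"
  using assms
proof (induction I rule: finite_psubset_induct)
  case (psubset I)
  show ?case
  proof (cases "I = {}")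
    case False
    obtain m where m: "m \<in> I" "\<And>i. i \<in> I \<Longrightarrow> r i \<le> r m"
    proof -
      have "Max (r ` I) \<in> r ` I" using False psubset.hyps by (intro Max_in) auto
      then obtain m where "m \<in> I" "r m = Max (r ` I)" by auto
      then show thesis using that psubset.hyps by (metis Max_ge finite_imageI imageI)
    qed
    define I' where "I' = {i\<in>I. B (x i) (r i) \<inter> B (x m) (r m) = {}}"
    have "m \<notin> I'" using centre_in_ball_cc[of "x m" "r m"] psubset.prems m(1) by (auto simp: I'_def)
    then have "I' \<subset> I" using m(1) by (auto simp: I'_def)
    have "\<exists>J\<subseteq>I'. disjoint_family_on (\<lambda>i. B (x i) (r i)) J \<and>
       (\<forall>i\<in>I'. \<exists>j\<in>J. B (x i) (r i) \<subseteq> B (x j) (3 * r j))"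
      by (rule psubset.IH[OF \<open>I' \<subset> I\<close>]) (use psubset.prems \<open>I' \<subset> I\<close> in auto)
    then obtain J where J: "J \<subseteq> I'" "disjoint_family_on (\<lambda>i. B (x i) (r i)) J"
      "\<forall>i\<in>I'. \<exists>j\<in>J. B (x i) (r i) \<subseteq> B (x j) (3 * r j)" by blast
    have "B (x i) (r i) \<subseteq> B (x m) (3 * r m)" if i: "i \<in> I" "i \<notin> I'" for i
    proof
      fix z assume z: "z \<in> B (x i) (r i)"
      obtain w where w: "w \<in> B (x i) (r i)" "w \<in> B (x m) (r m)" using i by (auto simp: I'_def)
      have in\<Omega>: "x i \<in> \<Omega>" "x m \<in> \<Omega>" "w \<in> \<Omega>" "z \<in> \<Omega>"
        using psubset.prems(1) i m w z by (auto simp: mem_ball_cc)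
      have "d (x m) z \<le> d (x m) w + d w z" by (rule dist_triangle_cc) (use in\<Omega> in auto)
      moreover have "d w z \<le> d w (x i) + d (x i) z" by (rule dist_triangle_cc) (use in\<Omega> in auto)
      ultimately have "d (x m) z < r m + r i + r i" using z w by (simp add: mem_ball_cc dist_sym)
      then show "z \<in> B (x m) (3 * r m)" using m(2)[OF i(1)] in\<Omega> by (simp add: mem_ball_cc)
    qed
    then have "\<forall>i\<in>I. \<exists>j\<in>insert m J. B (x i) (r i) \<subseteq> B (x j) (3 * r j)" using J(3) by blast
    moreover have "disjoint_family_on (\<lambda>i. B (x i) (r i)) (insert m J)"
      using J(1,2) by (auto simp: disjoint_family_on_def I'_def)
    moreover have "insert m J \<subseteq> I" using m J(1) by (auto simp: I'_def)
    ultimately show ?thesis by blast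
  qed (auto simp: disjoint_family_on_def)
qed

lemma emeasure_ball:
  assumes "x \<in> \<Omega>" shows "emeasure lborel (B x r) = ennreal (measure lebesgue (B x r))"
proof -
  have "emeasure lborel (B x r) = emeasure lebesgue (B x r)"
    using open_ball_cc[OF assms] by (simp add: borel_open)
  then show ?thesis using ball_lmeasurable[OF assms] by (simp add: emeasure_eq_measure2)
qed

lemma ball_borel: "x \<in> \<Omega> \<Longrightarrow> B x r \<in> sets borel"
  using open_ball_cc by (simp add: borel_open)

definition doubling_const :: real where "doubling_const = 2 powr Q"

lemma doubling_const_ge_1: "doubling_const \<ge> 1"
  using dimension_gt_2 by (simp add: doubling_const_def ge_one_powr_ge_zero)

lemma emeasure_triple_ball:
  assumes x: "x \<in> \<Omega>" and r: "r > 0"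
  shows "emeasure lborel (B x (3 * r)) \<le> ennreal (doubling_const\<^sup>2) * emeasure lborel (B x r)"
proof -
  have "measure lebesgue (B x (3 * r)) \<le> measure lebesgue (B x (2 * (2 * r)))"
    using r by (intro measure_mono_fmeasurable ball_mono fmeasurableD ball_lmeasurable x) auto
  also have "\<dots> \<le> doubling_const * measure lebesgue (B x (2 * r))"
    using ball_doubling[OF x, of "2 * r"] r by (simp add: doubling_const_def)
  also have "\<dots> \<le> doubling_const * (doubling_const * measure lebesgue (B x r))"
    using ball_doubling[OF x r] doubling_const_ge_1 by (intro mult_left_mono) (auto simp: doubling_const_def)
  finally have "measure lebesgue (B x (3 * r)) \<le> doubling_const\<^sup>2 * measure lebesgue (B x r)"
    by (simp add: power2_eq_square mult.assoc)
  then show ?thesis by (simp add: emeasure_ball[OF x] ennreal_mult'[symmetric] ennreal_leI)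
qed

text \<open>Exhaust \<open>U\<close> by compact sets, cover each by finitely many of the given balls and select a disjoint
  subfamily whose triples still cover.\<close>
lemma covering_weak_type:
  fixes h :: "real^'n \<Rightarrow> ennreal"
  assumes h: "h \<in> borel_measurable borel" and "open U"
    and cover: "\<And>x. x \<in> U \<Longrightarrow> \<exists>y\<in>\<Omega>. \<exists>r>0. x \<in> B y r \<and>
       c * emeasure lborel (B y r) \<le> (\<integral>\<^sup>+z\<in>B y r. h z \<partial>lborel)"
  shows "c * emeasure lborel U \<le> ennreal (doubling_const\<^sup>2) * (\<integral>\<^sup>+z\<in>\<Omega>. h z \<partial>lborel)"
proof -
  have comp: "c * emeasure lborel K \<le> ennreal (doubling_const\<^sup>2) * (\<integral>\<^sup>+z\<in>\<Omega>. h z \<partial>lborel)"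
    if K: "compact K" "K \<subseteq> U" for K
  proof -
    obtain y r where yr: "\<And>x. x \<in> K \<Longrightarrow> y x \<in> \<Omega>" "\<And>x. x \<in> K \<Longrightarrow> r x > 0" "\<And>x. x \<in> K \<Longrightarrow> x \<in> B (y x) (r x)"
       "\<And>x. x \<in> K \<Longrightarrow> c * emeasure lborel (B (y x) (r x)) \<le> (\<integral>\<^sup>+z\<in>B (y x) (r x). h z \<partial>lborel)"
    proof -
      have "\<forall>x\<in>K. \<exists>p. fst p \<in> \<Omega> \<and> snd p > 0 \<and> x \<in> B (fst p) (snd p) \<and>
          c * emeasure lborel (B (fst p) (snd p)) \<le> (\<integral>\<^sup>+z\<in>B (fst p) (snd p). h z \<partial>lborel)"
      proof
        fix x assume "x \<in> K"
        then obtain y r where "y \<in> \<Omega>" "r > 0" "x \<in> B y r"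
            "c * emeasure lborel (B y r) \<le> (\<integral>\<^sup>+z\<in>B y r. h z \<partial>lborel)"
          using cover[of x] K(2) by auto
        then show "\<exists>p. fst p \<in> \<Omega> \<and> snd p > 0 \<and> x \<in> B (fst p) (snd p) \<and>
          c * emeasure lborel (B (fst p) (snd p)) \<le> (\<integral>\<^sup>+z\<in>B (fst p) (snd p). h z \<partial>lborel)"
          by (intro exI[of _ "(y, r)"]) simp
      qed
      from bchoice[OF this] obtain p where "\<forall>x\<in>K. fst (p x) \<in> \<Omega> \<and> snd (p x) > 0 \<and> x \<in> B (fst (p x)) (snd (p x)) \<and>
          c * emeasure lborel (B (fst (p x)) (snd (p x))) \<le> (\<integral>\<^sup>+z\<in>B (fst (p x)) (snd (p x)). h z \<partial>lborel)" ..
      then show thesis using that[of "\<lambda>x. fst (p x)" "\<lambda>x. snd (p x)"] by blast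
    qed
    obtain I where I: "I \<subseteq> K" "finite I" "K \<subseteq> (\<Union>x\<in>I. B (y x) (r x))"
    proof (rule compactE_image[OF K(1), of K "\<lambda>x. B (y x) (r x)"])
      show "open (B (y x) (r x))" if "x \<in> K" for x using open_ball_cc yr(1)[OF that] .
      show "K \<subseteq> (\<Union>x\<in>K. B (y x) (r x))" using yr(3) by blast
    qed
    have "\<exists>J\<subseteq>I. disjoint_family_on (\<lambda>i. B (y i) (r i)) J \<and>
       (\<forall>i\<in>I. \<exists>j\<in>J. B (y i) (r i) \<subseteq> B (y j) (3 * r j))"
      by (rule vitali_selection[OF I(2)]) (use yr(1,2) I(1) in auto)
    then obtain J where J: "J \<subseteq> I" "disjoint_family_on (\<lambda>i. B (y i) (r i)) J"
      "\<forall>i\<in>I. \<exists>j\<in>J. B (y i) (r i) \<subseteq> B (y j) (3 * r j)" by blast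
    have finJ: "finite J" using I(2) J(1) finite_subset by blast
    have J\<Omega>: "y j \<in> \<Omega>" "r j > 0" if "j \<in> J" for j using yr that I J by blast+
    have "K \<subseteq> (\<Union>j\<in>J. B (y j) (3 * r j))" using I(3) J(3) by blast
    then have "emeasure lborel K \<le> emeasure lborel (\<Union>j\<in>J. B (y j) (3 * r j))"
      using J\<Omega> finJ by (intro emeasure_mono) (auto intro!: sets.finite_UN ball_borel)
    also have "\<dots> \<le> (\<Sum>j\<in>J. emeasure lborel (B (y j) (3 * r j)))"
      using J\<Omega> finJ by (intro emeasure_subadditive_finite) (auto intro!: ball_borel)
    also have "\<dots> \<le> (\<Sum>j\<in>J. ennreal (doubling_const\<^sup>2) * emeasure lborel (B (y j) (r j)))"
      using J\<Omega> by (intro sum_mono emeasure_triple_ball) auto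
    finally have "c * emeasure lborel K \<le> c * (\<Sum>j\<in>J. ennreal (doubling_const\<^sup>2) * emeasure lborel (B (y j) (r j)))"
      by (rule mult_left_mono) simp
    also have "\<dots> = ennreal (doubling_const\<^sup>2) * (\<Sum>j\<in>J. c * emeasure lborel (B (y j) (r j)))"
      by (simp add: sum_distrib_left mult.left_commute)
    also have "\<dots> \<le> ennreal (doubling_const\<^sup>2) * (\<Sum>j\<in>J. \<integral>\<^sup>+z\<in>B (y j) (r j). h z \<partial>lborel)"
      using yr(4) I(1) J(1) by (intro mult_left_mono sum_mono) auto
    also have "(\<Sum>j\<in>J. \<integral>\<^sup>+z\<in>B (y j) (r j). h z \<partial>lborel) = (\<integral>\<^sup>+z. (\<Sum>j\<in>J. h z * indicator (B (y j) (r j)) z) \<partial>lborel)"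
      using J\<Omega> h ball_borel by (intro nn_integral_sum[symmetric]) auto
    also have "\<dots> \<le> (\<integral>\<^sup>+z\<in>\<Omega>. h z \<partial>lborel)"
    proof (rule nn_integral_mono)
      fix z
      have "(indicator (\<Union>j\<in>J. B (y j) (r j)) z :: ennreal) = (\<Sum>j\<in>J. indicator (B (y j) (r j)) z)"
        by (rule indicator_UN_disjoint[OF finJ J(2)])
      then have "(\<Sum>j\<in>J. h z * indicator (B (y j) (r j)) z) = h z * indicator (\<Union>j\<in>J. B (y j) (r j)) z"
        by (simp add: sum_distrib_left)
      also have "\<dots> \<le> h z * indicator \<Omega> z"
        using ball_subset_domain by (intro mult_left_mono) (auto simp: indicator_def)
      finally show "(\<Sum>j\<in>J. h z * indicator (B (y j) (r j)) z) \<le> h z * indicator \<Omega> z" .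
    qed
    finally show ?thesis by (simp add: mult_left_mono)
  qed
  obtain K where K: "\<And>n. compact (K n)" "\<And>n. K n \<subseteq> U" "\<And>n. K n \<subseteq> interior (K (Suc n))" "\<Union>(range K) = U"
    using open_Union_compact_subsets[OF \<open>open U\<close>] by metis
  have "incseq K" using K(3) interior_subset by (intro incseq_SucI) blast
  moreover have "range K \<subseteq> sets lborel" using K(1) by (auto simp: compact_imp_closed borel_closed)
  ultimately have "emeasure lborel U = (SUP n. emeasure lborel (K n))"
    using SUP_emeasure_incseq[of K lborel] K(4) by simp
  then have "c * emeasure lborel U = (SUP n. c * emeasure lborel (K n))"
    by (simp add: SUP_mult_left_ennreal)
  also have "\<dots> \<le> ennreal (doubling_const\<^sup>2) * (\<integral>\<^sup>+z\<in>\<Omega>. h z \<partial>lborel)"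
    using comp K(1,2) by (intro SUP_least) auto
  finally show ?thesis .
qed

text \<open>The uncentred maximal function of the metric measure space \<open>\<Omega>\<close>. With uncentred balls its
  superlevel sets are unions of open balls, so that measurability is immediate.\<close>
definition maximal :: "(real^'n \<Rightarrow> ennreal) \<Rightarrow> real^'n \<Rightarrow> ennreal" where
  "maximal g x = (SUP (y, r) \<in> {(y, r). y \<in> \<Omega> \<and> r > 0 \<and> x \<in> B y r}.
      (\<integral>\<^sup>+z\<in>B y r. g z \<partial>lborel) / emeasure lborel (B y r))"

lemma maximal_greater_iff:
  "a < maximal g x \<longleftrightarrow> (\<exists>y\<in>\<Omega>. \<exists>r>0. x \<in> B y r \<and> a < (\<integral>\<^sup>+z\<in>B y r. g z \<partial>lborel) / emeasure lborel (B y r))"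
  unfolding maximal_def less_SUP_iff by auto

lemma open_maximal_greater: "open {x. a < maximal g x}"
proof -
  have "{x. a < maximal g x} = (\<Union>(y, r) \<in> {(y, r). y \<in> \<Omega> \<and> r > 0 \<and>
      a < (\<integral>\<^sup>+z\<in>B y r. g z \<partial>lborel) / emeasure lborel (B y r)}. B y r)"
    by (auto simp: maximal_greater_iff)
  then show ?thesis using open_ball_cc by auto
qed

lemma maximal_measurable[measurable]: "maximal g \<in> borel_measurable borel"
  using open_maximal_greater by (intro borel_measurableI_greater) (auto intro: borel_open)

lemma emeasure_ball_pos_finite:
  assumes "x \<in> \<Omega>" "r > 0"
  shows "emeasure lborel (B x r) > 0" "emeasure lborel (B x r) < top"
  using assms ball_measure_pos by (auto simp: emeasure_ball)

text \<open>Only the part of \<open>g\<close> above \<open>l/2\<close> can push an average above \<open>l\<close>.\<close>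
lemma maximal_weak_type:
  fixes g :: "real^'n \<Rightarrow> ennreal"
  assumes [measurable]: "g \<in> borel_measurable borel" and "l > 0"
  shows "ennreal (l/2) * emeasure lborel {x. ennreal l < maximal g x} \<le>
     ennreal (doubling_const\<^sup>2) * (\<integral>\<^sup>+z\<in>\<Omega>. g z * indicator {z. ennreal (l/2) < g z} z \<partial>lborel)"
proof (rule covering_weak_type[OF _ open_maximal_greater])
  show "(\<lambda>z. g z * indicator {z. ennreal (l/2) < g z} z) \<in> borel_measurable borel" by measurable
  fix x assume "x \<in> {x. ennreal l < maximal g x}"
  then obtain y r where yr: "y \<in> \<Omega>" "r > 0" "x \<in> B y r" "ennreal l < (\<integral>\<^sup>+z\<in>B y r. g z \<partial>lborel) / emeasure lborel (B y r)"
    by (auto simp: maximal_greater_iff)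
  note pf = emeasure_ball_pos_finite[OF yr(1,2)]
  have [measurable]: "B y r \<in> sets borel" using ball_borel yr(1) by blast
  define h where "h = (\<lambda>z. g z * indicator {z. ennreal (l/2) < g z} z)"
  have [measurable]: "h \<in> borel_measurable borel" unfolding h_def by measurable
  have "ennreal l * emeasure lborel (B y r) \<le> (\<integral>\<^sup>+z\<in>B y r. g z \<partial>lborel)"
    using mult_right_mono[OF less_imp_le[OF yr(4)], of "emeasure lborel (B y r)"] pf
    by (simp add: ennreal_divide_times ennreal_times_divide mult_divide_eq_ennreal)
  also have "\<dots> \<le> (\<integral>\<^sup>+z. h z * indicator (B y r) z + ennreal (l/2) * indicator (B y r) z \<partial>lborel)"
    by (intro nn_integral_mono) (auto simp: h_def indicator_def not_less)
  also have "\<dots> = (\<integral>\<^sup>+z\<in>B y r. h z \<partial>lborel) + ennreal (l/2) * emeasure lborel (B y r)"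
    by (subst nn_integral_add) (auto simp: nn_integral_cmult_indicator)
  finally have *: "ennreal l * emeasure lborel (B y r) \<le> (\<integral>\<^sup>+z\<in>B y r. h z \<partial>lborel) + ennreal (l/2) * emeasure lborel (B y r)" .
  have "ennreal l = ennreal (l/2) + ennreal (l/2)" using \<open>l > 0\<close> by (simp add: ennreal_plus[symmetric] del: ennreal_plus)
  then have "ennreal (l/2) * emeasure lborel (B y r) + ennreal (l/2) * emeasure lborel (B y r)
     \<le> ennreal (l/2) * emeasure lborel (B y r) + (\<integral>\<^sup>+z\<in>B y r. h z \<partial>lborel)"
    using * by (simp add: distrib_right add.commute)
  then have "ennreal (l/2) * emeasure lborel (B y r) = \<infinity> \<or>
      ennreal (l/2) * emeasure lborel (B y r) \<le> (\<integral>\<^sup>+z\<in>B y r. h z \<partial>lborel)"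
    unfolding ennreal_add_left_cancel_le .
  moreover have "ennreal (l/2) * emeasure lborel (B y r) < top" using pf by (simp add: ennreal_mult_less_top)
  ultimately have "ennreal (l/2) * emeasure lborel (B y r) \<le> (\<integral>\<^sup>+z\<in>B y r. h z \<partial>lborel)" by auto
  then show "\<exists>y\<in>\<Omega>. \<exists>r>0. x \<in> B y r \<and> ennreal (l/2) * emeasure lborel (B y r)
      \<le> (\<integral>\<^sup>+z\<in>B y r. g z * indicator {z. ennreal (l/2) < g z} z \<partial>lborel)"
    using yr unfolding h_def by blast
qed

text \<open>Integrate the weak type bound over \<open>l\<close>. By Fubini's theorem the right hand side becomes
  the integral of \<open>g\<close> times the length of \<open>{l. l/2 < g}\<close>, which is \<open>2 g\<close>.\<close>
theorem maximal_L2_bound: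
  fixes g :: "real^'n \<Rightarrow> ennreal"
  assumes [measurable]: "g \<in> borel_measurable borel" and fin: "\<And>x. g x < top"
  shows "(\<integral>\<^sup>+x. maximal g x * maximal g x \<partial>lborel)
    \<le> ennreal (8 * doubling_const\<^sup>2) * (\<integral>\<^sup>+x\<in>\<Omega>. g x * g x \<partial>lborel)"
proof -
  define D where "D = doubling_const\<^sup>2"
  have "D > 0" using doubling_const_ge_1 by (simp add: D_def)
  have [measurable]: "\<Omega> \<in> sets borel" using open_domain by (rule borel_open)
  have "(\<integral>\<^sup>+x. maximal g x * maximal g x \<partial>lborel)
     \<le> (\<integral>\<^sup>+x. (\<integral>\<^sup>+l. ennreal (2 * l) * indicator {l. 0 < l \<and> ennreal l < maximal g x} l \<partial>lborel) \<partial>lborel)"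
    by (intro nn_integral_mono nn_integral_layer_cake_square)
  also have "\<dots> = (\<integral>\<^sup>+l. (\<integral>\<^sup>+x. ennreal (2 * l) * indicator {l. 0 < l \<and> ennreal l < maximal g x} l \<partial>lborel) \<partial>lborel)"
    by (rule lborel_pair.Fubini') measurable
  also have "\<dots> \<le> (\<integral>\<^sup>+l. (\<integral>\<^sup>+x. ennreal (4 * D) * (g x * indicator \<Omega> x * indicator {l. 0 < l \<and> ennreal (l/2) < g x} l) \<partial>lborel) \<partial>lborel)"
  proof (rule nn_integral_mono)
    fix l :: real
    show "(\<integral>\<^sup>+x. ennreal (2 * l) * indicator {l. 0 < l \<and> ennreal l < maximal g x} l \<partial>lborel)
      \<le> (\<integral>\<^sup>+x. ennreal (4 * D) * (g x * indicator \<Omega> x * indicator {l. 0 < l \<and> ennreal (l/2) < g x} l) \<partial>lborel)"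
    proof (cases "l > 0")
      case True
      have "(\<integral>\<^sup>+x. ennreal (2 * l) * indicator {l. 0 < l \<and> ennreal l < maximal g x} l \<partial>lborel)
         = (\<integral>\<^sup>+x. ennreal (2 * l) * indicator {x. ennreal l < maximal g x} x \<partial>lborel)"
        using True by (intro nn_integral_cong) (auto simp: indicator_def)
      also have "\<dots> = ennreal (2 * l) * emeasure lborel {x. ennreal l < maximal g x}"
        by (rule nn_integral_cmult_indicator) measurable
      also have "\<dots> = 4 * (ennreal (l/2) * emeasure lborel {x. ennreal l < maximal g x})"
      proof -
        have "ennreal (2 * l) = 4 * ennreal (l/2)"
          using True ennreal_mult[of 4 "l/2"] by simp
        then show ?thesis by (simp add: mult.assoc)
      qed
      also have "\<dots> \<le> 4 * (ennreal D * (\<integral>\<^sup>+z\<in>\<Omega>. g z * indicator {z. ennreal (l/2) < g z} z \<partial>lborel))"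
        unfolding D_def by (intro mult_left_mono maximal_weak_type True) auto
      also have "\<dots> = ennreal (4 * D) * (\<integral>\<^sup>+z\<in>\<Omega>. g z * indicator {z. ennreal (l/2) < g z} z \<partial>lborel)"
        using \<open>D > 0\<close> by (simp add: ennreal_mult mult.assoc)
      also have "\<dots> = (\<integral>\<^sup>+x. ennreal (4 * D) * (g x * indicator {z. ennreal (l/2) < g z} x * indicator \<Omega> x) \<partial>lborel)"
        by (rule nn_integral_cmult[symmetric]) measurable
      also have "\<dots> = (\<integral>\<^sup>+x. ennreal (4 * D) * (g x * indicator \<Omega> x * indicator {l. 0 < l \<and> ennreal (l/2) < g x} l) \<partial>lborel)"
        using True by (intro nn_integral_cong) (auto simp: indicator_def)
      finally show ?thesis .
    qed simp
  qed
  also have "\<dots> = (\<integral>\<^sup>+x. (\<integral>\<^sup>+l. ennreal (4 * D) * (g x * indicator \<Omega> x * indicator {l. 0 < l \<and> ennreal (l/2) < g x} l) \<partial>lborel) \<partial>lborel)"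
    by (rule lborel_pair.Fubini'[symmetric]) measurable
  also have "\<dots> \<le> (\<integral>\<^sup>+x. ennreal (8 * D) * (g x * g x * indicator \<Omega> x) \<partial>lborel)"
  proof (rule nn_integral_mono)
    fix x
    obtain a where a: "a \<ge> 0" "g x = ennreal a" using fin[of x] by (cases "g x") auto
    have "(\<integral>\<^sup>+l. ennreal (4 * D) * (g x * indicator \<Omega> x * indicator {l. 0 < l \<and> ennreal (l/2) < g x} l) \<partial>lborel)
       \<le> (\<integral>\<^sup>+l. (ennreal (4 * D) * (g x * indicator \<Omega> x)) * indicator {0..2 * a} l \<partial>lborel)"
    proof (intro nn_integral_mono)
      fix l :: real
      have "indicator {l. 0 < l \<and> ennreal (l/2) < g x} l \<le> (indicator {0..2 * a} l :: ennreal)"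
        using a by (auto simp: indicator_def ennreal_less_iff)
      then show "ennreal (4 * D) * (g x * indicator \<Omega> x * indicator {l. 0 < l \<and> ennreal (l/2) < g x} l)
         \<le> (ennreal (4 * D) * (g x * indicator \<Omega> x)) * indicator {0..2 * a} l"
        by (simp add: mult.assoc mult_left_mono)
    qed
    also have "\<dots> = (ennreal (4 * D) * (g x * indicator \<Omega> x)) * ennreal (2 * a)"
      using a(1) by (subst nn_integral_cmult_indicator) auto
    also have "\<dots> = ennreal (8 * D) * (g x * g x * indicator \<Omega> x)"
      using a \<open>D > 0\<close> by (cases "x \<in> \<Omega>") (simp_all add: ennreal_mult[symmetric])
    finally show "(\<integral>\<^sup>+l. ennreal (4 * D) * (g x * indicator \<Omega> x * indicator {l. 0 < l \<and> ennreal (l/2) < g x} l) \<partial>lborel)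
       \<le> ennreal (8 * D) * (g x * g x * indicator \<Omega> x)" .
  qed
  also have "\<dots> = ennreal (8 * D) * (\<integral>\<^sup>+x\<in>\<Omega>. g x * g x \<partial>lborel)"
    by (rule nn_integral_cmult) measurable
  finally show ?thesis unfolding D_def .
qed

end

section \<open>The Sobolev--Poincare inequality\<close>

lemma continuous_borel_lebesgue:
  fixes u :: "real^'n \<Rightarrow> 'b::topological_space"
  assumes "continuous_on UNIV u"
  shows "u \<in> borel_measurable lebesgue"
  using borel_measurable_continuous_onI[OF assms] by (intro measurable_completion) simp

lemma continuous_set_integrable:
  fixes u :: "real^'n \<Rightarrow> real"
  assumes u: "continuous_on UNIV u" and S: "S \<in> sets borel" "bounded S"
  shows "set_integrable lebesgue S u"
proof -
  have "compact (u ` closure S)"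
    using S(2) by (intro compact_continuous_image continuous_on_subset[OF u subset_UNIV]) (simp add: compact_closure)
  then obtain M where "\<forall>y\<in>u ` closure S. norm y \<le> M"
    by (meson bounded_iff compact_imp_bounded)
  then have M: "norm (u x) \<le> M" if "x \<in> S" for x
    using that closure_subset[of S] by blast
  show ?thesis unfolding set_integrable_def
  proof (rule integrableI_bounded_set_indicator)
    show "u \<in> borel_measurable lebesgue" using u by (rule continuous_borel_lebesgue)
    show "emeasure lebesgue S < \<infinity>" using S emeasure_bounded_finite[OF S(2)] by simp
    show "AE x in lebesgue. x \<in> S \<longrightarrow> norm (u x) \<le> M" using M by simp
  qed (use S in simp)
qed

lemma set_integral_const_lmeasurable:
  assumes "S \<in> lmeasurable"
  shows "(LINT y:S|lebesgue. c) = (c::real) * measure lebesgue S"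
proof -
  have "(LINT y:S|lebesgue. c) = (LINT y|lebesgue. indicator S y) * c"
    unfolding set_lebesgue_integral_def by simp
  then show ?thesis using assms by (simp add: mult.commute)
qed

lemma set_integral_subset_mono:
  fixes u :: "'a \<Rightarrow> real"
  assumes "set_integrable M B u" "A \<in> sets M" "A \<subseteq> B" and pos: "\<And>x. u x \<ge> 0"
  shows "(LINT y:A|M. u y) \<le> (LINT y:B|M. u y)"
proof -
  have "set_integrable M A u" using assms set_integrable_subset by blast
  then show ?thesis using assms unfolding set_lebesgue_integral_def set_integrable_def
    by (intro integral_mono) (auto simp: indicator_def)
qed

lemma nn_integral_continuous_eq:
  fixes u :: "real^'n \<Rightarrow> real"
  assumes u: "continuous_on UNIV u" and S: "S \<in> sets borel" "bounded S" and pos: "\<And>x. u x \<ge> 0"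
  shows "(\<integral>\<^sup>+x\<in>S. ennreal (u x) \<partial>lborel) = ennreal (LINT x:S|lebesgue. u x)"
proof -
  have [measurable]: "u \<in> borel_measurable borel" using u by (rule borel_measurable_continuous_onI)
  have [measurable]: "S \<in> sets borel" by (rule S)
  have "(\<integral>\<^sup>+x\<in>S. ennreal (u x) \<partial>lborel) = (\<integral>\<^sup>+x. ennreal (indicator S x *\<^sub>R u x) \<partial>lborel)"
    by (intro nn_integral_cong) (auto simp: indicator_def)
  also have "\<dots> = (\<integral>\<^sup>+x. ennreal (indicator S x *\<^sub>R u x) \<partial>lebesgue)"
    by (rule nn_integral_completion[symmetric]) measurable
  also have "\<dots> = ennreal (LINT x|lebesgue. indicator S x *\<^sub>R u x)"
    using continuous_set_integrable[OF u S] pos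
    by (intro nn_integral_eq_integral) (auto simp: set_integrable_def)
  finally show ?thesis by (simp add: set_lebesgue_integral_def)
qed

text \<open>Passing from the mean over a ball to the mean over a smaller ball costs the ratio of their
  measures; with \<open>c\<close> the mean over \<open>B\<close> this is one step of the telescoping sum below.\<close>
lemma mean_on_diff_le:
  fixes u :: "real^'n \<Rightarrow> real"
  assumes u: "continuous_on UNIV u" and A: "A \<in> sets borel" and B: "B \<in> sets borel" "bounded B" and "A \<subseteq> B"
    and "measure lebesgue A > 0" and K: "measure lebesgue B \<le> K * measure lebesgue A"
  shows "\<bar>mean_on A u - c\<bar> \<le> K * mean_on B (\<lambda>y. \<bar>u y - c\<bar>)"
proof -
  have bA: "bounded A" using B(2) \<open>A \<subseteq> B\<close> bounded_subset by blast
  have fin: "emeasure lebesgue A < \<infinity>" using A emeasure_bounded_finite[OF bA] by simp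
  have lA: "A \<in> lmeasurable" "B \<in> lmeasurable" using A B bA by (auto intro!: bounded_set_imp_lmeasurable)
  then have "measure lebesgue A \<le> measure lebesgue B" using \<open>A \<subseteq> B\<close> by (intro measure_mono_fmeasurable) auto
  then have pB: "measure lebesgue B > 0" using assms(6) by simp
  have ci: "set_integrable lebesgue A (\<lambda>_. c)"
    using A bA by (intro continuous_set_integrable) auto
  have iu: "set_integrable lebesgue A u" by (intro continuous_set_integrable u A bA)
  have uc: "continuous_on UNIV (\<lambda>y. \<bar>u y - c\<bar>)" by (intro continuous_intros u)
  have iA: "set_integrable lebesgue A (\<lambda>y. \<bar>u y - c\<bar>)" by (intro continuous_set_integrable uc A bA)
  have iB: "set_integrable lebesgue B (\<lambda>y. \<bar>u y - c\<bar>)" by (intro continuous_set_integrable uc B)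
  have "(LINT y:A|lebesgue. u y - c) = (LINT y:A|lebesgue. u y) - c * measure lebesgue A"
    using set_integral_diff(2)[OF iu ci] lA by (simp add: set_integral_const_lmeasurable)
  then have eq: "mean_on A u - c = (LINT y:A|lebesgue. u y - c) / measure lebesgue A"
    using assms(6) by (simp add: mean_on_def field_simps)
  have "\<bar>LINT y:A|lebesgue. u y - c\<bar> \<le> (LINT y:A|lebesgue. \<bar>u y - c\<bar>)"
    using set_integral_norm_bound[OF set_integral_diff(1)[OF iu ci]] by simp
  also have "\<dots> \<le> (LINT y:B|lebesgue. \<bar>u y - c\<bar>)"
    using \<open>A \<subseteq> B\<close> A by (intro set_integral_subset_mono iB) auto
  finally have 1: "\<bar>LINT y:A|lebesgue. u y - c\<bar> \<le> (LINT y:B|lebesgue. \<bar>u y - c\<bar>)" .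
  have nn: "0 \<le> (LINT y:B|lebesgue. \<bar>u y - c\<bar>)" using 1 by linarith
  have "\<bar>mean_on A u - c\<bar> \<le> (LINT y:B|lebesgue. \<bar>u y - c\<bar>) / measure lebesgue A"
    unfolding eq using 1 assms(6) by (simp add: divide_right_mono)
  also have "\<dots> \<le> K * ((LINT y:B|lebesgue. \<bar>u y - c\<bar>) / measure lebesgue B)"
    using mult_right_mono[OF K nn] assms(6) pB by (simp add: field_simps)
  finally show ?thesis by (simp add: mean_on_def)
qed

text \<open>Jensen's inequality for the square, from \<open>0 \<le> \<integral> (g - m)\<^sup>2\<close> with \<open>m\<close> the mean of \<open>g\<close>.\<close>
lemma mean_on_square_le:
  fixes g :: "real^'n \<Rightarrow> real"
  assumes g: "continuous_on UNIV g" and B: "B \<in> sets borel" "bounded B"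
    and "measure lebesgue B > 0"
  shows "(mean_on B g)\<^sup>2 * measure lebesgue B \<le> (LINT y:B|lebesgue. (g y)\<^sup>2)"
proof -
  define m where "m = mean_on B g"
  have lB: "B \<in> lmeasurable" using B by (auto intro!: bounded_set_imp_lmeasurable)
  have i: "set_integrable lebesgue B (\<lambda>y. (g y)\<^sup>2)" "set_integrable lebesgue B (\<lambda>y. 2 * m * g y)"
     "set_integrable lebesgue B (\<lambda>_. m\<^sup>2)"
    by (intro continuous_set_integrable B continuous_intros g)+
  have "0 \<le> (LINT y:B|lebesgue. (g y - m)\<^sup>2)"
    unfolding set_lebesgue_integral_def by (intro integral_nonneg_AE) auto
  also have "\<dots> = (LINT y:B|lebesgue. (g y)\<^sup>2 - 2 * m * g y + m\<^sup>2)"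
    by (simp add: power2_diff algebra_simps)
  also have "\<dots> = (LINT y:B|lebesgue. (g y)\<^sup>2) - (LINT y:B|lebesgue. 2 * m * g y) + (LINT y:B|lebesgue. m\<^sup>2)"
    using i by (simp add: set_integral_add set_integral_diff)
  also have "(LINT y:B|lebesgue. 2 * m * g y) = 2 * m * (m * measure lebesgue B)"
    using assms(4) by (simp add: m_def mean_on_def)
  also have "(LINT y:B|lebesgue. m\<^sup>2) = m\<^sup>2 * measure lebesgue B"
    using lB by (simp add: set_integral_const_lmeasurable)
  finally show ?thesis by (simp add: m_def power2_eq_square)
qed

lemma C1_onD:
  assumes "C1_on UNIV u"
  shows "continuous_on UNIV u" "\<And>x. u differentiable (at x)" "\<And>v. continuous_on UNIV (\<lambda>x. frechet_derivative u (at x) v)"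
  using assms unfolding C1_on_def
  by (auto simp: differentiable_on_def intro!: differentiable_imp_continuous_on)

text \<open>Coordinates make continuity and measurability of the gradient visible.\<close>
lemma X_gradient_nth:
  assumes "u differentiable (at x)"
  shows "X_gradient X u x $ j = (\<Sum>b\<in>Basis. (X j x \<bullet> b) * frechet_derivative u (at x) b)"
proof -
  interpret linear "frechet_derivative u (at x)" by (rule linear_frechet_derivative[OF assms])
  have "frechet_derivative u (at x) (X j x) = frechet_derivative u (at x) (\<Sum>b\<in>Basis. (X j x \<bullet> b) *\<^sub>R b)"
    by (simp add: euclidean_representation)
  also have "\<dots> = (\<Sum>b\<in>Basis. (X j x \<bullet> b) * frechet_derivative u (at x) b)"
    by (simp add: sum scale)
  finally show ?thesis by (simp add: X_gradient_def)
qed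

lemma X_gradient_continuous:
  assumes u: "C1_on UNIV u" and X: "\<And>j. continuous_on UNIV (X j)"
  shows "continuous_on UNIV (X_gradient X u)"
proof -
  have "continuous_on UNIV (\<lambda>x. \<chi> j. \<Sum>b\<in>Basis. (X j x \<bullet> b) * frechet_derivative u (at x) b)"
    using C1_onD(3)[OF u] X by (intro continuous_intros)
  moreover have "X_gradient X u = (\<lambda>x. \<chi> j. \<Sum>b\<in>Basis. (X j x \<bullet> b) * frechet_derivative u (at x) b)"
    using X_gradient_nth[OF C1_onD(2)[OF u]] by (auto simp: vec_eq_iff fun_eq_iff)
  ultimately show ?thesis by simp
qed

text \<open>Hedberg's splitting: bound the terms with small index by the growing bound and the others
  by the constant one, cutting where the two bounds agree.\<close>
lemma hedberg_sum:
  fixes A b Q :: real and m :: "nat \<Rightarrow> real"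
  assumes "Q > 2" "A \<ge> 0" "b \<ge> 0"
    and m: "\<And>i. 0 \<le> m i" "\<And>i. m i \<le> A" "\<And>i. m i \<le> b * 2 powr (real i * (Q/2))"
  shows "(\<Sum>i<n. (1/2)^i * m i) \<le>
     (2 powr (Q/2 - 1) / (2 powr (Q/2 - 1) - 1) + 2) * (A powr (1 - 2/Q) * b powr (2/Q))"
proof (cases "A = 0 \<or> b = 0")
  case True
  then have "m i = 0" for i using m(1)[of i] m(2)[of i] m(3)[of i] by auto
  then show ?thesis using True by auto
next
  case False
  then have "A > 0" "b > 0" using assms by auto
  define q where "q = Q/2 - 1"
  have "q > 0" using assms by (simp add: q_def)
  define p where "p = 2 powr q"
  have "p > 1" using \<open>q > 0\<close> unfolding p_def by simp
  define T where "T = A / b"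
  have "T > 0" using \<open>A > 0\<close> \<open>b > 0\<close> by (simp add: T_def)
  define S where "S = A powr (1 - 2/Q) * b powr (2/Q)"
  have S1: "A * T powr (- 2/Q) = S"
  proof -
    have "A * T powr (- 2/Q) = A powr 1 * (A powr (-2/Q) * b powr (2/Q))"
      using \<open>A > 0\<close> \<open>b > 0\<close> by (simp add: T_def powr_divide powr_minus_divide)
    also have "\<dots> = A powr (1 + (-2/Q)) * b powr (2/Q)" by (simp only: powr_add mult.assoc)
    finally show ?thesis by (simp add: S_def)
  qed
  have S2: "b * T powr (1 - 2/Q) = S"
  proof -
    have "b * T powr (1 - 2/Q) = b * (T * T powr (-2/Q))"
      using \<open>T > 0\<close> powr_add[of T 1 "-2/Q"] by simp
    also have "\<dots> = A * T powr (-2/Q)" using \<open>b > 0\<close> by (simp add: T_def)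
    finally show ?thesis using S1 by simp
  qed
  obtain k0 :: nat where "T \<le> 2 powr (real k0 * (Q/2))"
  proof -
    obtain k :: nat where k: "log 2 T / (Q/2) \<le> real k" using real_arch_simple by blast
    have "T = 2 powr log 2 T" using \<open>T > 0\<close> by simp
    also have "\<dots> \<le> 2 powr (real k * (Q/2))" using k assms(1) by (intro powr_mono) (auto simp: field_simps)
    finally show thesis using that by blast
  qed
  \<comment> \<open>The index at which the growing bound \<open>b 2 powr (k Q/2)\<close> overtakes the constant bound \<open>A\<close>.\<close>
  define k where "k = (LEAST k::nat. T \<le> 2 powr (real k * (Q/2)))"
  have k: "T \<le> 2 powr (real k * (Q/2))" unfolding k_def by (rule LeastI) fact
  have klt: "2 powr (real j * (Q/2)) < T" if "j < k" for j
    using not_less_Least[of j "\<lambda>k. T \<le> 2 powr (real k * (Q/2))"] that by (simp add: k_def)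
  have low: "(\<Sum>i<k. (1/2)^i * m i) \<le> p / (p - 1) * S"
  proof (cases k)
    case 0
    then show ?thesis using \<open>p > 1\<close> by (simp add: S_def)
  next
    case (Suc j)
    have pw: "(1/2)^i * 2 powr (real i * (Q/2)) = p ^ i" for i :: nat
    proof -
      have "p ^ i = 2 powr (real i * (Q/2) + (- real i))"
        unfolding p_def q_def powr_power by (simp add: algebra_simps powr_powr powr_realpow[symmetric])
      also have "\<dots> = 2 powr (real i * (Q/2)) * 2 powr (- real i)" by (rule powr_add)
      also have "2 powr (- real i) = (1/2)^i"
        by (simp add: powr_minus powr_realpow power_one_over inverse_eq_divide)
      finally show ?thesis by (simp add: mult.commute)
    qed
    have "(\<Sum>i<k. (1/2)^i * m i) \<le> (\<Sum>i<k. (1/2)^i * (b * 2 powr (real i * (Q/2))))"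
      using m(3) by (intro sum_mono mult_left_mono) auto
    also have "\<dots> = (\<Sum>i<k. b * ((1/2)^i * 2 powr (real i * (Q/2))))" by (simp add: mult.left_commute)
    also have "\<dots> = b * (\<Sum>i<k. p ^ i)" unfolding pw by (simp add: sum_distrib_left)
    also have "(\<Sum>i<k. p ^ i) = (p ^ k - 1) / (p - 1)" using \<open>p > 1\<close> by (intro geometric_sum) auto
    also have "b * ((p ^ k - 1) / (p - 1)) \<le> b * (p * T powr (1 - 2/Q) / (p - 1))"
    proof -
      have "p ^ j = (2 powr (real j * (Q/2))) powr (1 - 2/Q)"
      proof -
        have "p ^ j = p powr real j" using \<open>p > 1\<close> by (simp add: powr_realpow)
        also have "\<dots> = 2 powr (q * real j)" by (simp add: p_def powr_powr)
        also have "q * real j = (real j * (Q/2)) * (1 - 2/Q)" using assms(1) by (simp add: q_def field_simps)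
        finally show ?thesis by (simp add: powr_powr)
      qed
      also have "\<dots> \<le> T powr (1 - 2/Q)"
        using klt[of j] Suc assms(1) by (intro powr_mono2) auto
      finally have "p ^ k \<le> p * T powr (1 - 2/Q)" using Suc \<open>p > 1\<close> by simp
      then show ?thesis using \<open>p > 1\<close> \<open>b > 0\<close> by (intro mult_left_mono divide_right_mono) auto
    qed
    also have "\<dots> = p / (p - 1) * (b * T powr (1 - 2/Q))" by simp
    finally show ?thesis using S2 by simp
  qed
  have geo: "(\<Sum>i\<in>{k..<n}. (1/2::real)^i) \<le> 2 * (1/2)^k"
  proof (cases "k \<le> n")
    case True
    then have "(\<Sum>i\<in>{k..<n}. (1/2::real)^i) = 2 * (1/2)^k - 2 * (1/2)^n"
      by (induction n rule: dec_induct) simp_all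
    then show ?thesis by simp
  qed simp
  have high: "(\<Sum>i\<in>{k..<n}. (1/2)^i * m i) \<le> 2 * S"
  proof -
    have "(\<Sum>i\<in>{k..<n}. (1/2)^i * m i) \<le> (\<Sum>i\<in>{k..<n}. (1/2)^i * A)"
      using m(2) by (intro sum_mono mult_left_mono) auto
    also have "\<dots> = A * (\<Sum>i\<in>{k..<n}. (1/2)^i)" by (simp add: sum_distrib_left mult.commute)
    also have "\<dots> \<le> A * (2 * (1/2)^k)" using geo \<open>A > 0\<close> by (intro mult_left_mono) auto
    also have "(1/2::real)^k = (2 powr (real k * (Q/2))) powr (-2/Q)"
      using assms(1) by (simp add: powr_powr powr_minus powr_realpow power_one_over inverse_eq_divide)
    also have "A * (2 * (2 powr (real k * (Q/2))) powr (-2/Q)) \<le> A * (2 * T powr (-2/Q))"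
      using k \<open>T > 0\<close> \<open>A > 0\<close> assms(1) by (intro mult_left_mono powr_mono2') auto
    finally show ?thesis using S1 by simp
  qed
  have "(\<Sum>i<n. (1/2)^i * m i) \<le> (\<Sum>i\<in>{..<k} \<union> {k..<n}. (1/2)^i * m i)"
    using m(1) by (intro sum_mono2) auto
  also have "\<dots> = (\<Sum>i<k. (1/2)^i * m i) + (\<Sum>i\<in>{k..<n}. (1/2)^i * m i)"
    by (intro sum.union_disjoint) auto
  also have "\<dots> \<le> p / (p - 1) * S + 2 * S" using low high by simp
  finally show ?thesis unfolding S_def p_def q_def by (simp add: distrib_right)
qed

context cc_space begin

abbreviation grad_norm :: "(real^'n \<Rightarrow> real) \<Rightarrow> real^'n \<Rightarrow> real" where
  "grad_norm u x \<equiv> norm (X_gradient X u x)"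

lemma grad_norm_continuous: "C1_on UNIV u \<Longrightarrow> continuous_on UNIV (grad_norm u)"
  by (intro continuous_on_norm X_gradient_continuous continuous_fields)

lemma ball_bounded: "bounded (B x r)"
  using ball_subset_domain bounded_domain bounded_subset by blast

lemma domain_borel: "\<Omega> \<in> sets borel"
  using open_domain by (rule borel_open)

lemma mean_le_maximal:
  assumes g: "continuous_on UNIV g" and pos: "\<And>x. g x \<ge> 0" and x: "x \<in> \<Omega>" "r > 0"
  shows "ennreal (mean_on (B x r) g) \<le> maximal (\<lambda>x. ennreal (g x)) x"
proof -
  have "(\<integral>\<^sup>+z\<in>B x r. ennreal (g z) \<partial>lborel) / emeasure lborel (B x r) = ennreal (mean_on (B x r) g)"
    unfolding nn_integral_continuous_eq[OF g ball_borel[OF x(1)] ball_bounded pos] emeasure_ball[OF x(1)] mean_on_def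
    using ball_measure_pos[OF x] pos
    by (intro divide_ennreal) (auto simp: set_lebesgue_integral_def intro!: integral_nonneg_AE)
  then show ?thesis
    unfolding maximal_def using centre_in_ball_cc[OF x] x
    by (intro SUP_upper2[of "(x, r)"]) auto
qed

text \<open>Control balls shrink to their centre in the Euclidean sense.\<close>
lemma mean_tendsto_value:
  assumes u: "continuous_on UNIV u" and x: "x \<in> \<Omega>" and "\<And>i. r i > 0" "r \<longlonglongrightarrow> (0::real)"
  shows "(\<lambda>i. mean_on (B x (r i)) u) \<longlonglongrightarrow> u x"
proof (rule tendstoI)
  fix e :: real assume "e > 0"
  have "isCont u x" using u by (simp add: continuous_on_eq_continuous_at)
  then obtain \<delta> where "\<delta> > 0" and \<delta>: "\<And>y. dist y x < \<delta> \<Longrightarrow> dist (u y) (u x) < e/2"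
    unfolding continuous_at_eps_delta using \<open>e > 0\<close> by (metis half_gt_zero)
  obtain s where s: "s > 0" "B x s \<subseteq> ball x \<delta>"
    using small_ball_in_euclidean_ball[OF x \<open>\<delta> > 0\<close>] by blast
  have "\<forall>\<^sub>F i in sequentially. r i < s" using assms(4) s(1) by (rule order_tendstoD)
  then show "\<forall>\<^sub>F i in sequentially. dist (mean_on (B x (r i)) u) (u x) < e"
  proof eventually_elim
    fix i assume "r i < s"
    then have sub: "B x (r i) \<subseteq> ball x \<delta>" using s(2) ball_mono[of "r i" s x] by auto
    note pos = ball_measure_pos[OF x assms(3)[of i]]
    have "\<bar>mean_on (B x (r i)) u - u x\<bar> \<le> 1 * mean_on (B x (r i)) (\<lambda>y. \<bar>u y - u x\<bar>)"
      by (intro mean_on_diff_le u ball_borel[OF x] ball_bounded pos) auto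
    also have "\<dots> \<le> e/2"
    proof -
      have "(LINT y:B x (r i)|lebesgue. \<bar>u y - u x\<bar>) \<le> (LINT y:B x (r i)|lebesgue. e/2)"
      proof (rule set_integral_mono)
        show "set_integrable lebesgue (B x (r i)) (\<lambda>y. \<bar>u y - u x\<bar>)" "set_integrable lebesgue (B x (r i)) (\<lambda>y. e/2)"
          by (intro continuous_set_integrable continuous_intros u ball_borel[OF x] ball_bounded)+
        fix y assume "y \<in> B x (r i)"
        then have "dist y x < \<delta>" using sub by (auto simp: dist_commute)
        then show "\<bar>u y - u x\<bar> \<le> e/2" using \<delta> by (force simp: dist_real_def)
      qed
      also have "\<dots> = e/2 * measure lebesgue (B x (r i))"
        using ball_lmeasurable[OF x, of "r i"] by (simp add: set_integral_const_lmeasurable)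
      finally show ?thesis using pos by (simp add: mean_on_def field_simps)
    qed
    finally show "dist (mean_on (B x (r i)) u) (u x) < e" using \<open>e > 0\<close> by (simp add: dist_real_def)
  qed
qed

lemma set_integral_square_nonneg: "0 \<le> (LINT y:S|M. (f y :: real)\<^sup>2)"
  unfolding set_lebesgue_integral_def by (intro integral_nonneg_AE) auto

text \<open>Telescoping along the balls of radius \<open>(1/2)\<^sup>i D\<close> around \<open>x\<close>; the averages of the gradient are
  bounded both by its maximal function and, by the lower bound on the measure of balls, by its
  \<open>L\<^sup>2\<close> norm.\<close>
lemma pointwise_oscillation_bound:
  obtains C where "C > 0"
    "\<And>u x A. \<lbrakk>C1_on UNIV u; x \<in> \<Omega>; A \<ge> 0; maximal (\<lambda>x. ennreal (grad_norm u x)) x \<le> ennreal A\<rbrakk> \<Longrightarrow>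
       \<bar>u x - mean_on \<Omega> u\<bar> \<le> C * (A powr (1 - 2/Q) * (LINT y:\<Omega>|lebesgue. (grad_norm u y)\<^sup>2) powr (1/Q))"
proof -
  obtain D where D: "D > 0" "\<And>x y. x \<in> \<Omega> \<Longrightarrow> y \<in> \<Omega> \<Longrightarrow> d x y < D" using dist_bounded by blast
  obtain P \<nu> where P: "P > 0" "\<nu> > 0" and poin: "\<forall>x\<in>\<Omega>. \<forall>r>0. \<forall>u U.
      open U \<and> closure (B x r \<union> B x (\<nu> * r)) \<subseteq> U \<and> C1_on U u \<longrightarrow>
      mean_on (B x r) (\<lambda>y. \<bar>u y - mean_on (B x r) u\<bar>)
        \<le> P * r * mean_on (B x (\<nu> * r)) (\<lambda>y. norm (X_gradient X u y))"
    using poincare unfolding cc_poincare_def by (elim exE conjE)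
  \<comment> \<open>Large enough for the lower bound on the measure of all balls of radius \<open>\<nu> r i\<close> below.\<close>
  define R where "R = max D (\<nu> * D)"
  have R: "R > 0" "R \<ge> D" "R \<ge> \<nu> * D" using D by (auto simp: R_def)
  have full: "B x s = \<Omega>" if "x \<in> \<Omega>" "s \<ge> D" for x s
    using D(2)[OF that(1)] that(2) by (force simp: cc_ball_def)
  define c where "c = ((2 * R / (\<nu> * D)) powr Q / measure lebesgue \<Omega>) powr (1/2)"
  have "c > 0" using R D P domain_measure_pos by (simp add: c_def)
  define H where "H = (2 powr (Q/2 - 1) / (2 powr (Q/2 - 1) - 1) + 2)"
  have "(1::real) < 2 powr (Q/2 - 1)" using dimension_gt_2 by simp
  then have "H > 0" unfolding H_def by (intro add_pos_pos divide_pos_pos) auto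
  define C where "C = doubling_const * P * D * (H * c powr (2/Q))"
  have "C > 0" using doubling_const_ge_1 P D \<open>H > 0\<close> \<open>c > 0\<close> by (simp add: C_def)
  moreover have "\<bar>u x - mean_on \<Omega> u\<bar> \<le> C * (A powr (1 - 2/Q) * (LINT y:\<Omega>|lebesgue. (grad_norm u y)\<^sup>2) powr (1/Q))"
    if u: "C1_on UNIV u" and x: "x \<in> \<Omega>" and "A \<ge> 0" and A: "maximal (\<lambda>x. ennreal (grad_norm u x)) x \<le> ennreal A"
    for u x A
  proof -
    define g where "g = grad_norm u"
    define I where "I = (LINT y:\<Omega>|lebesgue. (g y)\<^sup>2)"
    have "I \<ge> 0" unfolding I_def by (rule set_integral_square_nonneg)
    have g: "continuous_on UNIV g" unfolding g_def by (rule grad_norm_continuous[OF u])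
    have uc: "continuous_on UNIV u" by (rule C1_onD[OF u])
    define r where "r = (\<lambda>i::nat. D * (1/2)^i)"
    have r: "r i > 0" "r (Suc i) = r i / 2" "r i \<le> D" for i
      using D by (auto simp: r_def mult_left_le power_le_one)
    define m where "m = (\<lambda>i. mean_on (B x (\<nu> * r i)) g)"
    define a where "a = (\<lambda>i. mean_on (B x (r i)) u)"
    have m0: "0 \<le> m i" for i
      unfolding m_def mean_on_def set_lebesgue_integral_def g_def by (intro divide_nonneg_nonneg integral_nonneg_AE) auto
    have step: "\<bar>a (Suc i) - a i\<bar> \<le> doubling_const * P * D * ((1/2)^i * m i)" for i
    proof -
      have "\<bar>a (Suc i) - a i\<bar> \<le> doubling_const * mean_on (B x (r i)) (\<lambda>y. \<bar>u y - a i\<bar>)"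
        unfolding a_def
      proof (rule mean_on_diff_le[OF uc])
        show "B x (r (Suc i)) \<subseteq> B x (r i)" using r[of i] by (intro ball_mono) simp
        show "measure lebesgue (B x (r i)) \<le> doubling_const * measure lebesgue (B x (r (Suc i)))"
          using ball_doubling[OF x r(1)[of "Suc i"]] unfolding r(2)[of i] by (simp add: doubling_const_def)
      qed (auto intro: ball_borel x ball_bounded ball_measure_pos r)
      also have "mean_on (B x (r i)) (\<lambda>y. \<bar>u y - a i\<bar>) \<le> P * r i * m i"
        unfolding a_def m_def g_def by (rule poin[rule_format, OF x r(1), of UNIV]) (use u in auto)
      also have "P * r i * m i = P * D * ((1/2)^i * m i)" by (simp add: r_def)
      finally show ?thesis using doubling_const_ge_1 by (simp add: mult_left_mono mult.assoc)
    qed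
    have mA: "m i \<le> A" for i
    proof -
      have "ennreal (m i) \<le> maximal (\<lambda>x. ennreal (g x)) x"
        unfolding m_def by (rule mean_le_maximal[OF g]) (use x P r in \<open>auto simp: g_def\<close>)
      then have "ennreal (m i) \<le> ennreal A" using A unfolding g_def by (rule order_trans)
      then show ?thesis using \<open>A \<ge> 0\<close> by simp
    qed
    have mb: "m i \<le> (c * I powr (1/2)) * 2 powr (real i * (Q/2))" for i
    proof -
      define V where "V = measure lebesgue (B x (\<nu> * r i))"
      have V: "V > 0" unfolding V_def using ball_measure_pos x P r by simp
      have "(m i)\<^sup>2 * V \<le> (LINT y:B x (\<nu> * r i)|lebesgue. (g y)\<^sup>2)"
        unfolding m_def V_def by (rule mean_on_square_le[OF g]) (use V in \<open>auto simp: V_def x intro: ball_borel ball_bounded\<close>)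
      also have "\<dots> \<le> I" unfolding I_def
        by (intro set_integral_subset_mono continuous_set_integrable continuous_intros g domain_borel bounded_domain)
           (use ball_subset_domain ball_borel[OF x] in auto)
      finally have 1: "(m i)\<^sup>2 * V \<le> I" .
      have "measure lebesgue \<Omega> \<le> (2 * R / (\<nu> * r i)) powr Q * V"
        unfolding V_def
      proof (rule domain_measure_le_ball[OF x])
        show "0 < \<nu> * r i" using P r by simp
        have "\<nu> * r i \<le> \<nu> * D" using r(3)[of i] P by simp
        then show "\<nu> * r i \<le> R" using R by simp
        show "B x R = \<Omega>" using full x R by simp
      qed
      also have "2 * R / (\<nu> * r i) = (2 * R / (\<nu> * D)) * 2 ^ i" by (simp add: r_def power_one_over)
      also have "\<dots> powr Q = (2 * R / (\<nu> * D)) powr Q * 2 powr (real i * Q)"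
      proof -
        have "(2 ^ i :: real) powr Q = 2 powr (real i * Q)"
          by (simp add: powr_powr powr_realpow[symmetric])
        then show ?thesis using R D P by (subst powr_mult) auto
      qed
      finally have 2: "measure lebesgue \<Omega> \<le> (2 * R / (\<nu> * D)) powr Q * 2 powr (real i * Q) * V" .
      have "(m i)\<^sup>2 * measure lebesgue \<Omega> \<le> (m i)\<^sup>2 * ((2 * R / (\<nu> * D)) powr Q * 2 powr (real i * Q) * V)"
        using 2 by (intro mult_left_mono) auto
      also have "\<dots> = (2 * R / (\<nu> * D)) powr Q * 2 powr (real i * Q) * ((m i)\<^sup>2 * V)" by (simp add: mult_ac)
      also have "\<dots> \<le> (2 * R / (\<nu> * D)) powr Q * 2 powr (real i * Q) * I"
        using 1 by (intro mult_left_mono) auto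
      finally have "(m i)\<^sup>2 \<le> ((2 * R / (\<nu> * D)) powr Q / measure lebesgue \<Omega>) * I * 2 powr (real i * Q)"
        using domain_measure_pos by (simp add: field_simps)
      then have "((m i)\<^sup>2) powr (1/2) \<le> (((2 * R / (\<nu> * D)) powr Q / measure lebesgue \<Omega>) * I * 2 powr (real i * Q)) powr (1/2)"
        by (intro powr_mono2) auto
      also have "\<dots> = (c * I powr (1/2)) * 2 powr (real i * (Q/2))"
      proof -
        have *: "(w * I * z) powr (1/2) = w powr (1/2) * I powr (1/2) * z powr (1/2)" if "w \<ge> 0" "z \<ge> 0" for w z
          using that \<open>I \<ge> 0\<close> by (simp add: powr_mult)
        have z: "2 powr (real i * (Q/2)) = (2 powr (real i * Q)) powr (1/2)" by (simp add: powr_powr)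
        show ?thesis unfolding c_def z by (rule *) auto
      qed
      finally show ?thesis using m0[of i] by (simp add: powr_half_sqrt)
    qed
    have tele: "\<bar>a n - a 0\<bar> \<le> doubling_const * P * D * (\<Sum>i<n. (1/2)^i * m i)" for n
    proof (induction n)
      case (Suc n)
      then show ?case using step[of n] by (simp add: distrib_left)
    qed simp
    have bound: "\<bar>a n - a 0\<bar> \<le> C * (A powr (1 - 2/Q) * I powr (1/Q))" for n
    proof -
      have "(\<Sum>i<n. (1/2)^i * m i) \<le> H * (A powr (1 - 2/Q) * (c * I powr (1/2)) powr (2/Q))"
        unfolding H_def using \<open>c > 0\<close> by (intro hedberg_sum dimension_gt_2 \<open>A \<ge> 0\<close> m0 mA mb) auto
      also have "(c * I powr (1/2)) powr (2/Q) = c powr (2/Q) * I powr (1/Q)"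
        using \<open>c > 0\<close> by (simp add: powr_mult powr_powr)
      finally have "doubling_const * P * D * (\<Sum>i<n. (1/2)^i * m i) \<le> doubling_const * P * D * (H * (A powr (1 - 2/Q) * (c powr (2/Q) * I powr (1/Q))))"
        using doubling_const_ge_1 P D by (intro mult_left_mono) auto
      also have "\<dots> = C * (A powr (1 - 2/Q) * I powr (1/Q))" by (simp add: C_def mult_ac)
      finally show ?thesis using tele[of n] by simp
    qed
    have "r \<longlonglongrightarrow> D * 0" unfolding r_def by (intro tendsto_intros LIMSEQ_power_zero) auto
    then have "a \<longlonglongrightarrow> u x" unfolding a_def using r(1) by (intro mean_tendsto_value uc x) auto
    then have "(\<lambda>n. \<bar>a n - a 0\<bar>) \<longlonglongrightarrow> \<bar>u x - a 0\<bar>" by (intro tendsto_intros)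
    then have "\<bar>u x - a 0\<bar> \<le> C * (A powr (1 - 2/Q) * I powr (1/Q))"
      using bound by (intro LIMSEQ_le_const2) auto
    moreover have "a 0 = mean_on \<Omega> u" using full[OF x, of D] by (simp add: a_def r_def)
    ultimately show ?thesis by (simp add: I_def g_def)
  qed
  ultimately show thesis using that by blast
qed

text \<open>Raise the pointwise bound to the power \<open>2 Q / (Q - 2)\<close>; since \<open>(1 - 2/Q) 2 Q / (Q - 2) = 2\<close>, the
  maximal theorem in \<open>L\<^sup>2\<close> applies.\<close>
theorem sobolev_poincare:
  obtains C where "C > 0"
    "\<And>u. C1_on UNIV u \<Longrightarrow> (\<integral>\<^sup>+x\<in>\<Omega>. ennreal (\<bar>u x - mean_on \<Omega> u\<bar> powr (2 * Q / (Q - 2))) \<partial>lborel)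
       \<le> ennreal (C * (LINT y:\<Omega>|lebesgue. (grad_norm u y)\<^sup>2) powr (Q / (Q - 2)))"
proof -
  obtain C where "C > 0" and C:
    "\<And>u x A. \<lbrakk>C1_on UNIV u; x \<in> \<Omega>; A \<ge> 0; maximal (\<lambda>x. ennreal (grad_norm u x)) x \<le> ennreal A\<rbrakk> \<Longrightarrow>
       \<bar>u x - mean_on \<Omega> u\<bar> \<le> C * (A powr (1 - 2/Q) * (LINT y:\<Omega>|lebesgue. (grad_norm u y)\<^sup>2) powr (1/Q))"
    using pointwise_oscillation_bound by blast
  define s where "s = 2 * Q / (Q - 2)"
  have s: "s > 0" "(1 - 2/Q) * s = 2" "(1/Q) * s = 2 / (Q - 2)"
    using dimension_gt_2 by (auto simp: s_def field_simps)
  show thesis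
  proof (rule that)
    show "C powr s * (8 * doubling_const\<^sup>2) > 0" using \<open>C > 0\<close> doubling_const_ge_1 by simp
    fix u :: "real^'n \<Rightarrow> real" assume u: "C1_on UNIV u"
    define g where "g = grad_norm u"
    define I where "I = (LINT y:\<Omega>|lebesgue. (g y)\<^sup>2)"
    have "I \<ge> 0" unfolding I_def by (rule set_integral_square_nonneg)
    have g: "continuous_on UNIV g" unfolding g_def by (rule grad_norm_continuous[OF u])
    have [measurable]: "g \<in> borel_measurable borel" using g by (rule borel_measurable_continuous_onI)
    define k where "k = C powr s * I powr (2 / (Q - 2))"
    have "k \<ge> 0" by (simp add: k_def)
    have pt: "ennreal (\<bar>u x - mean_on \<Omega> u\<bar> powr s) * indicator \<Omega> x
       \<le> ennreal k * (maximal (\<lambda>x. ennreal (g x)) x * maximal (\<lambda>x. ennreal (g x)) x)" for x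
    proof (cases "x \<in> \<Omega>")
      case True
      have fin: "\<bar>u x - mean_on \<Omega> u\<bar> powr s \<le> k * (A * A)" if "A \<ge> 0" "maximal (\<lambda>x. ennreal (g x)) x \<le> ennreal A" for A
      proof -
        have "\<bar>u x - mean_on \<Omega> u\<bar> powr s \<le> (C * (A powr (1 - 2/Q) * I powr (1/Q))) powr s"
          using C[OF u True that(1)] that(2) s(1) by (intro powr_mono2) (auto simp: I_def g_def)
        also have "\<dots> = C powr s * (A powr 2 * I powr (2 / (Q - 2)))"
          using \<open>C > 0\<close> \<open>A \<ge> 0\<close> \<open>I \<ge> 0\<close> by (simp add: powr_mult powr_powr s(2,3) del: times_divide_eq_left times_divide_eq_right)
        finally show ?thesis using \<open>A \<ge> 0\<close> by (simp add: k_def mult_ac power2_eq_square)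
      qed
      show ?thesis
      proof (cases "maximal (\<lambda>x. ennreal (g x)) x")
        case (real A)
        then show ?thesis using fin[of A] True \<open>k \<ge> 0\<close> by (simp add: ennreal_mult[symmetric] ennreal_leI)
      next
        case top
        show ?thesis
        proof (cases "k = 0")
          case k0: True
          \<comment> \<open>The gradient vanishes identically, and so does its maximal function.\<close>
          then have "I = 0" using \<open>C > 0\<close> \<open>I \<ge> 0\<close> by (auto simp: k_def)
          then have "(\<integral>\<^sup>+x\<in>\<Omega>. ennreal (g x) * ennreal (g x) \<partial>lborel) = 0"
            using nn_integral_continuous_eq[of "\<lambda>x. (g x)\<^sup>2" \<Omega>] g domain_borel bounded_domain
            by (simp add: I_def power2_eq_square ennreal_mult[symmetric] g_def continuous_intros)
          then have ae: "AE z in lborel. ennreal (g z) * ennreal (g z) * indicator \<Omega> z = 0"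
            using domain_borel by (subst (asm) nn_integral_0_iff_AE) auto
          have "maximal (\<lambda>x. ennreal (g x)) x \<le> 0"
            unfolding maximal_def
          proof (rule SUP_least, clarify)
            fix y r
            have "(\<integral>\<^sup>+z\<in>B y r. ennreal (g z) \<partial>lborel) = (\<integral>\<^sup>+z. 0 \<partial>(lborel :: (real^'n) measure))"
            proof (rule nn_integral_cong_AE)
              show "AE z in lborel. ennreal (g z) * indicator (B y r) z = 0"
                using ae
              proof eventually_elim
                fix z assume "ennreal (g z) * ennreal (g z) * indicator \<Omega> z = 0"
                then show "ennreal (g z) * indicator (B y r) z = 0"
                  using ball_subset_domain[of y r] by (auto simp: indicator_def split: if_splits)
              qed
            qed
            then show "(\<integral>\<^sup>+z\<in>B y r. ennreal (g z) \<partial>lborel) / emeasure lborel (B y r) \<le> 0" by simp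
          qed
          then show ?thesis using top by simp
        next
          case False
          then show ?thesis using top \<open>k \<ge> 0\<close> by (simp add: ennreal_mult_top)
        qed
      qed
    qed simp
    have "(\<integral>\<^sup>+x\<in>\<Omega>. ennreal (\<bar>u x - mean_on \<Omega> u\<bar> powr s) \<partial>lborel)
      \<le> (\<integral>\<^sup>+x. ennreal k * (maximal (\<lambda>x. ennreal (g x)) x * maximal (\<lambda>x. ennreal (g x)) x) \<partial>lborel)"
      by (intro nn_integral_mono pt)
    also have "\<dots> = ennreal k * (\<integral>\<^sup>+x. maximal (\<lambda>x. ennreal (g x)) x * maximal (\<lambda>x. ennreal (g x)) x \<partial>lborel)"
      by (rule nn_integral_cmult) measurable
    also have "\<dots> \<le> ennreal k * (ennreal (8 * doubling_const\<^sup>2) * (\<integral>\<^sup>+x\<in>\<Omega>. ennreal (g x) * ennreal (g x) \<partial>lborel))"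
      by (intro mult_left_mono maximal_L2_bound) auto
    also have "(\<integral>\<^sup>+x\<in>\<Omega>. ennreal (g x) * ennreal (g x) \<partial>lborel) = ennreal I"
      using nn_integral_continuous_eq[of "\<lambda>x. (g x)\<^sup>2" \<Omega>] g domain_borel bounded_domain
      by (simp add: I_def power2_eq_square ennreal_mult[symmetric] g_def continuous_intros)
    also have "ennreal k * (ennreal (8 * doubling_const\<^sup>2) * ennreal I) = ennreal (k * (8 * doubling_const\<^sup>2 * I))"
      using \<open>k \<ge> 0\<close> \<open>I \<ge> 0\<close> by (simp add: ennreal_mult)
    also have "k * (8 * doubling_const\<^sup>2 * I) = C powr s * (8 * doubling_const\<^sup>2) * I powr (Q / (Q - 2))"
    proof -
      have "Q / (Q - 2) = 2 / (Q - 2) + 1" using dimension_gt_2 by (simp add: field_simps)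
      then have "I powr (Q / (Q - 2)) = I powr (2 / (Q - 2)) * I" using \<open>I \<ge> 0\<close> by (simp add: powr_add)
      then show ?thesis by (simp add: k_def mult_ac)
    qed
    finally show "(\<integral>\<^sup>+x\<in>\<Omega>. ennreal (\<bar>u x - mean_on \<Omega> u\<bar> powr (2 * Q / (Q - 2))) \<partial>lborel)
       \<le> ennreal (C powr s * (8 * doubling_const\<^sup>2) * (LINT y:\<Omega>|lebesgue. (grad_norm u y)\<^sup>2) powr (Q / (Q - 2)))"
      by (simp only: s_def I_def g_def)
  qed
qed

end

section \<open>Test functions and the exterior of the domain\<close>

lemma C1_onI:
  fixes u :: "real^'n \<Rightarrow> real"
  assumes "\<And>x. (u has_derivative D x) (at x)" and "\<And>v. continuous_on UNIV (\<lambda>x. D x v)"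
  shows "C1_on UNIV u"
proof -
  have "frechet_derivative u (at x) = D x" for x using frechet_derivative_at[OF assms(1)] by simp
  then show ?thesis using assms unfolding C1_on_def
    by (auto simp: differentiable_on_def differentiable_def)
qed

lemma X_gradient_eq:
  assumes "(u has_derivative D) (at x)"
  shows "X_gradient X u x $ j = D (X j x)"
  unfolding X_gradient_def using frechet_derivative_at[OF assms] by simp

lemma C1_on_has_derivative:
  "C1_on UNIV u \<Longrightarrow> (u has_derivative frechet_derivative u (at x)) (at x)"
  using C1_onD(2) frechet_derivative_works by blast

lemma integrable_continuous_bounded_support:
  fixes f :: "real^'n \<Rightarrow> real"
  assumes f: "continuous_on UNIV f" and zero: "\<And>x. x \<notin> cball a R \<Longrightarrow> f x = 0"
  shows "integrable lborel f"
proof -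
  have [measurable]: "f \<in> borel_measurable borel" using f by (rule borel_measurable_continuous_onI)
  have "f = (\<lambda>x. indicator (cball a R) x *\<^sub>R f x)" using zero by (auto simp: indicator_def fun_eq_iff)
  moreover have "set_integrable lebesgue (cball a R) f" by (intro continuous_set_integrable f) auto
  ultimately have "integrable lebesgue f" unfolding set_integrable_def by simp
  then show ?thesis by (simp add: integrable_completion)
qed

lemma has_derivative_along_line:
  fixes w :: "real^'n \<Rightarrow> real"
  assumes "C1_on UNIV w"
  shows "((\<lambda>s. w (x + s *\<^sub>R e)) has_real_derivative frechet_derivative w (at (x + s *\<^sub>R e)) e) (at s)"
proof -
  interpret D: linear "frechet_derivative w (at (x + s *\<^sub>R e))"
    using C1_onD(2)[OF assms] by (rule linear_frechet_derivative)
  have "((\<lambda>s. x + s *\<^sub>R e) has_derivative (\<lambda>h. h *\<^sub>R e)) (at s)" by (auto intro!: derivative_eq_intros)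
  from has_derivative_compose[OF this C1_on_has_derivative[OF assms]]
  have "((\<lambda>s. w (x + s *\<^sub>R e)) has_derivative (\<lambda>h. frechet_derivative w (at (x + s *\<^sub>R e)) (h *\<^sub>R e))) (at s)" .
  moreover have "(\<lambda>h. frechet_derivative w (at (x + s *\<^sub>R e)) (h *\<^sub>R e)) = (*) (frechet_derivative w (at (x + s *\<^sub>R e)) e)"
    by (simp add: D.scale fun_eq_iff)
  ultimately show ?thesis by (simp add: has_field_derivative_def)
qed

text \<open>Integration by parts against a coefficient that is merely Lipschitz: move the difference
  quotient from \<open>w\<close> to \<open>c\<close> by translation invariance, and let the step tend to \<open>0\<close>.\<close>
lemma integral_lipschitz_derivative_bound:
  fixes w c :: "real^'n \<Rightarrow> real"
  assumes w: "C1_on UNIV w" and zero: "\<And>x. x \<notin> cball 0 R \<Longrightarrow> w x = 0"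
    and c: "continuous_on UNIV c" and L: "L-lipschitz_on (cball 0 (R + 1)) c" and e: "norm e = 1"
  shows "\<bar>LINT x|lborel. c x * frechet_derivative w (at x) e\<bar> \<le> L * (LINT x|lborel. \<bar>w x\<bar>)"
proof -
  have wc: "continuous_on UNIV w" using C1_onD[OF w] by simp
  have Dc: "continuous_on UNIV (\<lambda>x. frechet_derivative w (at x) e)" using C1_onD[OF w] by simp
  have [measurable]: "w \<in> borel_measurable borel" "c \<in> borel_measurable borel"
    "(\<lambda>x. frechet_derivative w (at x) e) \<in> borel_measurable borel"
    using wc c Dc by (auto intro: borel_measurable_continuous_onI)
  define q where "q = (\<lambda>t x. c x * ((w (x + t *\<^sub>R e) - w x) / t))"
  have bound: "\<bar>LINT x|lborel. q t x\<bar> \<le> L * (LINT x|lborel. \<bar>w x\<bar>)" if t: "0 < t" "t \<le> 1" for t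
  proof -
    have tc: "continuous_on UNIV (\<lambda>x. w (x + t *\<^sub>R e))" "continuous_on UNIV (\<lambda>x. c (x - t *\<^sub>R e))"
      by (intro continuous_on_compose2[OF wc] continuous_on_compose2[OF c] continuous_intros, auto)+
    have tz: "w (x + t *\<^sub>R e) = 0" if "x \<notin> cball 0 (R + 1)" for x
    proof (rule zero)
      have "norm x \<le> norm (x + t *\<^sub>R e) + norm (t *\<^sub>R e)" using norm_triangle_ineq4[of "x + t *\<^sub>R e" "t *\<^sub>R e"] by simp
      then show "x + t *\<^sub>R e \<notin> cball 0 R" using that t e by simp
    qed
    have i1: "integrable lborel (\<lambda>x. c x * w (x + t *\<^sub>R e))"
      by (rule integrable_continuous_bounded_support[of _ 0 "R + 1"]) (use tz in \<open>auto intro!: continuous_intros c tc\<close>)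
    have i2: "integrable lborel (\<lambda>x. c x * w x)" "integrable lborel (\<lambda>x. c (x - t *\<^sub>R e) * w x)" "integrable lborel (\<lambda>x. \<bar>w x\<bar>)"
      by (rule integrable_continuous_bounded_support[of _ 0 R]; use zero in \<open>auto intro!: continuous_intros c tc wc\<close>)+
    have "(LINT x|lborel. q t x) = ((LINT x|lborel. c x * w (x + t *\<^sub>R e)) - (LINT x|lborel. c x * w x)) / t"
      unfolding q_def using i1 i2 by (simp add: right_diff_distrib diff_divide_distrib)
    also have "(LINT x|lborel. c x * w (x + t *\<^sub>R e)) = (LINT x|lborel. c (x - t *\<^sub>R e) * w x)"
    proof -
      have "(LINT x|lborel. c (x - t *\<^sub>R e) * w x) = (LINT x|distr lborel borel ((+) (t *\<^sub>R e)). c (x - t *\<^sub>R e) * w x)"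
        by (simp add: lborel_distr_plus)
      also have "\<dots> = (LINT x|lborel. c x * w (x + t *\<^sub>R e))"
        by (subst integral_distr) (auto simp: add.commute)
      finally show ?thesis by simp
    qed
    also have "((LINT x|lborel. c (x - t *\<^sub>R e) * w x) - (LINT x|lborel. c x * w x)) / t
       = (LINT x|lborel. ((c (x - t *\<^sub>R e) - c x) * w x) / t)"
      using i2 by (simp add: left_diff_distrib)
    also have "\<bar>\<dots>\<bar> \<le> (LINT x|lborel. \<bar>((c (x - t *\<^sub>R e) - c x) * w x) / t\<bar>)"
      by (rule integral_abs_bound)
    also have "\<dots> \<le> (LINT x|lborel. L * \<bar>w x\<bar>)"
    proof (rule integral_mono)
      show "integrable lborel (\<lambda>x. \<bar>((c (x - t *\<^sub>R e) - c x) * w x) / t\<bar>)"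
        using i2 by (intro integrable_abs integrable_divide) (simp add: left_diff_distrib)
      show "integrable lborel (\<lambda>x. L * \<bar>w x\<bar>)" using i2 by simp
      fix x
      show "\<bar>((c (x - t *\<^sub>R e) - c x) * w x) / t\<bar> \<le> L * \<bar>w x\<bar>"
      proof (cases "x \<in> cball 0 R")
        case True
        have "norm (x - t *\<^sub>R e) \<le> norm x + norm (t *\<^sub>R e)" by (rule norm_triangle_ineq4)
        then have "x - t *\<^sub>R e \<in> cball 0 (R + 1)" using True t e by simp
        moreover have "x \<in> cball 0 (R + 1)" using True by simp
        ultimately have "\<bar>c (x - t *\<^sub>R e) - c x\<bar> \<le> L * t"
          using lipschitz_onD[OF L, of "x - t *\<^sub>R e" x] t e by (simp add: dist_norm dist_real_def)
        then have "\<bar>c (x - t *\<^sub>R e) - c x\<bar> * \<bar>w x\<bar> \<le> (L * t) * \<bar>w x\<bar>" by (rule mult_right_mono) simp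
        moreover have "\<bar>((c (x - t *\<^sub>R e) - c x) * w x) / t\<bar> = \<bar>c (x - t *\<^sub>R e) - c x\<bar> * \<bar>w x\<bar> / t"
          using t by (simp only: abs_mult abs_divide abs_of_pos)
        ultimately show ?thesis using t by (simp add: pos_divide_le_eq mult_ac)
      qed (simp add: zero)
    qed
    finally show ?thesis using i2 by simp
  qed
  define t where "t = (\<lambda>n::nat. 1 / real (Suc n))"
  have t: "0 < t n" "t n \<le> 1" for n by (auto simp: t_def)
  have t0: "t \<longlonglongrightarrow> 0" unfolding t_def using LIMSEQ_inverse_real_of_nat by (simp add: inverse_eq_divide)
  have "compact (c ` cball 0 (R + 1))" "compact ((\<lambda>x. frechet_derivative w (at x) e) ` cball 0 (R + 2))"
    by (intro compact_continuous_image continuous_on_subset[OF c subset_UNIV] continuous_on_subset[OF Dc subset_UNIV] compact_cball)+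
  then obtain M1 M2 where M: "M1 > 0" "M2 > 0" "\<And>x. x \<in> cball 0 (R + 1) \<Longrightarrow> \<bar>c x\<bar> \<le> M1"
    "\<And>x. x \<in> cball 0 (R + 2) \<Longrightarrow> \<bar>frechet_derivative w (at x) e\<bar> \<le> M2"
    by (auto dest!: compact_imp_bounded simp: bounded_pos)
  have "(\<lambda>n. LINT x|lborel. q (t n) x) \<longlonglongrightarrow> (LINT x|lborel. c x * frechet_derivative w (at x) e)"
  proof (rule integral_dominated_convergence[where w="\<lambda>x. (M1 * M2) * indicator (cball 0 (R + 1)) x"])
    show "q (t n) \<in> borel_measurable lborel" for n unfolding q_def by measurable
    show "(\<lambda>x. c x * frechet_derivative w (at x) e) \<in> borel_measurable lborel" by measurable
    show "integrable lborel (\<lambda>x. M1 * M2 * indicator (cball (0::real^'n) (R + 1)) x)"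
      using emeasure_bounded_finite[of "cball (0::real^'n) (R + 1)"] by (intro integrable_mult_right integrable_real_indicator) auto
    show "AE x in lborel. (\<lambda>n. q (t n) x) \<longlonglongrightarrow> c x * frechet_derivative w (at x) e"
    proof (rule AE_I2)
      fix x
      have "(\<lambda>h. (w (x + (0 + h) *\<^sub>R e) - w (x + 0 *\<^sub>R e)) / h) \<midarrow>0\<rightarrow> frechet_derivative w (at (x + 0 *\<^sub>R e)) e"
        using has_derivative_along_line[OF w, of x e 0] unfolding DERIV_def .
      then have lim: "(\<lambda>h. (w (x + h *\<^sub>R e) - w x) / h) \<midarrow>0\<rightarrow> frechet_derivative w (at x) e" by simp
      have "filterlim t (at 0) sequentially"
        using t0 t(1) by (auto simp: filterlim_at intro!: always_eventually less_imp_neq[THEN not_sym])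
      from filterlim_compose[OF lim this]
      show "(\<lambda>n. q (t n) x) \<longlonglongrightarrow> c x * frechet_derivative w (at x) e"
        unfolding q_def by (intro tendsto_intros)
    qed
    show "AE x in lborel. norm (q (t n) x) \<le> M1 * M2 * indicator (cball 0 (R + 1)) x" for n
    proof (rule AE_I2)
      fix x
      show "norm (q (t n) x) \<le> M1 * M2 * indicator (cball 0 (R + 1)) x"
      proof (cases "x \<in> cball 0 (R + 1)")
        case True
        have "\<exists>z. 0 < z \<and> z < t n \<and> w (x + t n *\<^sub>R e) - w (x + 0 *\<^sub>R e) = (t n - 0) * frechet_derivative w (at (x + z *\<^sub>R e)) e"
          using t(1) by (intro MVT2) (auto intro: has_derivative_along_line[OF w])
        then obtain z where z: "0 < z" "z < t n" "w (x + t n *\<^sub>R e) - w x = t n * frechet_derivative w (at (x + z *\<^sub>R e)) e" by auto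
        have "norm (x + z *\<^sub>R e) \<le> norm x + norm (z *\<^sub>R e)" by (rule norm_triangle_ineq)
        then have "x + z *\<^sub>R e \<in> cball 0 (R + 2)" using True z t(2)[of n] e by simp
        then have "\<bar>c x * frechet_derivative w (at (x + z *\<^sub>R e)) e\<bar> \<le> M1 * M2"
          unfolding abs_mult using M True by (intro mult_mono) auto
        moreover have "q (t n) x = c x * frechet_derivative w (at (x + z *\<^sub>R e)) e"
          using z t(1)[of n] by (simp add: q_def)
        ultimately show ?thesis using True by simp
      next
        case False
        have "norm x \<le> norm (x + t n *\<^sub>R e) + norm (t n *\<^sub>R e)" using norm_triangle_ineq4[of "x + t n *\<^sub>R e" "t n *\<^sub>R e"] by simp
        then have "x + t n *\<^sub>R e \<notin> cball 0 R" using False t[of n] e by auto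
        moreover have "x \<notin> cball 0 R" using False by auto
        ultimately have "q (t n) x = 0" using zero by (simp add: q_def)
        then show ?thesis using False by simp
      qed
    qed
  qed
  then have "(\<lambda>n. \<bar>LINT x|lborel. q (t n) x\<bar>) \<longlonglongrightarrow> \<bar>LINT x|lborel. c x * frechet_derivative w (at x) e\<bar>"
    by (rule tendsto_rabs)
  then show ?thesis by (rule LIMSEQ_le_const2) (use bound t in blast)
qed

lemma integral_X_gradient_bound:
  fixes w :: "real^'n \<Rightarrow> real" and X :: "'m::finite \<Rightarrow> real^'n \<Rightarrow> real^'n" and L :: real
  assumes w: "C1_on UNIV w" and zero: "\<And>x. x \<notin> cball 0 R \<Longrightarrow> w x = 0"
    and X: "continuous_on UNIV (X j)" and L: "L-lipschitz_on (cball 0 (R + 1)) (X j)"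
  shows "\<bar>LINT x|lborel. X_gradient X w x $ j\<bar> \<le> CARD('n) * L * (LINT x|lborel. \<bar>w x\<bar>)"
proof -
  have Dzero: "frechet_derivative w (at x) b = 0" if x: "x \<notin> cball 0 R" for x b
  proof -
    have "(w has_derivative (\<lambda>_::real^'n. 0::real)) (at x)"
      by (rule has_derivative_transform_within_open[of "\<lambda>_. 0" _ _ _ "- cball 0 R"])
         (use zero x in auto)
    from fun_cong[OF frechet_derivative_at[OF this], of b] show ?thesis by simp
  qed
  have lip: "L-lipschitz_on (cball 0 (R + 1)) (\<lambda>x. X j x \<bullet> b)" if "b \<in> Basis" for b
  proof (rule lipschitz_onI)
    fix x y :: "real^'n" assume xy: "x \<in> cball 0 (R + 1)" "y \<in> cball 0 (R + 1)"
    have "dist (X j x \<bullet> b) (X j y \<bullet> b) \<le> norm (X j x - X j y)"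
      using Basis_le_norm[OF that, of "X j x - X j y"] by (simp add: dist_real_def inner_diff_left)
    also have "\<dots> \<le> L * dist x y" using lipschitz_onD[OF L xy] by (simp add: dist_norm)
    finally show "dist (X j x \<bullet> b) (X j y \<bullet> b) \<le> L * dist x y" .
  qed (rule lipschitz_on_nonneg[OF L])
  have int: "integrable lborel (\<lambda>x. (X j x \<bullet> b) * frechet_derivative w (at x) b)" for b
    by (rule integrable_continuous_bounded_support[of _ 0 R])
       (auto intro!: continuous_intros X C1_onD(3)[OF w] simp: Dzero)
  have "(LINT x|lborel. X_gradient X w x $ j) = (LINT x|lborel. (\<Sum>b\<in>Basis. (X j x \<bullet> b) * frechet_derivative w (at x) b))"
    by (simp only: X_gradient_nth[OF C1_onD(2)[OF w]])
  also have "\<dots> = (\<Sum>b\<in>Basis. LINT x|lborel. (X j x \<bullet> b) * frechet_derivative w (at x) b)"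
    using int by (intro Bochner_Integration.integral_sum) auto
  also have "\<bar>\<dots>\<bar> \<le> (\<Sum>b\<in>Basis. \<bar>LINT x|lborel. (X j x \<bullet> b) * frechet_derivative w (at x) b\<bar>)" by (rule sum_abs)
  also have "\<dots> \<le> (\<Sum>b\<in>(Basis::(real^'n) set). L * (LINT x|lborel. \<bar>w x\<bar>))"
    by (intro sum_mono integral_lipschitz_derivative_bound[OF w zero] continuous_intros X)
      (auto intro: lip)
  finally show ?thesis by (simp add: mult.assoc)
qed

lemma has_derivative_positive_part_square:
  "((\<lambda>t::real. (max 0 t)\<^sup>2) has_real_derivative 2 * max 0 t) (at t)"
proof -
  consider "t > 0" | "t < 0" | "t = 0" by linarith
  then show ?thesis
  proof cases
    case 1
    have "((\<lambda>t::real. t\<^sup>2) has_real_derivative 2 * t) (at t)" by (auto intro!: derivative_eq_intros)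
    then have "((\<lambda>t::real. (max 0 t)\<^sup>2) has_real_derivative 2 * t) (at t)"
      by (rule has_field_derivative_transform_within_open[of _ _ _ "{0<..}"]) (use 1 in auto)
    then show ?thesis using 1 by simp
  next
    case 2
    have "((\<lambda>t::real. 0) has_real_derivative 0) (at t)" by simp
    then have "((\<lambda>t::real. (max 0 t)\<^sup>2) has_real_derivative 0) (at t)"
      by (rule has_field_derivative_transform_within_open[of _ _ _ "{..<0}"]) (use 2 in auto)
    then show ?thesis using 2 by simp
  next
    case 3
    have "(\<lambda>s::real. ((max 0 s)\<^sup>2 - (max 0 0)\<^sup>2) / (s - 0)) \<midarrow>0\<rightarrow> 0"
    proof (rule Lim_null_comparison)
      show "\<forall>\<^sub>F s in at 0. norm (((max 0 s)\<^sup>2 - (max 0 0)\<^sup>2) / (s - 0)) \<le> \<bar>s::real\<bar>"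
        by (intro always_eventually) (auto simp: max_def power2_eq_square)
      show "(\<lambda>s::real. \<bar>s\<bar>) \<midarrow>0\<rightarrow> 0" using tendsto_rabs_zero[OF tendsto_ident_at] by simp
    qed
    then show ?thesis using 3 by (simp add: has_field_derivative_iff)
  qed
qed

lemma Cc_infinity_C1:
  assumes "\<phi> \<in> Cc_infinity \<Omega>" shows "C1_on UNIV \<phi>"
proof -
  have "Ck (Suc 0) \<phi>" using assms by (auto simp: Cc_infinity_def simp del: Ck.simps)
  then show ?thesis by (simp add: C1_on_def)
qed

lemma Cc_infinity_zero:
  fixes \<phi> :: "real^'n \<Rightarrow> real"
  assumes "\<phi> \<in> Cc_infinity \<Omega>" "x \<notin> \<Omega>"
  shows "\<phi> x = 0" "X_gradient X \<phi> x = 0"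
proof -
  define S where "S = closure {x. \<phi> x \<noteq> 0}"
  have S: "S \<subseteq> \<Omega>" "closed S" using assms by (auto simp: Cc_infinity_def S_def)
  have out: "\<phi> z = 0" if "z \<notin> S" for z
    using that closure_subset[of "{x. \<phi> x \<noteq> 0}"] unfolding S_def by blast
  show "\<phi> x = 0" using S assms out by blast
  have "x \<in> - S" using S assms(2) by blast
  have "(\<phi> has_derivative (\<lambda>_::real^'n. 0::real)) (at x)"
  proof (rule has_derivative_transform_within_open[OF _ _ \<open>x \<in> - S\<close>])
    show "((\<lambda>_. 0) has_derivative (\<lambda>_::real^'n. 0::real)) (at x)" by simp
    show "open (- S)" using S(2) by blast
    show "0 = \<phi> z" if "z \<in> - S" for z using out that by simp
  qed
  note fun_cong[OF frechet_derivative_at[OF this]]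
  then show "X_gradient X \<phi> x = 0" by (simp add: X_gradient_def vec_eq_iff)
qed

context cc_space begin

text \<open>The support of Lebesgue measure restricted to the complement of \<open>\<Omega>\<close>. Replacing the complement
  by this set discards punctures and other parts of the complement that are locally null, which
  the integral identities below cannot see.\<close>
definition essential_exterior :: "(real^'n) set" where
  "essential_exterior = {y. \<forall>r>0. \<not> negligible (ball y r - \<Omega>)}"

abbreviation "E \<equiv> essential_exterior"

lemma not_exteriorD:
  assumes "y \<notin> E" obtains r where "r > 0" "negligible (ball y r - \<Omega>)"
  using assms by (auto simp: essential_exterior_def)

lemma closed_exterior: "closed E"
  unfolding closed_def open_contains_ball
proof
  fix y assume "y \<in> - E"
  then obtain r where r: "r > 0" "negligible (ball y r - \<Omega>)" using not_exteriorD by blast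
  have "ball y (r/2) \<subseteq> - E"
  proof
    fix z assume "z \<in> ball y (r/2)"
    then have "ball z (r/2) \<subseteq> ball y r" by (intro ball_subset_ball_iff[THEN iffD2]) (auto simp: dist_commute)
    then have "negligible (ball z (r/2) - \<Omega>)" using r by (elim negligible_subset) auto
    then show "z \<in> - E" using r by (auto simp: essential_exterior_def intro!: exI[of _ "r/2"])
  qed
  then show "\<exists>e>0. ball y e \<subseteq> - E" using r by (intro exI[of _ "r/2"]) auto
qed

lemma exterior_disjoint: "E \<inter> \<Omega> = {}"
proof -
  have "y \<notin> E" if "y \<in> \<Omega>" for y
  proof -
    obtain r where "r > 0" "ball y r \<subseteq> \<Omega>" using open_domain \<open>y \<in> \<Omega>\<close> open_contains_ball by blast
    then have "ball y r - \<Omega> = {}" by auto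
    then show ?thesis using \<open>r > 0\<close> by (auto simp: essential_exterior_def intro!: exI[of _ r])
  qed
  then show ?thesis by blast
qed

lemma not_negligible_ball: "r > 0 \<Longrightarrow> \<not> negligible (ball (y::real^'n) r)"
  using open_not_negligible[OF open_ball, of y r] by simp

lemma near_domain_if_not_exterior:
  assumes "w \<notin> E" "\<eta> > 0"
  obtains x where "x \<in> \<Omega>" "dist w x < \<eta>"
proof -
  obtain r where r: "r > 0" "negligible (ball w r - \<Omega>)" using not_exteriorD[OF assms(1)] .
  have "\<not> ball w (min r \<eta>) \<subseteq> ball w r - \<Omega>"
    using not_negligible_ball[of "min r \<eta>" w] r assms(2) negligible_subset by auto
  then show thesis using that by auto
qed

lemma exterior_nonempty: "E \<noteq> {}"
proof -
  obtain R where R: "\<And>x. x \<in> \<Omega> \<Longrightarrow> norm x \<le> R" using bounded_domain unfolding bounded_iff by blast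
  obtain y :: "real^'n" where y: "norm y = \<bar>R\<bar> + 1" using vector_choose_size[of "\<bar>R\<bar> + 1"] by auto
  have "y \<in> E"
    unfolding essential_exterior_def
  proof (clarify)
    fix r :: real assume "r > 0" "negligible (ball y r - \<Omega>)"
    moreover have "ball y (min r 1) \<subseteq> ball y r - \<Omega>"
    proof
      fix z assume "z \<in> ball y (min r 1)"
      then have z: "dist y z < r" "norm (y - z) < 1" by (auto simp: dist_norm)
      have "norm z \<ge> norm y - norm (y - z)" using norm_triangle_ineq2[of y "y - z"] by simp
      then have "norm z > R" using z y by linarith
      then show "z \<in> ball y r - \<Omega>" using z R by force
    qed
    ultimately show False using not_negligible_ball[of "min r 1" y] negligible_subset by auto
  qed
  then show ?thesis by blast
qed

text \<open>The exterior has a boundary point, since it is neither empty nor the whole space, and points off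
  the exterior are limits of points of \<open>\<Omega>\<close>.\<close>
lemma domain_points_near_exterior:
  assumes "\<eta> > 0"
  obtains x where "x \<in> \<Omega>" "infdist x E < \<eta>"
proof -
  have "E \<noteq> UNIV" using exterior_disjoint nonempty_domain by blast
  then have "frontier E \<noteq> {}" using exterior_nonempty frontier_eq_empty by blast
  then obtain y where "y \<in> frontier E" by blast
  then have y: "y \<in> E" "y \<in> closure (- E)" using closed_exterior by (auto simp: frontier_closures)
  then obtain w where w: "w \<notin> E" "dist w y < \<eta>/2" using assms unfolding closure_approachable by (metis ComplD half_gt_zero)
  obtain x where x: "x \<in> \<Omega>" "dist w x < \<eta>/2" using near_domain_if_not_exterior[OF w(1), of "\<eta>/2"] assms by auto
  have "infdist x E \<le> dist x y" using y by (intro infdist_le)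
  also have "\<dots> \<le> dist w x + dist w y" using dist_triangle3[of x y w] by simp
  finally show thesis using that x w by simp
qed

text \<open>If the fields were tangent to the exterior at every point that is nearest to some point
  off it, then by Lipschitz continuity the distance to the exterior could grow only exponentially
  along subunit paths, and points of \<open>\<Omega>\<close> near the exterior would be too far from a fixed
  point of \<open>\<Omega>\<close>.\<close>
lemma transversal_contact_point:
  obtains z y j where "z \<notin> E" "y \<in> E" "infdist z E = dist z y" "X j y \<bullet> (z - y) \<noteq> 0"
proof (rule ccontr)
  assume "\<not> thesis"
  note contact = that
  have tang: "X j y \<bullet> (z - y) = 0" if "z \<notin> E" "y \<in> E" "infdist z E = dist z y" for z y j
    using contact[OF that] \<open>\<not> thesis\<close> by blast
  obtain D where D: "D > 0" "\<And>x y. x \<in> \<Omega> \<Longrightarrow> y \<in> \<Omega> \<Longrightarrow> d x y < D" using dist_bounded by blast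
  obtain x0 where x0: "x0 \<in> \<Omega>" using nonempty_domain by blast
  obtain e0 where e0: "e0 \<in> E" using exterior_nonempty by blast
  have pos: "infdist x E > 0" if "x \<notin> E" for x
    using that infdist_pos_not_in_closed[OF closed_exterior exterior_nonempty] by blast
  obtain R0 where R0: "\<And>x. x \<in> \<Omega> \<Longrightarrow> norm x \<le> R0" using bounded_domain unfolding bounded_iff by blast
  have R0': "norm x \<le> R0 + 1" if xE: "x \<notin> E" for x
  proof -
    obtain w where "w \<in> \<Omega>" "dist x w < 1" using near_domain_if_not_exterior[OF xE, of 1] by auto
    then show ?thesis using R0[of w] norm_triangle_ineq2[of x w] by (simp add: dist_norm)
  qed
  define R1 where "R1 = 2 * (R0 + 1) + norm e0"
  have "R0 \<ge> 0" using R0[OF x0] norm_ge_zero[of x0] by linarith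
  have "\<forall>j. \<exists>L. L-lipschitz_on (cball 0 R1) (X j)"
    using locally_lipschitz_on_cball[OF lipschitz_fields] by metis
  then obtain Lj where Lj: "\<And>j. (Lj j)-lipschitz_on (cball 0 R1) (X j)" by metis
  define L where "L = (\<Sum>j\<in>UNIV. Lj j)"
  have L: "L-lipschitz_on (cball 0 R1) (X j)" for j
    using Lj lipschitz_on_nonneg[OF Lj] unfolding L_def
    by (intro lipschitz_on_le[OF Lj[of j]] member_le_sum) auto
  have "L \<ge> 0" using lipschitz_on_nonneg[OF L] .
  define M where "M = real CARD('m)"
  have "M \<ge> 0" by (simp add: M_def)
  have main: "infdist x0 E \<le> infdist x E * exp (M * L * D)" if x: "x \<in> \<Omega>" for x
  proof (cases "infdist x0 E \<le> infdist x E")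
    case True
    have "infdist x E * 1 \<le> infdist x E * exp (M * L * D)"
      using \<open>M \<ge> 0\<close> \<open>L \<ge> 0\<close> D by (intro mult_left_mono) (auto simp: infdist_nonneg)
    then show ?thesis using True by simp
  next
    case False
    define m where "m = infdist x E"
    have "m > 0" unfolding m_def using pos[of x] x exterior_disjoint by blast
    obtain T \<gamma> where T: "0 < T" "T < D" "subunit X T \<gamma>" "\<gamma> 0 = x" "\<gamma> T = x0"
      using dist_lessD[OF x x0 D(2)[OF x x0]] .
    obtain K N where K: "K-lipschitz_on {0..T} \<gamma>" and N: "negligible N"
      and v: "\<And>t. t\<in>{0..T}-N \<Longrightarrow> velocity_condition X T \<gamma> t"
      using T(3) unfolding subunit_iff_lipschitz[of X, OF continuous_fields] by blast
    have "K \<ge> 0" using lipschitz_on_nonneg[OF K] .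
    define f where "f = (\<lambda>t. infdist (\<gamma> t) E)"
    have fc: "continuous_on {0..T} f" unfolding f_def
      using lipschitz_on_continuous_on[OF K] by (intro continuous_on_infdist)
    \<comment> \<open>After the last time \<open>t0\<close> at which the path, going from \<open>x\<close> to \<open>x0\<close>, is within distance \<open>m\<close> of
      the exterior, it keeps a positive distance, so that the logarithm of the distance is
      Lipschitz, and it stays in a bounded region, so that \<open>L\<close> applies.\<close>
    define S where "S = {t\<in>{0..T}. f t \<in> {..m}}"
    have "closed S" unfolding S_def using continuous_closed_preimage[OF fc, of "{..m}"] by (simp add: vimage_def Int_def)
    then have "compact S" by (auto simp: compact_eq_bounded_closed S_def intro: bounded_subset[of "{0..T}"])
    moreover have "0 \<in> S" using T by (simp add: S_def f_def m_def)
    ultimately obtain t0 where t0: "t0 \<in> S" "\<And>t. t \<in> S \<Longrightarrow> t \<le> t0" using compact_attains_sup[of S] by blast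
    have t0T: "0 \<le> t0" "t0 \<le> T" "f t0 \<le> m" using t0(1) by (auto simp: S_def)
    have fT: "m \<le> f T" using False T by (simp add: f_def m_def)
    obtain t1 where t1: "t0 \<le> t1" "t1 \<le> T" "f t1 = m"
      using IVT'[of f t0 m T] t0T fT continuous_on_subset[OF fc, of "{t0..T}"] by auto
    have "t1 \<in> S" using t1 t0T by (simp add: S_def)
    then have ft0: "f t0 = m" using t0(2)[of t1] t1 by simp
    have fge: "m \<le> f t" if "t0 \<le> t" "t \<le> T" for t
    proof (cases "t = t0")
      case False
      then have "t \<notin> S" using t0(2)[of t] that by auto
      then show ?thesis using that t0T by (auto simp: S_def)
    qed (simp add: ft0)
    have notE: "\<gamma> t \<notin> E" if "t0 \<le> t" "t \<le> T" for t
    proof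
      assume "\<gamma> t \<in> E" then have "f t = 0" by (simp add: f_def)
      then show False using fge[OF that] \<open>m > 0\<close> by simp
    qed
    define g where "g = (\<lambda>t. ln (f t))"
    have "g T - g t0 \<le> (M * L) * (T - t0)"
    proof (rule abs_continuous_growth_bound[OF t0T(2) _ N])
      have "abs_continuous_on 0 T \<gamma>" using T(3) unfolding subunit_def by blast
      then have "abs_continuous_on t0 T \<gamma>" by (rule abs_continuous_on_subset) (use t0T in auto)
      then show "abs_continuous_on t0 T g"
      proof (rule abs_continuous_on_dominated)
        show "1 / m \<ge> 0" using \<open>m > 0\<close> by simp
        fix s t assume st: "t0 \<le> s" "s \<le> t" "t \<le> T"
        have fs: "m \<le> f s" "m \<le> f t" using fge st by auto
        have ln_le: "ln b - ln a \<le> \<bar>b - a\<bar> / m" if "m \<le> a" "m \<le> b" for a b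
        proof -
          have "ln b - ln a = ln (b / a)" using that \<open>m > 0\<close> by (simp add: ln_div)
          also have "\<dots> \<le> b / a - 1" using that \<open>m > 0\<close> by (intro ln_le_minus_one) auto
          also have "\<dots> = (b - a) / a" using that \<open>m > 0\<close> by (simp add: field_simps)
          also have "\<dots> \<le> \<bar>b - a\<bar> / m" using that \<open>m > 0\<close> by (intro frac_le) auto
          finally show ?thesis .
        qed
        have "dist (g s) (g t) \<le> \<bar>f s - f t\<bar> / m"
          using ln_le[OF fs] ln_le[OF fs(2,1)] by (simp add: g_def dist_real_def abs_le_iff abs_minus_commute)
        also have "\<dots> \<le> dist (\<gamma> s) (\<gamma> t) / m"
          using infdist_triangle_abs[of "\<gamma> s" E "\<gamma> t"] \<open>m > 0\<close> by (intro divide_right_mono) (auto simp: f_def)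
        finally show "dist (g s) (g t) \<le> 1 / m * dist (\<gamma> s) (\<gamma> t)" by simp
      qed
      show "0 \<le> M * L" using \<open>M \<ge> 0\<close> \<open>L \<ge> 0\<close> by simp
      fix t \<epsilon> :: real assume t: "t \<in> {t0..T} - N" and "\<epsilon> > 0"
      then have "t \<in> {0..T} - N" using t0T by auto
      then obtain c where c: "(\<Sum>j\<in>UNIV. (c j)\<^sup>2) \<le> 1"
        "(\<gamma> has_vector_derivative (\<Sum>j\<in>UNIV. c j *\<^sub>R X j (\<gamma> t))) (at t within {0..T})"
        using v unfolding velocity_condition_def by blast
      define V where "V = (\<Sum>j\<in>UNIV. c j *\<^sub>R X j (\<gamma> t))"
      have cj: "\<bar>c j\<bar> \<le> 1" for j
      proof -
        have "(c j)\<^sup>2 \<le> (\<Sum>j\<in>UNIV. (c j)\<^sup>2)" by (rule member_le_sum) auto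
        then show ?thesis using c(1) by (simp add: abs_square_le_1[symmetric])
      qed
      have em: "\<epsilon> * m / 2 > 0" using \<open>\<epsilon> > 0\<close> \<open>m > 0\<close> by simp
      obtain \<delta> where "\<delta> > 0" and \<delta>: "\<And>s s'. \<lbrakk>0 \<le> s; s \<le> t; t \<le> s'; s' \<le> T; s' - s < \<delta>\<rbrakk>
         \<Longrightarrow> norm (\<gamma> s' - \<gamma> s - (s' - s) *\<^sub>R V) \<le> \<epsilon> * m / 2 * (s' - s)"
      proof -
        have "(\<gamma> has_vector_derivative V) (at t within {0..T})" using c(2) by (simp add: V_def)
        from has_vector_derivative_straddle[OF this em] show thesis using that by metis
      qed
      define J where "J = M * L * K + K\<^sup>2 / (2 * m)"
      have "J \<ge> 0" using \<open>M \<ge> 0\<close> \<open>L \<ge> 0\<close> \<open>K \<ge> 0\<close> \<open>m > 0\<close> by (simp add: J_def)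
      define \<delta>' where "\<delta>' = min \<delta> (\<epsilon> * m / 2 / (J + 1))"
      have "\<delta>' > 0" using \<open>\<delta> > 0\<close> em \<open>J \<ge> 0\<close> by (simp add: \<delta>'_def)
      have "g s' - g s \<le> (M * L + \<epsilon>) * (s' - s)"
        if s: "t0 \<le> s" "s \<le> t" "t \<le> s'" "s' \<le> T" "s' - s < \<delta>'" for s s'
      proof -
        obtain y where y: "y \<in> E" "infdist (\<gamma> s) E = dist (\<gamma> s) y"
          using infdist_attains_inf[OF closed_exterior exterior_nonempty, of "\<gamma> s"] by blast
        \<comment> \<open>The nearest point \<open>y\<close> is taken at the left end \<open>s\<close> and not at the tag \<open>t\<close>: an upper bound for
          the distance at \<open>s'\<close> in terms of the one at \<open>s\<close> is wanted. By tangency at \<open>y\<close>, the component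
          of the velocity along \<open>q\<close> is at most proportional to the distance.\<close>
        define q where "q = \<gamma> s - y"
        have q: "norm q = f s" "m \<le> norm q" using y fge[of s] s by (auto simp: q_def f_def dist_norm)
        define \<Delta> where "\<Delta> = \<gamma> s' - \<gamma> s"
        have s0: "0 \<le> s" "0 \<le> s' - s" using s t0T by auto
        have \<Delta>: "norm \<Delta> \<le> K * (s' - s)"
          using lipschitz_onD[OF K, of s' s] s s0 by (auto simp: \<Delta>_def dist_norm)
        have ts: "norm (\<gamma> t - \<gamma> s) \<le> K * (s' - s)"
        proof -
          have "norm (\<gamma> t - \<gamma> s) \<le> K * (t - s)" using lipschitz_onD[OF K, of t s] s s0 by (auto simp: dist_norm)
          also have "\<dots> \<le> K * (s' - s)" using s \<open>K \<ge> 0\<close> by (intro mult_left_mono) auto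
          finally show ?thesis .
        qed
        have in_ball: "\<gamma> t \<in> cball 0 R1" "y \<in> cball 0 R1"
        proof -
          have 1: "norm (\<gamma> t) \<le> R0 + 1" "norm (\<gamma> s) \<le> R0 + 1" using notE s R0' by auto
          have 2: "dist (\<gamma> s) y \<le> dist (\<gamma> s) e0" using y(2) infdist_le[OF e0, of "\<gamma> s"] by simp
          have 3: "norm y \<le> norm (\<gamma> s) + dist (\<gamma> s) y"
            using norm_triangle_sub[of y "\<gamma> s"] by (simp add: dist_norm norm_minus_commute)
          have 4: "dist (\<gamma> s) e0 \<le> norm (\<gamma> s) + norm e0" unfolding dist_norm by (rule norm_triangle_ineq4)
          have aux: "a \<le> 2 * (r + 1) + e" if "a \<le> r + 1" "0 \<le> r" "0 \<le> e" for a r e :: real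
            using that by simp
          have aux2: "n \<le> 2 * (r + 1) + e"
            if "a \<le> r + 1" "b \<le> c" "n \<le> a + b" "c \<le> a + e" for a b c n r e :: real
            using that by simp
          have "norm (\<gamma> t) \<le> R1"
            unfolding R1_def by (rule aux[OF 1(1) \<open>R0 \<ge> 0\<close> norm_ge_zero])
          moreover have "norm y \<le> R1" unfolding R1_def by (rule aux2[OF 1(2) 2 3 4])
          ultimately show "\<gamma> t \<in> cball 0 R1" "y \<in> cball 0 R1" by simp_all
        qed
        have qV: "q \<bullet> V \<le> M * L * (K * (s' - s) + norm q) * norm q"
        proof -
          have "X j y \<bullet> q = 0" for j using tang[OF notE[of s] y] s by (simp add: q_def)
          then have "q \<bullet> V = (\<Sum>j\<in>UNIV. c j * ((X j (\<gamma> t) - X j y) \<bullet> q))"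
            by (simp add: V_def inner_sum_right inner_diff_left inner_commute[of q])
          also have "\<dots> \<le> (\<Sum>j\<in>(UNIV::'m set). L * (K * (s' - s) + norm q) * norm q)"
          proof (rule sum_mono)
            fix j
            have "c j * ((X j (\<gamma> t) - X j y) \<bullet> q) \<le> \<bar>c j\<bar> * \<bar>(X j (\<gamma> t) - X j y) \<bullet> q\<bar>"
              using abs_ge_self[of "c j * ((X j (\<gamma> t) - X j y) \<bullet> q)"] by (simp add: abs_mult)
            also have "\<dots> \<le> 1 * (norm (X j (\<gamma> t) - X j y) * norm q)"
              using cj by (intro mult_mono Cauchy_Schwarz_ineq2) auto
            also have "norm (X j (\<gamma> t) - X j y) \<le> L * norm (\<gamma> t - y)"
              using lipschitz_onD[OF L in_ball] by (simp add: dist_norm)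
            also have "norm (\<gamma> t - y) \<le> K * (s' - s) + norm q"
              using norm_triangle_ineq[of "\<gamma> t - \<gamma> s" q] ts by (simp add: q_def)
            finally show "c j * ((X j (\<gamma> t) - X j y) \<bullet> q) \<le> L * (K * (s' - s) + norm q) * norm q"
              using \<open>L \<ge> 0\<close> by (simp add: mult_left_mono mult_right_mono)
          qed
          also have "\<dots> = M * L * (K * (s' - s) + norm q) * norm q" by (simp add: M_def)
          finally show ?thesis .
        qed
        have "q \<bullet> \<Delta> = (s' - s) * (q \<bullet> V) + q \<bullet> (\<Delta> - (s' - s) *\<^sub>R V)" by (simp add: inner_diff_right)
        also have "q \<bullet> (\<Delta> - (s' - s) *\<^sub>R V) \<le> norm q * (\<epsilon> * m / 2 * (s' - s))"
          using norm_cauchy_schwarz[of q "\<Delta> - (s' - s) *\<^sub>R V"] \<delta>[of s s'] s s0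
            mult_left_mono[of "norm (\<Delta> - (s' - s) *\<^sub>R V)" "\<epsilon> * m / 2 * (s' - s)" "norm q"]
          by (simp add: \<Delta>_def \<delta>'_def)
        also have "(s' - s) * (q \<bullet> V) \<le> (s' - s) * (M * L * (K * (s' - s) + norm q) * norm q)"
          using qV s0 by (intro mult_left_mono) auto
        finally have q1: "q \<bullet> \<Delta> \<le> (s' - s) * (M * L * (K * (s' - s) + norm q) * norm q) + norm q * (\<epsilon> * m / 2 * (s' - s))"
          by simp
        have "z \<le> n * a * (w + b)" if "z \<le> a * (w * n) + n * (b * a)" for z a w n b :: real
          using that by (simp add: algebra_simps)
        from this[OF q1] have q\<Delta>: "q \<bullet> \<Delta> \<le> norm q * (s' - s) * (M * L * (K * (s' - s) + norm q) + \<epsilon> * m / 2)" .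
        have "norm q > 0" using q \<open>m > 0\<close> by linarith
        have "f s' \<le> norm (q + \<Delta>)"
          using infdist_le[OF y(1), of "\<gamma> s'"] by (simp add: f_def q_def \<Delta>_def dist_norm)
        also have "\<dots> \<le> norm q + (q \<bullet> \<Delta>) / norm q + (norm \<Delta>)\<^sup>2 / (2 * norm q)"
        proof (rule power2_le_imp_le)
          define a where "a = (2 * (q \<bullet> \<Delta>) + (norm \<Delta>)\<^sup>2) / (2 * norm q)"
          have e: "norm q + (q \<bullet> \<Delta>) / norm q + (norm \<Delta>)\<^sup>2 / (2 * norm q) = norm q + a"
            using \<open>norm q > 0\<close> by (simp add: a_def field_simps)
          have nq: "(norm (q + \<Delta>))\<^sup>2 = (norm q)\<^sup>2 + 2 * norm q * a"
            using \<open>norm q > 0\<close> by (simp add: a_def power2_norm_eq_inner inner_add inner_commute)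
          then show "(norm (q + \<Delta>))\<^sup>2 \<le> (norm q + (q \<bullet> \<Delta>) / norm q + (norm \<Delta>)\<^sup>2 / (2 * norm q))\<^sup>2"
            unfolding e by (simp add: power2_sum)
          have "0 \<le> norm q * (norm q + 2 * a)" using nq zero_le_power2[of "norm (q + \<Delta>)"] by (simp add: power2_eq_square algebra_simps)
          then have "0 \<le> norm q + 2 * a" using \<open>norm q > 0\<close> by (simp add: zero_le_mult_iff)
          then show "0 \<le> norm q + (q \<bullet> \<Delta>) / norm q + (norm \<Delta>)\<^sup>2 / (2 * norm q)"
            unfolding e using \<open>norm q > 0\<close> by linarith
        qed
        also have "(q \<bullet> \<Delta>) / norm q \<le> (s' - s) * (M * L * (K * (s' - s) + norm q) + \<epsilon> * m / 2)"
          using q\<Delta> \<open>norm q > 0\<close> by (simp add: field_simps)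
        also have "(norm \<Delta>)\<^sup>2 / (2 * norm q) \<le> (K * (s' - s))\<^sup>2 / (2 * m)"
          using \<Delta> q \<open>m > 0\<close> by (intro frac_le power_mono) auto
        finally have fs': "f s' - f s \<le> (s' - s) * (M * L * f s + \<epsilon> * m / 2 + J * (s' - s))"
          using q by (simp add: J_def algebra_simps power2_eq_square)
        have "J * (s' - s) \<le> \<epsilon> * m / 2"
        proof -
          have "s' - s \<le> \<epsilon> * m / 2 / (J + 1)" using s by (simp add: \<delta>'_def)
          then have "(J + 1) * (s' - s) \<le> \<epsilon> * m / 2" using \<open>J \<ge> 0\<close> by (simp add: field_simps)
          then show ?thesis using s0 by (simp add: algebra_simps)
        qed
        then have "M * L * f s + \<epsilon> * m / 2 + J * (s' - s) \<le> (M * L + \<epsilon>) * f s"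
        proof -
          have "\<epsilon> * m \<le> \<epsilon> * f s" using q \<open>\<epsilon> > 0\<close> by (intro mult_left_mono) auto
          then show ?thesis using \<open>J * (s' - s) \<le> \<epsilon> * m / 2\<close> unfolding distrib_right by linarith
        qed
        then have "f s' - f s \<le> (s' - s) * ((M * L + \<epsilon>) * f s)"
          using fs' s0 mult_left_mono order_trans by blast
        have fspos: "f s > 0" "f s' > 0" using fge[of s] fge[of s'] s t0T \<open>m > 0\<close> by auto
        have "g s' - g s = ln (f s' / f s)" using fspos by (simp add: g_def ln_div)
        also have "\<dots> \<le> f s' / f s - 1" using fspos by (intro ln_le_minus_one) auto
        also have "\<dots> = (f s' - f s) / f s" using fspos by (simp add: field_simps)
        also have "\<dots> \<le> ((s' - s) * ((M * L + \<epsilon>) * f s)) / f s"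
          using \<open>f s' - f s \<le> (s' - s) * ((M * L + \<epsilon>) * f s)\<close> fspos by (intro divide_right_mono) auto
        also have "\<dots> = (M * L + \<epsilon>) * (s' - s)" using fspos by simp
        finally show ?thesis .
      qed
      then show "\<exists>\<delta>>0. \<forall>s s'. t0 \<le> s \<and> s \<le> t \<and> t \<le> s' \<and> s' \<le> T \<and> s' - s < \<delta> \<longrightarrow>
         g s' - g s \<le> (M * L + \<epsilon>) * (s' - s)" using \<open>\<delta>' > 0\<close> by blast
    qed
    also have "\<dots> \<le> M * L * D" using \<open>M \<ge> 0\<close> \<open>L \<ge> 0\<close> T t0T by (intro mult_left_mono) auto
    finally have "ln (f T) \<le> ln m + M * L * D" by (simp add: g_def ft0)
    then have "exp (ln (f T)) \<le> exp (ln m + M * L * D)" by simp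
    then have "f T \<le> m * exp (M * L * D)" using fT \<open>m > 0\<close> by (simp add: exp_add)
    then show ?thesis using T by (simp add: f_def m_def)
  qed
  have "infdist x0 E > 0" using pos[of x0] x0 exterior_disjoint by blast
  then have "infdist x0 E / exp (M * L * D) > 0" by simp
  then obtain x where x: "x \<in> \<Omega>" "infdist x E < infdist x0 E / exp (M * L * D)"
    using domain_points_near_exterior by blast
  then show False using main[OF x(1)] by (simp add: field_simps)
qed

end

section \<open>The Sobolev inequality for test functions\<close>

lemma null_sets_lborel_iff_negligible:
  assumes "S \<in> sets borel"
  shows "S \<in> null_sets lborel \<longleftrightarrow> negligible S"
  using assms by (simp add: negligible_iff_null_sets null_sets_completion_iff)

lemma set_integral_lebesgue_eq_lborel:
  fixes f :: "real^'n \<Rightarrow> real"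
  assumes [measurable]: "f \<in> borel_measurable borel" "S \<in> sets borel"
  shows "(LINT x:S|lebesgue. f x) = (LINT x|lborel. indicator S x * f x)"
  unfolding set_lebesgue_integral_def real_scaleR_def by (rule integral_completion) measurable

context cc_space begin

text \<open>Integrate \<open>X\<^sub>j (\<psi> (c - \<phi>))\<close> by parts, where \<open>\<psi> = (max 0 h)\<^sup>2\<close> and \<open>h\<close> is positive on a slight
  enlargement of a ball that touches the exterior only at \<open>y\<close>. Outside \<open>\<Omega>\<close>, where \<open>c - \<phi> = c\<close>, this
  \<open>\<psi>\<close> is concentrated near \<open>y\<close>, and there \<open>X\<^sub>j \<psi>\<close> has a constant sign and dominates \<open>\<psi>\<close>. Hence a
  positive multiple of \<open>|c|\<close> is bounded by integrals of \<open>|\<phi> - c|\<close> and \<open>|X \<phi>|\<close> over \<open>\<Omega>\<close>.\<close>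
lemma constant_bound_at_contact_point:
  assumes y: "y \<in> E" and "z \<noteq> y" and null: "negligible (ball z (dist z y) - \<Omega>)"
    and contact: "X j y \<bullet> (z - y) \<noteq> 0"
  obtains C where "C > 0"
    "\<And>\<phi> c. \<phi> \<in> Cc_infinity \<Omega> \<Longrightarrow>
       \<bar>c\<bar> \<le> C * ((LINT x:\<Omega>|lebesgue. \<bar>\<phi> x - c\<bar>) + (LINT x:\<Omega>|lebesgue. grad_norm \<phi> x))"
proof -
  define \<kappa> where "\<kappa> = X j y \<bullet> (z - y)"
  define \<sigma> where "\<sigma> = sgn \<kappa>"
  have \<kappa>: "\<bar>\<kappa>\<bar> > 0" "\<sigma> * \<kappa> = \<bar>\<kappa>\<bar>" "\<bar>\<sigma>\<bar> = 1" using contact by (auto simp: \<kappa>_def \<sigma>_def sgn_if)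
  \<comment> \<open>The ball around the midpoint \<open>p\<close> with radius \<open>r\<close> lies in the ball around \<open>z\<close> and meets its
    boundary only at \<open>y\<close>.\<close>
  define p where "p = (1/2) *\<^sub>R (z + y)"
  define r where "r = dist z y / 2"
  have "r > 0" using \<open>z \<noteq> y\<close> by (simp add: r_def)
  have "p + p = z + y" by (simp add: p_def flip: scaleR_add_left)
  then have "z = p + p - y" by simp
  then have zp: "z - p = - (y - p)" by simp
  have "- 2 *\<^sub>R (y - p) = (- 1) *\<^sub>R (y - p) + (- 1) *\<^sub>R (y - p)"
    unfolding scaleR_add_left[symmetric] by simp
  then have yp: "- 2 *\<^sub>R (y - p) = z - y" using \<open>z = p + p - y\<close> by simp
  have ryp: "norm (y - p) = r"
  proof -
    have "norm (- 2 *\<^sub>R (y - p)) = norm (z - y)" by (simp only: yp)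
    then show ?thesis by (simp add: r_def dist_norm)
  qed
  define a where "a = (\<lambda>x. - 2 * ((x - p) \<bullet> X j x))"
  have ac: "continuous_on UNIV a" unfolding a_def by (intro continuous_intros continuous_fields)
  have ay: "a y = \<kappa>"
  proof -
    have "a y = (- 2 *\<^sub>R (y - p)) \<bullet> X j y" by (simp add: a_def)
    then show ?thesis by (simp only: yp \<kappa>_def inner_commute)
  qed
  obtain \<eta> where "\<eta> > 0" and \<eta>: "\<And>x. dist x y < \<eta> \<Longrightarrow> \<bar>\<kappa>\<bar> / 2 < \<sigma> * a x"
  proof -
    have "isCont a y" using ac by (simp add: continuous_on_eq_continuous_at)
    then obtain \<eta> where "\<eta> > 0" "\<And>x. dist x y < \<eta> \<Longrightarrow> dist (a x) (a y) < \<bar>\<kappa>\<bar> / 2"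
      unfolding continuous_at_eps_delta using \<kappa>(1) by (metis half_gt_zero)
    moreover have "\<bar>\<kappa>\<bar> / 2 < \<sigma> * t" if "dist t (a y) < \<bar>\<kappa>\<bar> / 2" for t
    proof -
      have "\<bar>\<sigma> * t - \<sigma> * \<kappa>\<bar> = \<bar>t - \<kappa>\<bar>" using \<kappa>(3) by (simp add: abs_mult flip: right_diff_distrib)
      then have "\<bar>\<sigma> * t - \<bar>\<kappa>\<bar>\<bar> < \<bar>\<kappa>\<bar> / 2" using that \<kappa>(2) by (simp add: dist_real_def ay)
      then show ?thesis by linarith
    qed
    ultimately show thesis using that by blast
  qed
  define R where "R = norm p + r + 1"
  obtain L where L: "L-lipschitz_on (cball 0 (R + 1)) (X j)" using locally_lipschitz_on_cball[OF lipschitz_fields] by blast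
  define K where "K = real CARD('n) * L"
  have "K \<ge> 0" using lipschitz_on_nonneg[OF L] by (simp add: K_def)
  \<comment> \<open>The second bound keeps the enlarged ball within \<open>\<eta>\<close> of \<open>y\<close> off the ball around \<open>z\<close>; the third
    makes \<open>X\<^sub>j \<psi>\<close> dominate \<open>K \<psi>\<close> there.\<close>
  define \<epsilon> where "\<epsilon> = min 1 (min (\<eta>\<^sup>2 / 2) (\<bar>\<kappa>\<bar> / (2 * (K + 1))))"
  have \<epsilon>: "\<epsilon> > 0" "\<epsilon> \<le> 1" "2 * \<epsilon> \<le> \<eta>\<^sup>2" "K * \<epsilon> \<le> \<bar>\<kappa>\<bar> / 2"
  proof -
    show "\<epsilon> > 0" using \<open>\<eta> > 0\<close> \<kappa>(1) \<open>K \<ge> 0\<close> by (simp add: \<epsilon>_def)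
    show "\<epsilon> \<le> 1" "2 * \<epsilon> \<le> \<eta>\<^sup>2" by (auto simp: \<epsilon>_def)
    have "\<epsilon> \<le> \<bar>\<kappa>\<bar> / (2 * (K + 1))" by (simp add: \<epsilon>_def)
    then have "(K + 1) * \<epsilon> \<le> \<bar>\<kappa>\<bar> / 2" using \<open>K \<ge> 0\<close> by (simp add: field_simps)
    then show "K * \<epsilon> \<le> \<bar>\<kappa>\<bar> / 2" using \<open>\<epsilon> > 0\<close> by (simp add: algebra_simps)
  qed
  define h where "h = (\<lambda>x. \<epsilon> + r\<^sup>2 - (x - p) \<bullet> (x - p))"
  define hp where "hp = (\<lambda>x. max 0 (h x))"
  have hpc: "continuous_on UNIV hp" unfolding hp_def h_def by (intro continuous_intros)
  have hp0: "hp x \<ge> 0" for x by (simp add: hp_def)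
  have hpsupp: "hp x = 0" if "x \<notin> cball 0 R" for x
  proof -
    have "norm (x - p) > r + 1" using that norm_triangle_ineq2[of x p] by (simp add: R_def)
    then have "(norm (x - p))\<^sup>2 > (r + 1)\<^sup>2" using \<open>r > 0\<close> by (intro power_strict_mono) auto
    then have "h x < 0" using \<epsilon>(2) \<open>r > 0\<close> by (simp add: h_def power2_norm_eq_inner[symmetric] power2_eq_square algebra_simps)
    then show ?thesis by (simp add: hp_def)
  qed
  have outside: "dist x y < \<eta>" "hp x \<le> \<epsilon>" if x: "x \<notin> ball z (dist z y)" and "hp x > 0" for x
  proof -
    define u where "u = x - p"
    define v where "v = y - p"
    have hx: "u \<bullet> u < \<epsilon> + r\<^sup>2" using that(2) by (simp add: hp_def h_def u_def)
    have "norm (x - z) \<ge> 2 * r" using x by (simp add: r_def dist_norm norm_minus_commute)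
    moreover have "x - z = u + v" using zp by (simp add: u_def v_def algebra_simps)
    ultimately have "(norm (u + v))\<^sup>2 \<ge> (2 * r)\<^sup>2" using \<open>r > 0\<close> by (intro power_mono) auto
    moreover have vv: "v \<bullet> v = r\<^sup>2" using ryp by (simp add: v_def power2_norm_eq_inner[symmetric])
    moreover have "(norm (u + v))\<^sup>2 = u \<bullet> u + 2 * (u \<bullet> v) + v \<bullet> v"
      by (simp add: power2_norm_eq_inner inner_add inner_commute)
    moreover have "(2 * r)\<^sup>2 = 4 * r\<^sup>2" by (simp add: power2_eq_square)
    ultimately have uv: "u \<bullet> u + 2 * (u \<bullet> v) \<ge> 3 * r\<^sup>2" by linarith
    have "(norm (x - y))\<^sup>2 = (norm (u - v))\<^sup>2" by (simp add: u_def v_def)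
    also have "\<dots> = u \<bullet> u - 2 * (u \<bullet> v) + r\<^sup>2"
      using vv by (simp add: power2_norm_eq_inner inner_diff inner_commute)
    also have "\<dots> < 2 * \<epsilon>" using uv hx by linarith
    also have "\<dots> \<le> \<eta>\<^sup>2" by (rule \<epsilon>)
    finally show "dist x y < \<eta>" using \<open>\<eta> > 0\<close> by (simp add: dist_norm power2_less_imp_less)
    have "u \<bullet> u \<ge> r\<^sup>2"
    proof -
      have "norm (u + v) \<le> norm u + r" using norm_triangle_ineq[of u v] ryp by (simp add: v_def)
      then have "norm u \<ge> r" using \<open>norm (x - z) \<ge> 2 * r\<close> \<open>x - z = u + v\<close> by simp
      then have "(norm u)\<^sup>2 \<ge> r\<^sup>2" using \<open>r > 0\<close> by (intro power_mono) auto
      then show ?thesis by (simp add: power2_norm_eq_inner)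
    qed
    then show "hp x \<le> \<epsilon>" using \<epsilon>(1) by (simp add: hp_def h_def u_def)
  qed
  define \<psi> where "\<psi> = (\<lambda>x. (hp x)\<^sup>2)"
  have D\<psi>: "(\<psi> has_derivative (\<lambda>v. 2 * hp x * (- 2 * ((x - p) \<bullet> v)))) (at x)" for x
  proof -
    have "(h has_derivative (\<lambda>v. - 2 * ((x - p) \<bullet> v))) (at x)"
      unfolding h_def by (auto intro!: derivative_eq_intros simp: inner_commute algebra_simps)
    from has_derivative_compose[OF this has_derivative_positive_part_square[unfolded has_field_derivative_def]]
    show ?thesis unfolding \<psi>_def hp_def by simp
  qed
  have \<psi>C1: "C1_on UNIV \<psi>"
    by (rule C1_onI[OF D\<psi>]) (intro continuous_intros hpc)
  have \<psi>c: "continuous_on UNIV \<psi>" unfolding \<psi>_def by (intro continuous_intros hpc)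
  define P where "P = (\<lambda>x. 2 * hp x * a x)"
  have Pc: "continuous_on UNIV P" unfolding P_def by (intro continuous_intros hpc ac)
  have [measurable]: "P \<in> borel_measurable borel" "\<psi> \<in> borel_measurable borel" "hp \<in> borel_measurable borel"
    using Pc \<psi>c hpc by (auto intro: borel_measurable_continuous_onI)
  have [measurable]: "\<Omega> \<in> sets borel" by (rule domain_borel)
  have ind: "integrable lborel (\<lambda>x. indicator S x * f x)"
    if "S \<in> sets borel" "integrable lborel f" for S and f :: "real^'n \<Rightarrow> real"
    using integrable_real_mult_indicator[of S lborel f] that by (simp add: mult.commute)
  have iP: "integrable lborel P" "integrable lborel \<psi>"
    using integrable_continuous_bounded_support[OF Pc, of 0 R] integrable_continuous_bounded_support[OF \<psi>c, of 0 R] hpsupp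
    by (auto simp: P_def \<psi>_def)
  define F where "F = (\<lambda>x. indicator (- \<Omega>) x * (\<sigma> * P x - K * \<psi> x))"
  have iF: "integrable lborel F" unfolding F_def using iP by (intro ind) auto
  define \<delta> where "\<delta> = (LINT x|lborel. F x)"
  have AEout: "AE x in lborel. x \<notin> ball z (dist z y) - \<Omega>"
    using null by (intro AE_not_in) (simp add: null_sets_lborel_iff_negligible)
  have Flow: "F x \<ge> hp x * (\<bar>\<kappa>\<bar> / 2)" if "x \<notin> \<Omega>" "x \<notin> ball z (dist z y)" for x
  proof (cases "hp x > 0")
    case True
    have "\<bar>\<kappa>\<bar> / 2 \<le> 2 * (\<sigma> * a x) - K * hp x"
      using outside[OF that(2) True] \<eta>[of x] \<epsilon>(4) mult_left_mono[of "hp x" \<epsilon> K] \<open>K \<ge> 0\<close> by linarith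
    then have "hp x * (\<bar>\<kappa>\<bar> / 2) \<le> hp x * (2 * (\<sigma> * a x) - K * hp x)" using hp0 by (intro mult_left_mono) auto
    also have "\<dots> = F x" using that by (simp add: F_def P_def \<psi>_def power2_eq_square algebra_simps)
    finally show ?thesis .
  next
    case False
    then have "hp x = 0" using hp0[of x] by simp
    then show ?thesis by (simp add: F_def P_def \<psi>_def)
  qed
  have F0: "AE x in lborel. 0 \<le> F x"
    using AEout
  proof eventually_elim
    fix x assume "x \<notin> ball z (dist z y) - \<Omega>"
    show "0 \<le> F x"
    proof (cases "x \<in> \<Omega>")
      case False
      have "0 \<le> hp x * (\<bar>\<kappa>\<bar> / 2)" using hp0[of x] by simp
      also have "\<dots> \<le> F x" using Flow[OF False] \<open>x \<notin> ball z (dist z y) - \<Omega>\<close> False by blast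
      finally show ?thesis .
    qed (simp add: F_def)
  qed
  have "\<delta> > 0"
  proof (rule ccontr)
    assume "\<not> \<delta> > 0"
    moreover have "\<delta> \<ge> 0" unfolding \<delta>_def by (rule integral_nonneg_AE[OF F0])
    ultimately have "\<delta> = 0" by simp
    then have "AE x in lborel. F x = 0"
      using integral_nonneg_eq_0_iff_AE[OF iF F0] by (simp add: \<delta>_def)
    then have "AE x in lborel. x \<notin> {x. hp x > 0} - \<Omega>"
      using AEout
    proof eventually_elim
      fix x assume x: "F x = 0" "x \<notin> ball z (dist z y) - \<Omega>"
      show "x \<notin> {x. hp x > 0} - \<Omega>"
      proof
        assume "x \<in> {x. hp x > 0} - \<Omega>"
        then have "hp x > 0" "x \<notin> \<Omega>" by auto
        then have "0 < hp x * (\<bar>\<kappa>\<bar> / 2)" "hp x * (\<bar>\<kappa>\<bar> / 2) \<le> F x" using \<kappa>(1) Flow[of x] x(2) by auto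
        then show False using x(1) by simp
      qed
    qed
    then have null: "negligible ({x. hp x > 0} - \<Omega>)"
      by (subst null_sets_lborel_iff_negligible[symmetric]) (auto simp: AE_iff_null_sets)
    have "h y = \<epsilon>" using ryp by (simp add: h_def power2_norm_eq_inner[symmetric])
    then have "hp y > 0" using \<epsilon> by (simp add: hp_def)
    moreover have "open {x. hp x > 0}" using open_Collect_less[OF continuous_on_const hpc] by simp
    ultimately obtain s where "s > 0" "ball y s \<subseteq> {x. hp x > 0}" using open_contains_ball by (metis mem_Collect_eq)
    then have "negligible (ball y s - \<Omega>)" using null by (elim negligible_subset) auto
    then show False using y \<open>s > 0\<close> by (auto simp: essential_exterior_def)
  qed
  obtain M where "M > 0" and M: "\<And>x. x \<in> \<Omega> \<Longrightarrow> \<bar>P x\<bar> + K * \<psi> x \<le> M" "\<And>x. x \<in> \<Omega> \<Longrightarrow> \<psi> x \<le> M"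
  proof -
    have "compact ((\<lambda>x. \<bar>P x\<bar> + K * \<psi> x + \<psi> x) ` closure \<Omega>)"
      using bounded_domain by (intro compact_continuous_image continuous_intros
        continuous_on_subset[OF Pc subset_UNIV] continuous_on_subset[OF \<psi>c subset_UNIV]) (simp add: compact_closure)
    then obtain M where M: "M > 0" "\<forall>t\<in>(\<lambda>x. \<bar>P x\<bar> + K * \<psi> x + \<psi> x) ` closure \<Omega>. norm t \<le> M"
      using compact_imp_bounded bounded_pos by blast
    have "\<bar>P x\<bar> + K * \<psi> x + \<psi> x \<le> M" if "x \<in> \<Omega>" for x
    proof -
      have "x \<in> closure \<Omega>" using that closure_subset by blast
      then have "norm (\<bar>P x\<bar> + K * \<psi> x + \<psi> x) \<le> M" using M(2) by blast
      then show ?thesis by simp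
    qed
    moreover have "0 \<le> \<psi> x" "0 \<le> K * \<psi> x" for x using \<open>K \<ge> 0\<close> by (auto simp: \<psi>_def)
    ultimately show thesis using that[of M] M(1) by (smt (verit))
  qed
  show thesis
  proof (rule that)
    show "M / \<delta> > 0" using \<open>M > 0\<close> \<open>\<delta> > 0\<close> by simp
    fix \<phi> :: "real^'n \<Rightarrow> real" and c :: real assume \<phi>: "\<phi> \<in> Cc_infinity \<Omega>"
    note \<phi>C1 = Cc_infinity_C1[OF \<phi>]
    have \<phi>c: "continuous_on UNIV \<phi>" using C1_onD[OF \<phi>C1] by simp
    have gc: "continuous_on UNIV (\<lambda>x. X_gradient X \<phi> x $ j)"
      using X_gradient_continuous[OF \<phi>C1 continuous_fields] by (intro continuous_intros)
    have [measurable]: "\<phi> \<in> borel_measurable borel" "(\<lambda>x. X_gradient X \<phi> x $ j) \<in> borel_measurable borel"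
      "grad_norm \<phi> \<in> borel_measurable borel"
      using \<phi>c gc grad_norm_continuous[OF \<phi>C1] by (auto intro: borel_measurable_continuous_onI)
    define w where "w = (\<lambda>x. \<psi> x * (c - \<phi> x))"
    define Dw where "Dw = (\<lambda>x v. \<psi> x * (- frechet_derivative \<phi> (at x) v) + 2 * hp x * (- 2 * ((x - p) \<bullet> v)) * (c - \<phi> x))"
    have Dw: "(w has_derivative Dw x) (at x)" for x
    proof -
      have "((\<lambda>x. c - \<phi> x) has_derivative (\<lambda>v. - frechet_derivative \<phi> (at x) v)) (at x)"
        using has_derivative_diff[OF has_derivative_const C1_on_has_derivative[OF \<phi>C1]] by simp
      then show ?thesis unfolding w_def Dw_def by (intro has_derivative_mult D\<psi>)
    qed
    have wC1: "C1_on UNIV w"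
      by (rule C1_onI[OF Dw], unfold Dw_def) (intro continuous_intros \<psi>c hpc \<phi>c C1_onD(3)[OF \<phi>C1])
    have Xw: "X_gradient X w x $ j = P x * (c - \<phi> x) - \<psi> x * X_gradient X \<phi> x $ j" for x
      unfolding X_gradient_eq[OF Dw] Dw_def P_def a_def by (simp add: X_gradient_def)
    have bd: "\<bar>LINT x|lborel. X_gradient X w x $ j\<bar> \<le> K * (LINT x|lborel. \<bar>w x\<bar>)"
      unfolding K_def
      by (rule integral_X_gradient_bound[where X = X and j = j and L = L and R = R, OF wC1 _ continuous_fields[of j] L])
        (use hpsupp in \<open>simp add: w_def \<psi>_def\<close>)
    have zero: "\<phi> x = 0" "X_gradient X \<phi> x = 0" if "x \<notin> \<Omega>" for x
      using Cc_infinity_zero[OF \<phi> that] by auto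
    have i1: "integrable lborel (\<lambda>x. P x * (c - \<phi> x))" "integrable lborel (\<lambda>x. \<psi> x * X_gradient X \<phi> x $ j)"
        "integrable lborel (\<lambda>x. \<psi> x * \<bar>c - \<phi> x\<bar>)"
    proof -
      have *: "integrable lborel f" if "continuous_on UNIV f" "\<And>x. hp x = 0 \<Longrightarrow> f x = 0" for f :: "real^'n \<Rightarrow> real"
        using integrable_continuous_bounded_support[OF that(1), of 0 R] hpsupp that(2) by blast
      show "integrable lborel (\<lambda>x. P x * (c - \<phi> x))"
        by (rule *) (intro continuous_intros Pc \<phi>c, simp add: P_def)
      show "integrable lborel (\<lambda>x. \<psi> x * X_gradient X \<phi> x $ j)"
        by (rule *) (intro continuous_on_mult \<psi>c gc, simp add: \<psi>_def)
      show "integrable lborel (\<lambda>x. \<psi> x * \<bar>c - \<phi> x\<bar>)"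
        by (rule *) (intro continuous_intros \<psi>c \<phi>c, simp add: \<psi>_def)
    qed
    define A1 where "A1 = (LINT x|lborel. indicator (- \<Omega>) x * P x)"
    define A2 where "A2 = (LINT x|lborel. indicator (- \<Omega>) x * \<psi> x)"
    define B1 where "B1 = (LINT x|lborel. indicator \<Omega> x * (P x * (c - \<phi> x)))"
    define B2 where "B2 = (LINT x|lborel. indicator \<Omega> x * (\<psi> x * \<bar>c - \<phi> x\<bar>))"
    define B3 where "B3 = (LINT x|lborel. \<psi> x * X_gradient X \<phi> x $ j)"
    have split1: "(LINT x|lborel. P x * (c - \<phi> x)) = c * A1 + B1"
    proof -
      have "(LINT x|lborel. P x * (c - \<phi> x)) = (LINT x|lborel. c * (indicator (- \<Omega>) x * P x) + indicator \<Omega> x * (P x * (c - \<phi> x)))"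
        using zero by (intro Bochner_Integration.integral_cong) (auto simp: indicator_def)
      also have "\<dots> = c * A1 + B1" unfolding A1_def B1_def
        using ind[of "- \<Omega>" P] ind[OF _ i1(1), of \<Omega>] iP by (subst Bochner_Integration.integral_add) auto
      finally show ?thesis .
    qed
    have split2: "(LINT x|lborel. \<bar>w x\<bar>) = \<bar>c\<bar> * A2 + B2"
    proof -
      have "(LINT x|lborel. \<bar>w x\<bar>) = (LINT x|lborel. \<bar>c\<bar> * (indicator (- \<Omega>) x * \<psi> x) + indicator \<Omega> x * (\<psi> x * \<bar>c - \<phi> x\<bar>))"
        using zero by (intro Bochner_Integration.integral_cong) (auto simp: indicator_def w_def \<psi>_def abs_mult)
      also have "\<dots> = \<bar>c\<bar> * A2 + B2" unfolding A2_def B2_def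
        using ind[of "- \<Omega>" \<psi>] ind[OF _ i1(3), of \<Omega>] iP by (subst Bochner_Integration.integral_add) auto
      finally show ?thesis .
    qed
    have "(LINT x|lborel. X_gradient X w x $ j) = c * A1 + B1 - B3"
      unfolding Xw B3_def split1[symmetric] using i1 by (intro Bochner_Integration.integral_diff) auto
    then have main: "\<bar>c * A1 + B1 - B3\<bar> \<le> K * (\<bar>c\<bar> * A2 + B2)" using bd split2 by simp
    have \<delta>eq: "\<delta> = \<sigma> * A1 - K * A2"
    proof -
      have "\<delta> = (LINT x|lborel. \<sigma> * (indicator (- \<Omega>) x * P x) - K * (indicator (- \<Omega>) x * \<psi> x))"
        unfolding \<delta>_def F_def by (intro Bochner_Integration.integral_cong) (auto simp: algebra_simps)
      also have "\<dots> = \<sigma> * A1 - K * A2" unfolding A1_def A2_def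
        using ind[of "- \<Omega>" P] ind[of "- \<Omega>" \<psi>] iP by (subst Bochner_Integration.integral_diff) auto
      finally show ?thesis .
    qed
    define I1 where "I1 = (LINT x|lborel. indicator \<Omega> x * \<bar>\<phi> x - c\<bar>)"
    define I2 where "I2 = (LINT x|lborel. indicator \<Omega> x * grad_norm \<phi> x)"
    have iI: "integrable lborel (\<lambda>x. indicator \<Omega> x * \<bar>\<phi> x - c\<bar>)" "integrable lborel (\<lambda>x. indicator \<Omega> x * grad_norm \<phi> x)"
    proof -
      have *: "integrable lborel (\<lambda>x. indicator \<Omega> x * f x)" if "continuous_on UNIV f" for f :: "real^'n \<Rightarrow> real"
      proof -
        have [measurable]: "f \<in> borel_measurable borel" using that by (rule borel_measurable_continuous_onI)
        have "integrable lebesgue (\<lambda>x. indicator \<Omega> x * f x)"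
          using continuous_set_integrable[OF that domain_borel bounded_domain] by (simp add: set_integrable_def)
        then show ?thesis by (subst (asm) integrable_completion) measurable
      qed
      show "integrable lborel (\<lambda>x. indicator \<Omega> x * \<bar>\<phi> x - c\<bar>)" by (intro * continuous_intros \<phi>c)
      show "integrable lborel (\<lambda>x. indicator \<Omega> x * grad_norm \<phi> x)" by (intro * grad_norm_continuous \<phi>C1)
    qed
    have B: "\<bar>B1\<bar> + K * B2 \<le> M * I1"
    proof -
      have "\<bar>B1\<bar> \<le> (LINT x|lborel. \<bar>indicator \<Omega> x * (P x * (c - \<phi> x))\<bar>)" unfolding B1_def by (rule integral_abs_bound)
      then have "\<bar>B1\<bar> + K * B2 \<le> (LINT x|lborel. \<bar>indicator \<Omega> x * (P x * (c - \<phi> x))\<bar> + K * (indicator \<Omega> x * (\<psi> x * \<bar>c - \<phi> x\<bar>)))"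
        unfolding B2_def using ind[OF _ i1(1), of \<Omega>] ind[OF _ i1(3), of \<Omega>]
        by (subst Bochner_Integration.integral_add) auto
      also have "\<dots> \<le> (LINT x|lborel. M * (indicator \<Omega> x * \<bar>\<phi> x - c\<bar>))"
      proof (rule integral_mono)
        show "integrable lborel (\<lambda>x. \<bar>indicator \<Omega> x * (P x * (c - \<phi> x))\<bar> + K * (indicator \<Omega> x * (\<psi> x * \<bar>c - \<phi> x\<bar>)))"
          using ind[OF _ i1(1), of \<Omega>] ind[OF _ i1(3), of \<Omega>] by auto
        show "integrable lborel (\<lambda>x. M * (indicator \<Omega> x * \<bar>\<phi> x - c\<bar>))" using iI by auto
        fix x
        have "(\<bar>P x\<bar> + K * \<psi> x) * \<bar>c - \<phi> x\<bar> \<le> M * \<bar>c - \<phi> x\<bar>" if "x \<in> \<Omega>"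
          using M(1)[OF that] by (intro mult_right_mono) auto
        then show "\<bar>indicator \<Omega> x * (P x * (c - \<phi> x))\<bar> + K * (indicator \<Omega> x * (\<psi> x * \<bar>c - \<phi> x\<bar>)) \<le> M * (indicator \<Omega> x * \<bar>\<phi> x - c\<bar>)"
          by (cases "x \<in> \<Omega>") (simp_all add: abs_mult distrib_right mult.assoc abs_minus_commute[of "\<phi> x" c])
      qed
      also have "\<dots> = M * I1" by (simp add: I1_def)
      finally show ?thesis .
    qed
    have B3: "\<bar>B3\<bar> \<le> M * I2"
    proof -
      have "\<bar>B3\<bar> \<le> (LINT x|lborel. \<bar>\<psi> x * X_gradient X \<phi> x $ j\<bar>)" unfolding B3_def by (rule integral_abs_bound)
      also have "\<dots> \<le> (LINT x|lborel. M * (indicator \<Omega> x * grad_norm \<phi> x))"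
      proof (rule integral_mono)
        show "integrable lborel (\<lambda>x. \<bar>\<psi> x * X_gradient X \<phi> x $ j\<bar>)" using i1 by auto
        show "integrable lborel (\<lambda>x. M * (indicator \<Omega> x * grad_norm \<phi> x))" using iI by auto
        fix x
        show "\<bar>\<psi> x * X_gradient X \<phi> x $ j\<bar> \<le> M * (indicator \<Omega> x * grad_norm \<phi> x)"
        proof (cases "x \<in> \<Omega>")
          case True
          have "\<psi> x * \<bar>X_gradient X \<phi> x $ j\<bar> \<le> M * grad_norm \<phi> x"
            using M(2)[OF True] component_le_norm_cart[of "X_gradient X \<phi> x" j] \<open>M > 0\<close>
            by (intro mult_mono) auto
          then show ?thesis using True by (simp add: abs_mult \<psi>_def)
        qed (simp add: zero)
      qed
      also have "\<dots> = M * I2" by (simp add: I2_def)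
      finally show ?thesis .
    qed
    have "\<sigma> * A1 \<le> \<bar>A1\<bar>" using \<kappa>(3) abs_ge_self[of "\<sigma> * A1"] by (simp add: abs_mult)
    then have "\<bar>c\<bar> * \<delta> \<le> \<bar>c\<bar> * (\<bar>A1\<bar> - K * A2)" unfolding \<delta>eq by (intro mult_left_mono) auto
    also have "\<dots> = \<bar>c * A1\<bar> - K * (\<bar>c\<bar> * A2)" by (simp add: abs_mult algebra_simps)
    also have "\<dots> \<le> \<bar>B1\<bar> + K * B2 + \<bar>B3\<bar>"
      using main distrib_left[of K "\<bar>c\<bar> * A2" B2] by linarith
    also have "\<dots> \<le> M * (I1 + I2)" using B B3 by (simp add: distrib_left)
    finally have "\<bar>c\<bar> \<le> M / \<delta> * (I1 + I2)" using \<open>\<delta> > 0\<close> by (simp add: field_simps)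
    moreover have "(LINT x:\<Omega>|lebesgue. \<bar>\<phi> x - c\<bar>) = I1" "(LINT x:\<Omega>|lebesgue. grad_norm \<phi> x) = I2"
      unfolding I1_def I2_def by (rule set_integral_lebesgue_eq_lborel; measurable)+
    ultimately show "\<bar>c\<bar> \<le> M / \<delta> * ((LINT x:\<Omega>|lebesgue. \<bar>\<phi> x - c\<bar>) + (LINT x:\<Omega>|lebesgue. grad_norm \<phi> x))"
      by simp
  qed
qed

text \<open>A ball that misses the exterior is contained in \<open>\<Omega>\<close> up to a null set, because this holds locally.\<close>
lemma constant_bound:
  obtains C where "C > 0"
    "\<And>\<phi> c. \<phi> \<in> Cc_infinity \<Omega> \<Longrightarrow>
       \<bar>c\<bar> \<le> C * ((LINT x:\<Omega>|lebesgue. \<bar>\<phi> x - c\<bar>) + (LINT x:\<Omega>|lebesgue. grad_norm \<phi> x))"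
proof -
  obtain z y j where zy: "z \<notin> E" "y \<in> E" "infdist z E = dist z y" "X j y \<bullet> (z - y) \<noteq> 0"
    using transversal_contact_point by blast
  have "negligible (ball z (dist z y) - \<Omega>)"
  proof (subst locally_negligible_alt, intro ballI)
    fix x assume x: "x \<in> ball z (dist z y) - \<Omega>"
    have "x \<notin> E"
    proof
      assume "x \<in> E"
      then have "infdist z E \<le> dist z x" by (rule infdist_le)
      then show False using zy(3) x by simp
    qed
    then obtain r where r: "r > 0" "negligible (ball x r - \<Omega>)" using not_exteriorD by blast
    show "\<exists>U. openin (top_of_set (ball z (dist z y) - \<Omega>)) U \<and> x \<in> U \<and> negligible U"
    proof (intro exI[of _ "(ball z (dist z y) - \<Omega>) \<inter> ball x r"] conjI)
      show "openin (top_of_set (ball z (dist z y) - \<Omega>)) ((ball z (dist z y) - \<Omega>) \<inter> ball x r)"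
        by (rule openin_open_Int) simp
      show "negligible ((ball z (dist z y) - \<Omega>) \<inter> ball x r)"
        by (rule negligible_subset[OF r(2)]) auto
    qed (use x r in auto)
  qed
  moreover have "z \<noteq> y" using zy by auto
  ultimately show thesis using constant_bound_at_contact_point[OF zy(2) _ _ zy(4)] that by metis
qed

text \<open>The global Sobolev inequality for test functions: the mean over \<open>\<Omega>\<close>, which the
  Poincare inequality leaves free, is controlled because test functions vanish outside \<open>\<Omega>\<close>.\<close>
theorem sobolev_test_functions:
  obtains S where "S > 0"
    "\<And>\<phi>. \<phi> \<in> Cc_infinity \<Omega> \<Longrightarrow> (\<integral>\<^sup>+x\<in>\<Omega>. ennreal (\<bar>\<phi> x\<bar> powr (2 * Q / (Q - 2))) \<partial>lborel)
       \<le> ennreal (S * (LINT y:\<Omega>|lebesgue. (grad_norm \<phi> y)\<^sup>2) powr (Q / (Q - 2)))"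
proof -
  obtain C1 where C1: "C1 > 0"
    "\<And>u. C1_on UNIV u \<Longrightarrow> (\<integral>\<^sup>+x\<in>\<Omega>. ennreal (\<bar>u x - mean_on \<Omega> u\<bar> powr (2 * Q / (Q - 2))) \<partial>lborel)
       \<le> ennreal (C1 * (LINT y:\<Omega>|lebesgue. (grad_norm u y)\<^sup>2) powr (Q / (Q - 2)))"
    using sobolev_poincare by blast
  obtain C2 where C2: "C2 > 0"
    "\<And>\<phi> c. \<phi> \<in> Cc_infinity \<Omega> \<Longrightarrow>
       \<bar>c\<bar> \<le> C2 * ((LINT x:\<Omega>|lebesgue. \<bar>\<phi> x - c\<bar>) + (LINT x:\<Omega>|lebesgue. grad_norm \<phi> x))"
    using constant_bound by blast
  define V where "V = measure lebesgue \<Omega>"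
  have "V > 0" unfolding V_def by (rule domain_measure_pos)
  define s where "s = 2 * Q / (Q - 2)"
  have s: "s > 1" "s / 2 = Q / (Q - 2)" using dimension_gt_2 by (auto simp: s_def field_simps)
  define C3 where "C3 = C2 * (V + C1 + V powr (1/2))"
  have "C3 > 0" using C1 C2 \<open>V > 0\<close> by (simp add: C3_def add_pos_pos)
  define S where "S = 2 powr s * (C1 + V * C3 powr s)"
  have "S > 0" using C1 \<open>V > 0\<close> by (simp add: S_def add_pos_nonneg)
  have main: "(\<integral>\<^sup>+x\<in>\<Omega>. ennreal (\<bar>\<phi> x\<bar> powr s) \<partial>lborel)
       \<le> ennreal (S * (LINT y:\<Omega>|lebesgue. (grad_norm \<phi> y)\<^sup>2) powr (s / 2))" if \<phi>: "\<phi> \<in> Cc_infinity \<Omega>" for \<phi>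
  proof -
    note \<phi>C1 = Cc_infinity_C1[OF \<phi>]
    have \<phi>c: "continuous_on UNIV \<phi>" using C1_onD[OF \<phi>C1] by simp
    have [measurable]: "\<Omega> \<in> sets borel" by (rule domain_borel)
    have [measurable]: "\<phi> \<in> borel_measurable borel" using \<phi>c by (rule borel_measurable_continuous_onI)
    define I where "I = (LINT y:\<Omega>|lebesgue. (grad_norm \<phi> y)\<^sup>2)"
    have "I \<ge> 0" unfolding I_def by (rule set_integral_square_nonneg)
    define c where "c = mean_on \<Omega> \<phi>"
    define J where "J = I powr (1/2)"
    have JI: "J powr s = I powr (s / 2)" by (simp add: J_def powr_powr)
    define osc where "osc = (LINT x:\<Omega>|lebesgue. \<bar>\<phi> x - c\<bar> powr s)"
    have oscc: "continuous_on UNIV (\<lambda>x. \<bar>\<phi> x - c\<bar> powr s)"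
      using s by (intro continuous_on_powr' continuous_intros \<phi>c) auto
    have nnosc: "(\<integral>\<^sup>+x\<in>\<Omega>. ennreal (\<bar>\<phi> x - c\<bar> powr s) \<partial>lborel) = ennreal osc"
      unfolding osc_def by (rule nn_integral_continuous_eq[OF oscc domain_borel bounded_domain]) simp
    have "ennreal osc \<le> ennreal (C1 * I powr (s / 2))"
      using C1(2)[OF \<phi>C1] unfolding nnosc[symmetric] unfolding c_def s_def I_def s(2)[unfolded s_def] .
    then have osc: "osc \<le> C1 * J powr s" using C1(1) by (simp add: JI)
    have "osc \<ge> 0" unfolding osc_def set_lebesgue_integral_def by (intro integral_nonneg_AE) auto
    have osc1: "(LINT x:\<Omega>|lebesgue. \<bar>\<phi> x - c\<bar>) \<le> (V + C1) * J"
    proof -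
      \<comment> \<open>Split according to whether \<open>|\<phi> - c|\<close> exceeds \<open>l\<close>; to be used with \<open>l = J\<close>.\<close>
      have le: "(LINT x:\<Omega>|lebesgue. \<bar>\<phi> x - c\<bar>) \<le> l * V + l powr (1 - s) * osc" if "l > 0" for l
      proof -
        have "(LINT x:\<Omega>|lebesgue. \<bar>\<phi> x - c\<bar>) \<le> (LINT x:\<Omega>|lebesgue. l + l powr (1 - s) * \<bar>\<phi> x - c\<bar> powr s)"
        proof (rule set_integral_mono)
          show "set_integrable lebesgue \<Omega> (\<lambda>x. \<bar>\<phi> x - c\<bar>)" "set_integrable lebesgue \<Omega> (\<lambda>x. l + l powr (1 - s) * \<bar>\<phi> x - c\<bar> powr s)"
            by (intro continuous_set_integrable domain_borel bounded_domain continuous_intros \<phi>c oscc)+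
          fix x
          show "\<bar>\<phi> x - c\<bar> \<le> l + l powr (1 - s) * \<bar>\<phi> x - c\<bar> powr s"
          proof (cases "\<bar>\<phi> x - c\<bar> \<le> l")
            case False
            define t where "t = \<bar>\<phi> x - c\<bar>"
            have "t > l" "t > 0" using False that by (auto simp: t_def)
            then have "l powr (s - 1) \<le> t powr (s - 1)" using s \<open>l > 0\<close> by (intro powr_mono2) auto
            then have "l powr (1 - s) * l powr (s - 1) \<le> l powr (1 - s) * t powr (s - 1)"
              by (intro mult_left_mono) auto
            then have "1 \<le> l powr (1 - s) * t powr (s - 1)"
              using \<open>l > 0\<close> by (simp flip: powr_add)
            then have "t * 1 \<le> t * (l powr (1 - s) * t powr (s - 1))" using \<open>t > 0\<close> by (intro mult_left_mono) auto
            also have "\<dots> = l powr (1 - s) * t powr s"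
              using \<open>t > 0\<close> powr_add[of t 1 "s - 1"] by simp
            finally show ?thesis using that by (simp add: t_def)
          qed (simp add: add_increasing2)
        qed
        also have "\<dots> = (LINT x:\<Omega>|lebesgue. l) + (LINT x:\<Omega>|lebesgue. l powr (1 - s) * \<bar>\<phi> x - c\<bar> powr s)"
          by (intro set_integral_add continuous_set_integrable domain_borel bounded_domain continuous_intros oscc)
        also have "\<dots> = l * V + l powr (1 - s) * osc"
          using set_integral_const_lmeasurable[OF domain_lmeasurable] by (simp add: V_def osc_def)
        finally show ?thesis .
      qed
      show ?thesis
      proof (cases "J > 0")
        case True
        have "(LINT x:\<Omega>|lebesgue. \<bar>\<phi> x - c\<bar>) \<le> J * V + J powr (1 - s) * (C1 * J powr s)"
          using le[OF True] osc mult_left_mono[of osc "C1 * J powr s" "J powr (1 - s)"] by simp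
        also have "J powr (1 - s) * (C1 * J powr s) = C1 * J"
          using True powr_add[of J "1 - s" s] by simp
        finally show ?thesis by (simp add: algebra_simps)
      next
        case False
        then have "J = 0" by (simp add: J_def)
        then have "osc = 0" using osc \<open>osc \<ge> 0\<close> by simp
        have "(LINT x:\<Omega>|lebesgue. \<bar>\<phi> x - c\<bar>) \<le> 0"
        proof (rule field_le_epsilon)
          fix e :: real assume "e > 0"
          then show "(LINT x:\<Omega>|lebesgue. \<bar>\<phi> x - c\<bar>) \<le> 0 + e"
            using le[of "e / V"] \<open>V > 0\<close> \<open>osc = 0\<close> by simp
        qed
        then show ?thesis using \<open>J = 0\<close> by simp
      qed
    qed
    have grad1: "(LINT x:\<Omega>|lebesgue. grad_norm \<phi> x) \<le> V powr (1/2) * J"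
    proof -
      have "(mean_on \<Omega> (grad_norm \<phi>))\<^sup>2 * V \<le> I"
        unfolding V_def I_def using domain_measure_pos
        by (intro mean_on_square_le grad_norm_continuous \<phi>C1 domain_borel bounded_domain)
      then have "(LINT x:\<Omega>|lebesgue. grad_norm \<phi> x)\<^sup>2 \<le> V * I"
        using \<open>V > 0\<close> by (simp add: mean_on_def V_def power_divide power2_eq_square field_simps)
      then have "\<bar>LINT x:\<Omega>|lebesgue. grad_norm \<phi> x\<bar> \<le> sqrt (V * I)"
        using real_sqrt_le_mono by fastforce
      then show ?thesis using \<open>V > 0\<close> \<open>I \<ge> 0\<close> by (simp add: J_def powr_half_sqrt real_sqrt_mult)
    qed
    have "\<bar>c\<bar> \<le> C2 * ((V + C1) * J + V powr (1/2) * J)"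
      using C2(2)[OF \<phi>, of c] osc1 grad1 C2(1) by (meson add_mono less_imp_le mult_left_mono order_trans)
    also have "\<dots> = C3 * J" by (simp add: C3_def algebra_simps)
    finally have "\<bar>c\<bar> powr s \<le> (C3 * J) powr s" using s by (intro powr_mono2) auto
    then have cs: "\<bar>c\<bar> powr s \<le> C3 powr s * J powr s" using \<open>C3 > 0\<close> by (simp add: powr_mult J_def)
    have pt: "\<bar>\<phi> x\<bar> powr s \<le> 2 powr s * (\<bar>\<phi> x - c\<bar> powr s + \<bar>c\<bar> powr s)" for x
    proof -
      have "\<bar>\<phi> x\<bar> \<le> \<bar>\<phi> x - c\<bar> + \<bar>c\<bar>" by simp
      also have "\<dots> \<le> 2 * max \<bar>\<phi> x - c\<bar> \<bar>c\<bar>" by (simp add: max_def)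
      finally have "\<bar>\<phi> x\<bar> \<le> 2 * max \<bar>\<phi> x - c\<bar> \<bar>c\<bar>" .
      then have "\<bar>\<phi> x\<bar> powr s \<le> (2 * max \<bar>\<phi> x - c\<bar> \<bar>c\<bar>) powr s" using s(1) by (intro powr_mono2) simp_all
      also have "\<dots> = 2 powr s * (max \<bar>\<phi> x - c\<bar> \<bar>c\<bar>) powr s" by (rule powr_mult)
      also have "\<dots> \<le> 2 powr s * (\<bar>\<phi> x - c\<bar> powr s + \<bar>c\<bar> powr s)" by (intro mult_left_mono) (auto simp: max_def)
      finally show ?thesis .
    qed
    have "(\<integral>\<^sup>+x\<in>\<Omega>. ennreal (\<bar>\<phi> x\<bar> powr s) \<partial>lborel)
       \<le> (\<integral>\<^sup>+x\<in>\<Omega>. ennreal (2 powr s * (\<bar>\<phi> x - c\<bar> powr s + \<bar>c\<bar> powr s)) \<partial>lborel)"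
      using pt by (intro nn_integral_mono) (auto simp: indicator_def intro!: ennreal_leI)
    also have "\<dots> = ennreal (LINT x:\<Omega>|lebesgue. 2 powr s * (\<bar>\<phi> x - c\<bar> powr s + \<bar>c\<bar> powr s))"
      by (intro nn_integral_continuous_eq domain_borel bounded_domain continuous_intros oscc) auto
    also have "(LINT x:\<Omega>|lebesgue. 2 powr s * (\<bar>\<phi> x - c\<bar> powr s + \<bar>c\<bar> powr s))
      = 2 powr s * ((LINT x:\<Omega>|lebesgue. \<bar>\<phi> x - c\<bar> powr s) + (LINT x:\<Omega>|lebesgue. \<bar>c\<bar> powr s))"
      by (subst set_integral_add(2)[symmetric])
         (auto intro!: continuous_set_integrable domain_borel bounded_domain continuous_intros oscc)
    also have "\<dots> = 2 powr s * (osc + \<bar>c\<bar> powr s * V)"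
      using set_integral_const_lmeasurable[OF domain_lmeasurable] by (simp add: V_def osc_def)
    also have "ennreal \<dots> \<le> ennreal (S * J powr s)"
    proof (rule ennreal_leI)
      have "2 powr s * (osc + \<bar>c\<bar> powr s * V) \<le> 2 powr s * (C1 * J powr s + (C3 powr s * J powr s) * V)"
        using osc cs \<open>V > 0\<close> by (intro mult_left_mono add_mono mult_right_mono) auto
      then show "2 powr s * (osc + \<bar>c\<bar> powr s * V) \<le> S * J powr s" by (simp add: S_def algebra_simps)
    qed
    finally show ?thesis by (simp only: JI I_def)
  qed
  show thesis
  proof (rule that[OF \<open>S > 0\<close>])
    fix \<phi> :: "real^'n \<Rightarrow> real" assume "\<phi> \<in> Cc_infinity \<Omega>"
    from main[OF this] show "(\<integral>\<^sup>+x\<in>\<Omega>. ennreal (\<bar>\<phi> x\<bar> powr (2 * Q / (Q - 2))) \<partial>lborel)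
       \<le> ennreal (S * (LINT y:\<Omega>|lebesgue. (grad_norm \<phi> y)\<^sup>2) powr (Q / (Q - 2)))"
      unfolding s(2) unfolding s_def .
  qed
qed

end

section \<open>Sobolev functions vanishing on the boundary\<close>

lemma frechet_derivative_eq: "(u has_derivative D) (at x) \<Longrightarrow> frechet_derivative u (at x) = D"
  using frechet_derivative_at by metis

lemma Ck_Suc_imp_Ck: "Ck (Suc k) u \<Longrightarrow> Ck k u"
proof (induction k arbitrary: u)
  case 0
  then show ?case by (simp add: differentiable_imp_continuous_on)
next
  case (Suc k)
  then show ?case by simp
qed

lemma Ck_SucD:
  assumes "Ck (Suc k) u"
  shows "(u has_derivative frechet_derivative u (at x)) (at x)" "Ck k (\<lambda>x. frechet_derivative u (at x) v)"
  using assms by (auto simp: differentiable_on_def frechet_derivative_works)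

lemma Ck_SucI:
  assumes "\<And>x. (u has_derivative D x) (at x)" and "\<And>v. Ck k (\<lambda>x. D x v)"
  shows "Ck (Suc k) u"
proof -
  have "frechet_derivative u (at x) = D x" for x by (rule frechet_derivative_eq[OF assms(1)])
  then show ?thesis using assms by (auto simp: differentiable_on_def differentiable_def)
qed

lemma Ck_const: "Ck k (\<lambda>_. c)"
proof (induction k arbitrary: c)
  case (Suc k)
  show ?case by (rule Ck_SucI[where D="\<lambda>_ _. 0"]) (use Suc in auto)
qed simp

lemma Ck_add: "Ck k u \<Longrightarrow> Ck k v \<Longrightarrow> Ck k (\<lambda>x. u x + v x)"
proof (induction k arbitrary: u v)
  case (Suc k)
  show ?case
    by (rule Ck_SucI[OF has_derivative_add[OF Ck_SucD(1)[OF Suc.prems(1)] Ck_SucD(1)[OF Suc.prems(2)]]])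
       (intro Suc.IH Ck_SucD(2)[OF Suc.prems(1)] Ck_SucD(2)[OF Suc.prems(2)])
qed (simp add: continuous_on_add)

lemma Ck_mult: "Ck k u \<Longrightarrow> Ck k v \<Longrightarrow> Ck k (\<lambda>x. u x * v x)"
proof (induction k arbitrary: u v)
  case (Suc k)
  show ?case
    by (rule Ck_SucI[OF has_derivative_mult[OF Ck_SucD(1)[OF Suc.prems(1)] Ck_SucD(1)[OF Suc.prems(2)]]])
       (intro Ck_add Suc.IH Ck_SucD(2)[OF Suc.prems(1)] Ck_SucD(2)[OF Suc.prems(2)] Ck_Suc_imp_Ck[OF Suc.prems(1)] Ck_Suc_imp_Ck[OF Suc.prems(2)])
qed (simp add: continuous_on_mult)

lemma Ck_power: "Ck k u \<Longrightarrow> Ck k (\<lambda>x. u x ^ n)"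
  by (induction n) (simp_all add: Ck_const Ck_mult)

lemma Ck_sum: "(\<And>i. i \<in> I \<Longrightarrow> Ck k (u i)) \<Longrightarrow> Ck k (\<lambda>x. \<Sum>i\<in>I. u i x)"
  by (induction I rule: infinite_finite_induct) (simp_all add: Ck_const Ck_add)

lemma polynomial_test_function:
  fixes \<phi> :: "real^'n \<Rightarrow> real" and a :: "nat \<Rightarrow> real"
  assumes "\<phi> \<in> Cc_infinity \<Omega>"
  shows "(\<lambda>x. \<Sum>i\<le>n. a i * \<phi> x ^ Suc i) \<in> Cc_infinity \<Omega>"
proof -
  define S where "S = closure {x. \<phi> x \<noteq> 0}"
  define T where "T = closure {x. (\<Sum>i\<le>n. a i * \<phi> x ^ Suc i) \<noteq> 0}"
  have \<phi>: "\<And>k. Ck k \<phi>" "compact S" "S \<subseteq> \<Omega>" using assms by (auto simp: Cc_infinity_def S_def)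
  have "{x. (\<Sum>i\<le>n. a i * \<phi> x ^ Suc i) \<noteq> 0} \<subseteq> {x. \<phi> x \<noteq> 0}" by auto
  then have "T \<subseteq> S" unfolding S_def T_def by (rule closure_mono)
  moreover have "closed T" by (simp add: T_def)
  ultimately have "compact T" using \<phi>(2) compact_Int_closed[of S T] by (simp add: Int_absorb1)
  moreover have "Ck k (\<lambda>x. \<Sum>i\<le>n. a i * \<phi> x ^ Suc i)" for k
    by (intro Ck_sum Ck_mult Ck_const Ck_power \<phi>)
  ultimately show ?thesis using \<open>T \<subseteq> S\<close> \<phi>(3) by (simp add: Cc_infinity_def T_def)
qed

lemma X_gradient_compose:
  assumes u: "u differentiable (at x)" and P: "(P has_real_derivative P') (at (u x))"
  shows "X_gradient X (\<lambda>x. P (u x)) x = P' *\<^sub>R X_gradient X u x"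
proof -
  have "(u has_derivative frechet_derivative u (at x)) (at x)" using u by (simp add: frechet_derivative_works)
  moreover have "(P has_derivative (\<lambda>h. P' * h)) (at (u x))" using P by (simp add: has_field_derivative_def)
  ultimately have "((\<lambda>x. P (u x)) has_derivative (\<lambda>v. P' * frechet_derivative u (at x) v)) (at x)"
    by (rule has_derivative_compose)
  then have "X_gradient X (\<lambda>x. P (u x)) x $ j = P' * frechet_derivative u (at x) (X j x)" for j
    by (rule X_gradient_eq)
  then show ?thesis by (simp add: vec_eq_iff X_gradient_def)
qed

text \<open>By the Weierstrass theorem applied to the derivative, a \<open>C\<^sup>1\<close> function that vanishes at
  \<open>0\<close> is on bounded intervals close in \<open>C\<^sup>1\<close> to polynomials that vanish at \<open>0\<close>. These preserve
  the space of test functions under composition.\<close>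
lemma polynomial_C1_approximation:
  fixes F F' :: "real \<Rightarrow> real"
  assumes F: "\<And>t. (F has_real_derivative F' t) (at t)" and F': "continuous_on UNIV F'" and "F 0 = 0" and "\<epsilon> > 0"
  obtains a :: "nat \<Rightarrow> real" and n where
    "\<And>t. \<bar>t\<bar> \<le> K \<Longrightarrow> \<bar>F t - (\<Sum>i\<le>n. (a i / Suc i) * t ^ Suc i)\<bar> \<le> \<epsilon> * \<bar>t\<bar>"
    "\<And>t. \<bar>t\<bar> \<le> K \<Longrightarrow> \<bar>F' t - (\<Sum>i\<le>n. a i * t ^ i)\<bar> \<le> \<epsilon>"
proof -
  obtain p where p: "real_polynomial_function p" "\<And>t. t \<in> {-K..K} \<Longrightarrow> \<bar>F' t - p t\<bar> < \<epsilon>"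
    using Stone_Weierstrass_real_polynomial_function[of "{-K..K}" F' \<epsilon>] continuous_on_subset[OF F'] \<open>\<epsilon> > 0\<close> by auto
  obtain a n where pa: "p = (\<lambda>t. \<Sum>i\<le>n. a i * t ^ i)"
    using p(1) real_polynomial_function_iff_sum by blast
  define P where "P = (\<lambda>t. \<Sum>i\<le>n. (a i / Suc i) * t ^ Suc i)"
  have P: "(P has_real_derivative p t) (at t)" for t
  proof -
    have "(P has_real_derivative (\<Sum>i\<le>n. (a i / Suc i) * (Suc i * t ^ i))) (at t)"
      unfolding P_def by (intro DERIV_sum DERIV_cmult) (use DERIV_power_Suc[OF DERIV_ident, where x=t] in auto)
    then show ?thesis by (simp add: pa)
  qed
  have D: "((\<lambda>t. F t - P t) has_real_derivative (F' t - p t)) (at t)" for t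
    using F P by (rule DERIV_diff)
  have FP: "\<bar>F t - P t\<bar> \<le> \<epsilon> * \<bar>t\<bar>" if "\<bar>t\<bar> \<le> K" for t
  proof -
    have "norm ((F t - P t) - (F 0 - P 0)) \<le> \<epsilon> * norm (t - 0)"
    proof (rule field_differentiable_bound[of "{-K..K}" "\<lambda>t. F t - P t" "\<lambda>t. F' t - p t"])
      show "((\<lambda>t. F t - P t) has_real_derivative (F' z - p z)) (at z within {-K..K})" for z
        using D by (rule DERIV_subset) simp
      show "norm (F' z - p z) \<le> \<epsilon>" if "z \<in> {-K..K}" for z using p(2)[OF that] by simp
    qed (use that in auto)
    then show ?thesis using \<open>F 0 = 0\<close> by (simp add: P_def)
  qed
  show thesis
  proof (rule that[of a n])
    fix t :: real assume t: "\<bar>t\<bar> \<le> K"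
    show "\<bar>F t - (\<Sum>i\<le>n. (a i / Suc i) * t ^ Suc i)\<bar> \<le> \<epsilon> * \<bar>t\<bar>" using FP[OF t] unfolding P_def .
    have "t \<in> {-K..K}" using t by auto
    from p(2)[OF this] show "\<bar>F' t - (\<Sum>i\<le>n. a i * t ^ i)\<bar> \<le> \<epsilon>" unfolding pa by (rule less_imp_le)
  qed
qed

subsection \<open>Square integrable functions\<close>

lemma norm_add_square_le:
  fixes a b :: "'a::real_normed_vector" shows "(norm (a + b))\<^sup>2 \<le> 2 * (norm a)\<^sup>2 + 2 * (norm b)\<^sup>2"
proof -
  have "(norm (a + b))\<^sup>2 \<le> (norm a + norm b)\<^sup>2" by (intro power_mono norm_triangle_ineq) simp
  also have "\<dots> \<le> 2 * (norm a)\<^sup>2 + 2 * (norm b)\<^sup>2" using sum_squares_bound[of "norm a" "norm b"] by (simp add: power2_sum)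
  finally show ?thesis .
qed

definition L2 :: "'a measure \<Rightarrow> ('a \<Rightarrow> 'b::euclidean_space) \<Rightarrow> bool" where
  "L2 M f \<longleftrightarrow> f \<in> borel_measurable M \<and> integrable M (\<lambda>x. (norm (f x))\<^sup>2)"

lemma L2D: "L2 M f \<Longrightarrow> f \<in> borel_measurable M" "L2 M f \<Longrightarrow> integrable M (\<lambda>x. (norm (f x))\<^sup>2)"
  by (auto simp: L2_def)

lemma L2_bound:
  assumes [measurable]: "f \<in> borel_measurable M" and h: "integrable M h" and "AE x in M. (norm (f x))\<^sup>2 \<le> h x"
  shows "L2 M f"
  unfolding L2_def
proof (intro conjI assms(1))
  show "integrable M (\<lambda>x. (norm (f x))\<^sup>2)"
    by (rule Bochner_Integration.integrable_bound[OF h]) (use assms(3) in \<open>auto elim!: eventually_mono\<close>)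
qed

lemma L2_add:
  assumes f: "L2 M f" and g: "L2 M g"
  shows "L2 M (\<lambda>x. f x + g x)"
    "(\<integral>x. (norm (f x + g x))\<^sup>2 \<partial>M) \<le> 2 * (\<integral>x. (norm (f x))\<^sup>2 \<partial>M) + 2 * (\<integral>x. (norm (g x))\<^sup>2 \<partial>M)"
proof -
  note [measurable] = L2D(1)[OF f] L2D(1)[OF g]
  have i: "integrable M (\<lambda>x. 2 * (norm (f x))\<^sup>2 + 2 * (norm (g x))\<^sup>2)"
    using L2D(2)[OF f] L2D(2)[OF g] by simp
  show l: "L2 M (\<lambda>x. f x + g x)" by (rule L2_bound[OF _ i]) (auto intro: norm_add_square_le)
  have "(\<integral>x. (norm (f x + g x))\<^sup>2 \<partial>M) \<le> (\<integral>x. 2 * (norm (f x))\<^sup>2 + 2 * (norm (g x))\<^sup>2 \<partial>M)"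
    using L2D(2)[OF l] i norm_add_square_le by (intro integral_mono) auto
  also have "\<dots> = 2 * (\<integral>x. (norm (f x))\<^sup>2 \<partial>M) + 2 * (\<integral>x. (norm (g x))\<^sup>2 \<partial>M)"
    using L2D(2)[OF f] L2D(2)[OF g] by simp
  finally show "(\<integral>x. (norm (f x + g x))\<^sup>2 \<partial>M) \<le> 2 * (\<integral>x. (norm (f x))\<^sup>2 \<partial>M) + 2 * (\<integral>x. (norm (g x))\<^sup>2 \<partial>M)" .
qed

lemma L2_uminus: "L2 M f \<Longrightarrow> L2 M (\<lambda>x. - f x)"
  by (simp add: L2_def)

lemma L2_diff: "L2 M f \<Longrightarrow> L2 M g \<Longrightarrow> L2 M (\<lambda>x. f x - g x)"
  using L2_add(1)[of M f "\<lambda>x. - g x"] by (simp add: L2_uminus)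

lemma L2_scale:
  fixes f :: "'a \<Rightarrow> 'b::euclidean_space"
  assumes f: "L2 M f" and [measurable]: "c \<in> borel_measurable M" and c: "\<And>x. x \<in> space M \<Longrightarrow> \<bar>c x\<bar> \<le> K"
  shows "L2 M (\<lambda>x. c x *\<^sub>R f x)" "(\<integral>x. (norm (c x *\<^sub>R f x))\<^sup>2 \<partial>M) \<le> K\<^sup>2 * (\<integral>x. (norm (f x))\<^sup>2 \<partial>M)"
proof -
  note [measurable] = L2D(1)[OF f]
  have i: "integrable M (\<lambda>x. K\<^sup>2 * (norm (f x))\<^sup>2)" using L2D(2)[OF f] by simp
  have le: "(norm (c x *\<^sub>R f x))\<^sup>2 \<le> K\<^sup>2 * (norm (f x))\<^sup>2" if "x \<in> space M" for x
  proof -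
    have "\<bar>c x\<bar>\<^sup>2 \<le> K\<^sup>2" using c[OF that] by (intro power_mono) auto
    then show ?thesis by (simp add: power_mult_distrib mult_right_mono)
  qed
  show l: "L2 M (\<lambda>x. c x *\<^sub>R f x)" by (rule L2_bound[OF _ i]) (use le in auto)
  have "(\<integral>x. (norm (c x *\<^sub>R f x))\<^sup>2 \<partial>M) \<le> (\<integral>x. K\<^sup>2 * (norm (f x))\<^sup>2 \<partial>M)"
    using L2D(2)[OF l] i le by (intro integral_mono) auto
  then show "(\<integral>x. (norm (c x *\<^sub>R f x))\<^sup>2 \<partial>M) \<le> K\<^sup>2 * (\<integral>x. (norm (f x))\<^sup>2 \<partial>M)" by simp
qed

lemma L2_tendsto_AE_subseq:
  assumes f: "\<And>k. L2 M (f k)" and g: "L2 M g" and lim: "(\<lambda>k. \<integral>x. (norm (f k x - g x))\<^sup>2 \<partial>M) \<longlonglongrightarrow> 0"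
  obtains r :: "nat \<Rightarrow> nat" where "strict_mono r" "AE x in M. (\<lambda>k. f (r k) x) \<longlonglongrightarrow> g x"
proof -
  have "\<exists>r. strict_mono r \<and> (AE x in M. (\<lambda>k. (norm (f (r k) x - g x))\<^sup>2) \<longlonglongrightarrow> 0)"
    by (rule tendsto_L1_AE_subseq) (use lim L2D(2)[OF L2_diff[OF f g]] in auto)
  then obtain r where r: "strict_mono r" "AE x in M. (\<lambda>k. (norm (f (r k) x - g x))\<^sup>2) \<longlonglongrightarrow> 0" by blast
  have "AE x in M. (\<lambda>k. f (r k) x) \<longlonglongrightarrow> g x"
    using r(2)
  proof eventually_elim
    fix x assume "(\<lambda>k. (norm (f (r k) x - g x))\<^sup>2) \<longlonglongrightarrow> 0"
    then have "(\<lambda>k. sqrt ((norm (f (r k) x - g x))\<^sup>2)) \<longlonglongrightarrow> sqrt 0" by (rule tendsto_real_sqrt)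
    then have "(\<lambda>k. norm (f (r k) x - g x)) \<longlonglongrightarrow> 0" by simp
    then show "(\<lambda>k. f (r k) x) \<longlonglongrightarrow> g x" by (simp add: LIM_zero_iff tendsto_norm_zero_iff)
  qed
  then show thesis using that r(1) by blast
qed

lemma Lp_on_2_iff: "f \<in> Lp_on \<Omega> 2 \<longleftrightarrow> L2 (lebesgue_on \<Omega>) f"
  by (simp add: Lp_on_def L2_def)

lemma Lp_norm_2_tendsto_0_iff:
  "(\<lambda>k. Lp_norm \<Omega> 2 (f k)) \<longlonglongrightarrow> 0 \<longleftrightarrow> (\<lambda>k. \<integral>x. (norm (f k x))\<^sup>2 \<partial>lebesgue_on \<Omega>) \<longlonglongrightarrow> 0"
proof -
  have eq: "Lp_norm \<Omega> 2 (f k) = sqrt (\<integral>x. (norm (f k x))\<^sup>2 \<partial>lebesgue_on \<Omega>)" for k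
    by (simp add: Lp_norm_def powr_half_sqrt)
  have "(\<lambda>k. sqrt (a k)) \<longlonglongrightarrow> 0 \<longleftrightarrow> a \<longlonglongrightarrow> 0" if "\<And>k. a k \<ge> 0" for a :: "nat \<Rightarrow> real"
  proof
    assume "(\<lambda>k. sqrt (a k)) \<longlonglongrightarrow> 0"
    then have "(\<lambda>k. (sqrt (a k))\<^sup>2) \<longlonglongrightarrow> 0\<^sup>2" by (rule tendsto_power)
    then show "a \<longlonglongrightarrow> 0" using that by simp
  next
    assume "a \<longlonglongrightarrow> 0"
    then have "(\<lambda>k. sqrt (a k)) \<longlonglongrightarrow> sqrt 0" by (rule tendsto_real_sqrt)
    then show "(\<lambda>k. sqrt (a k)) \<longlonglongrightarrow> 0" by simp
  qed
  then show ?thesis unfolding eq by simp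
qed

lemma W0_gradient_2_iff:
  "W0_gradient X \<Omega> 2 u G \<longleftrightarrow> L2 (lebesgue_on \<Omega>) u \<and> L2 (lebesgue_on \<Omega>) G \<and>
    (\<exists>\<phi>. (\<forall>k::nat. \<phi> k \<in> Cc_infinity \<Omega>) \<and>
      (\<lambda>k. \<integral>x. (norm (\<phi> k x - u x))\<^sup>2 \<partial>lebesgue_on \<Omega>) \<longlonglongrightarrow> 0 \<and>
      (\<lambda>k. \<integral>x. (norm (X_gradient X (\<phi> k) x - G x))\<^sup>2 \<partial>lebesgue_on \<Omega>) \<longlonglongrightarrow> 0)"
  unfolding W0_gradient_def Lp_on_2_iff Lp_norm_2_tendsto_0_iff ..

context cc_space begin

abbreviation "\<mu> \<equiv> lebesgue_on \<Omega>"

lemma domain_sets: "\<Omega> \<in> sets lebesgue"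
  using domain_borel by simp

lemma integral_domain: "(\<integral>x. f x \<partial>\<mu>) = (LINT x:\<Omega>|lebesgue. (f x :: real))"
  using domain_sets by (simp add: integral_restrict_space set_lebesgue_integral_def)

lemma nn_integral_domain:
  assumes "f \<in> borel_measurable borel"
  shows "(\<integral>\<^sup>+x. f x \<partial>\<mu>) = (\<integral>\<^sup>+x\<in>\<Omega>. f x \<partial>lborel)"
proof -
  have [measurable]: "\<Omega> \<in> sets borel" "f \<in> borel_measurable borel" by (rule domain_borel, rule assms)
  have "(\<integral>\<^sup>+x. f x \<partial>\<mu>) = (\<integral>\<^sup>+x\<in>\<Omega>. f x \<partial>lebesgue)" using domain_sets by (simp add: nn_integral_restrict_space)
  also have "\<dots> = (\<integral>\<^sup>+x\<in>\<Omega>. f x \<partial>lborel)" by (rule nn_integral_completion) measurable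
  finally show ?thesis .
qed

lemma finite_measure_domain: "finite_measure \<mu>"
  using domain_lmeasurable by (rule finite_measure_lebesgue_on)

lemma continuous_measurable_domain:
  fixes f :: "real^'n \<Rightarrow> 'b::{second_countable_topology, t2_space}"
  shows "continuous_on UNIV f \<Longrightarrow> f \<in> borel_measurable \<mu>"
  using continuous_borel_lebesgue[of f] by (rule measurable_restrict_space1)

lemma continuous_L2:
  fixes f :: "real^'n \<Rightarrow> 'b::euclidean_space"
  assumes "continuous_on UNIV f"
  shows "L2 \<mu> f"
  unfolding L2_def
proof
  show "f \<in> borel_measurable \<mu>" using assms by (rule continuous_measurable_domain)
  have "set_integrable lebesgue \<Omega> (\<lambda>x. (norm (f x))\<^sup>2)"
    by (intro continuous_set_integrable domain_borel bounded_domain continuous_intros assms)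
  then show "integrable \<mu> (\<lambda>x. (norm (f x))\<^sup>2)"
    using domain_sets by (simp add: integrable_restrict_space set_integrable_def)
qed

lemma test_function_L2:
  assumes "\<phi> \<in> Cc_infinity \<Omega>"
  shows "L2 \<mu> \<phi>" "L2 \<mu> (X_gradient X \<phi>)"
  using C1_onD(1) X_gradient_continuous continuous_fields Cc_infinity_C1[OF assms]
  by (auto intro!: continuous_L2)

text \<open>Fatou's lemma along a subsequence of test functions that converges almost everywhere.\<close>
theorem sobolev_W0:
  obtains S where "S > 0"
    "\<And>u G. W0_gradient X \<Omega> 2 u G \<Longrightarrow> (\<integral>\<^sup>+x. ennreal (\<bar>u x\<bar> powr (2 * Q / (Q - 2))) \<partial>\<mu>)
       \<le> ennreal (S * (\<integral>x. (norm (G x))\<^sup>2 \<partial>\<mu>) powr (Q / (Q - 2)))"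
proof -
  obtain S where S: "S > 0"
    "\<And>\<phi>. \<phi> \<in> Cc_infinity \<Omega> \<Longrightarrow> (\<integral>\<^sup>+x\<in>\<Omega>. ennreal (\<bar>\<phi> x\<bar> powr (2 * Q / (Q - 2))) \<partial>lborel)
       \<le> ennreal (S * (LINT y:\<Omega>|lebesgue. (grad_norm \<phi> y)\<^sup>2) powr (Q / (Q - 2)))"
    using sobolev_test_functions by blast
  define s where "s = 2 * Q / (Q - 2)"
  define t where "t = Q / (Q - 2)"
  have st: "s > 0" "t > 0" using dimension_gt_2 by (auto simp: s_def t_def)
  show thesis
  proof (rule that)
    show "S * 2 powr t > 0" using S by simp
    fix u :: "real^'n \<Rightarrow> real" and G :: "real^'n \<Rightarrow> real^'m"
    assume W: "W0_gradient X \<Omega> 2 u G"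
    then obtain \<phi> where u: "L2 \<mu> u" and G: "L2 \<mu> G" and \<phi>: "\<And>k::nat. \<phi> k \<in> Cc_infinity \<Omega>"
      and lim: "(\<lambda>k. \<integral>x. (norm (\<phi> k x - u x))\<^sup>2 \<partial>\<mu>) \<longlonglongrightarrow> 0"
        "(\<lambda>k. \<integral>x. (norm (X_gradient X (\<phi> k) x - G x))\<^sup>2 \<partial>\<mu>) \<longlonglongrightarrow> 0"
      unfolding W0_gradient_2_iff by blast
    obtain r where r: "strict_mono r" "AE x in \<mu>. (\<lambda>k. \<phi> (r k) x) \<longlonglongrightarrow> u x"
      using L2_tendsto_AE_subseq[OF test_function_L2(1)[OF \<phi>] u lim(1)] by blast
    define I where "I = (\<integral>x. (norm (G x))\<^sup>2 \<partial>\<mu>)"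
    have "I \<ge> 0" unfolding I_def by simp
    define e where "e = (\<lambda>k. \<integral>x. (norm (X_gradient X (\<phi> (r k)) x - G x))\<^sup>2 \<partial>\<mu>)"
    have e: "e \<longlonglongrightarrow> 0" using LIMSEQ_subseq_LIMSEQ[OF lim(2) r(1)] by (simp add: e_def o_def)
    have e0: "e k \<ge> 0" for k by (simp add: e_def)
    have \<phi>c: "continuous_on UNIV (\<phi> k)" for k using C1_onD(1)[OF Cc_infinity_C1[OF \<phi>]] .
    have bound: "(\<integral>\<^sup>+x. ennreal (\<bar>\<phi> (r k) x\<bar> powr s) \<partial>\<mu>) \<le> ennreal (S * (2 * I + 2 * e k) powr t)" for k
    proof -
      have "(\<integral>\<^sup>+x. ennreal (\<bar>\<phi> (r k) x\<bar> powr s) \<partial>\<mu>) = (\<integral>\<^sup>+x\<in>\<Omega>. ennreal (\<bar>\<phi> (r k) x\<bar> powr s) \<partial>lborel)"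
        using borel_measurable_continuous_onI[OF \<phi>c] by (intro nn_integral_domain) measurable
      also have "\<dots> \<le> ennreal (S * (LINT y:\<Omega>|lebesgue. (grad_norm (\<phi> (r k)) y)\<^sup>2) powr t)"
        unfolding s_def t_def by (rule S(2)[OF \<phi>])
      also have "\<dots> \<le> ennreal (S * (2 * I + 2 * e k) powr t)"
      proof (intro ennreal_leI mult_left_mono powr_mono2)
        have "(\<integral>x. (norm (G x + (X_gradient X (\<phi> (r k)) x - G x)))\<^sup>2 \<partial>\<mu>) \<le> 2 * I + 2 * e k"
          unfolding I_def e_def by (intro L2_add(2) L2_diff G test_function_L2 \<phi>)
        then show "(LINT y:\<Omega>|lebesgue. (grad_norm (\<phi> (r k)) y)\<^sup>2) \<le> 2 * I + 2 * e k"
          by (simp add: integral_domain[symmetric])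
      qed (use S st set_integral_square_nonneg in auto)
      finally show ?thesis .
    qed
    have "(\<integral>\<^sup>+x. ennreal (\<bar>u x\<bar> powr s) \<partial>\<mu>) = (\<integral>\<^sup>+x. liminf (\<lambda>k. ennreal (\<bar>\<phi> (r k) x\<bar> powr s)) \<partial>\<mu>)"
    proof (rule nn_integral_cong_AE)
      show "AE x in \<mu>. ennreal (\<bar>u x\<bar> powr s) = liminf (\<lambda>k. ennreal (\<bar>\<phi> (r k) x\<bar> powr s))"
        using r(2)
      proof eventually_elim
        fix x assume "(\<lambda>k. \<phi> (r k) x) \<longlonglongrightarrow> u x"
        then have "(\<lambda>k. ennreal (\<bar>\<phi> (r k) x\<bar> powr s)) \<longlonglongrightarrow> ennreal (\<bar>u x\<bar> powr s)"
          using st by (intro tendsto_ennrealI tendsto_powr2 tendsto_rabs) auto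
        then show "ennreal (\<bar>u x\<bar> powr s) = liminf (\<lambda>k. ennreal (\<bar>\<phi> (r k) x\<bar> powr s))"
          by (intro lim_imp_Liminf[symmetric]) auto
      qed
    qed
    also have "\<dots> \<le> liminf (\<lambda>k. \<integral>\<^sup>+x. ennreal (\<bar>\<phi> (r k) x\<bar> powr s) \<partial>\<mu>)"
      using continuous_measurable_domain[OF \<phi>c] by (intro nn_integral_liminf) measurable
    also have "\<dots> \<le> liminf (\<lambda>k. ennreal (S * (2 * I + 2 * e k) powr t))"
      using bound by (intro Liminf_mono always_eventually) auto
    also have "\<dots> = ennreal (S * (2 * I + 2 * 0) powr t)"
      using st \<open>I \<ge> 0\<close> e0
      by (intro lim_imp_Liminf tendsto_ennrealI tendsto_intros tendsto_powr2 e) auto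
    also have "S * (2 * I + 2 * 0) powr t = S * 2 powr t * I powr t"
      using \<open>I \<ge> 0\<close> by (simp add: powr_mult)
    finally show "(\<integral>\<^sup>+x. ennreal (\<bar>u x\<bar> powr (2 * Q / (Q - 2))) \<partial>\<mu>)
       \<le> ennreal (S * 2 powr t * (\<integral>x. (norm (G x))\<^sup>2 \<partial>\<mu>) powr (Q / (Q - 2)))"
      unfolding I_def s_def t_def .
  qed
qed

text \<open>Compose the approximating test functions \<open>\<phi> k\<close> with polynomials close to \<open>F\<close> on the range of \<open>\<phi> k\<close>.
  In the difference of the gradients, the term \<open>(F' (\<phi> k) - F' u) G\<close> tends to \<open>0\<close> by dominated
  convergence, which is why the \<open>\<phi> k\<close> are first thinned out to converge almost everywhere.\<close>
lemma W0_gradient_chain_rule: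
  fixes F F' :: "real \<Rightarrow> real"
  assumes W: "W0_gradient X \<Omega> 2 u G"
    and F: "\<And>t. (F has_real_derivative F' t) (at t)" and F': "continuous_on UNIV F'" and "F 0 = 0"
    and M: "\<And>t. \<bar>F' t\<bar> \<le> M"
  shows "W0_gradient X \<Omega> 2 (\<lambda>x. F (u x)) (\<lambda>x. F' (u x) *\<^sub>R G x)"
proof -
  obtain \<phi>0 where u: "L2 \<mu> u" and G: "L2 \<mu> G" and \<phi>0: "\<And>k::nat. \<phi>0 k \<in> Cc_infinity \<Omega>"
    and lim0: "(\<lambda>k. \<integral>x. (norm (\<phi>0 k x - u x))\<^sup>2 \<partial>\<mu>) \<longlonglongrightarrow> 0"
      "(\<lambda>k. \<integral>x. (norm (X_gradient X (\<phi>0 k) x - G x))\<^sup>2 \<partial>\<mu>) \<longlonglongrightarrow> 0"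
    using W unfolding W0_gradient_2_iff by blast
  obtain r where r: "strict_mono r" "AE x in \<mu>. (\<lambda>k. \<phi>0 (r k) x) \<longlonglongrightarrow> u x"
    using L2_tendsto_AE_subseq[OF test_function_L2(1)[OF \<phi>0] u lim0(1)] by blast
  define \<phi> where "\<phi> = (\<lambda>k. \<phi>0 (r k))"
  have \<phi>: "\<phi> k \<in> Cc_infinity \<Omega>" for k using \<phi>0 by (simp add: \<phi>_def)
  have lim: "(\<lambda>k. \<integral>x. (norm (\<phi> k x - u x))\<^sup>2 \<partial>\<mu>) \<longlonglongrightarrow> 0"
      "(\<lambda>k. \<integral>x. (norm (X_gradient X (\<phi> k) x - G x))\<^sup>2 \<partial>\<mu>) \<longlonglongrightarrow> 0"
    using LIMSEQ_subseq_LIMSEQ[OF lim0(1) r(1)] LIMSEQ_subseq_LIMSEQ[OF lim0(2) r(1)] by (simp_all add: \<phi>_def o_def)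
  have ae: "AE x in \<mu>. (\<lambda>k. \<phi> k x) \<longlonglongrightarrow> u x" using r(2) by (simp add: \<phi>_def)
  note \<phi>C1 = Cc_infinity_C1[OF \<phi>]
  have \<phi>c: "continuous_on UNIV (\<phi> k)" for k using C1_onD(1)[OF \<phi>C1] .
  have Fc: "continuous_on UNIV F" using F by (meson DERIV_continuous continuous_at_imp_continuous_on)
  note [measurable] = L2D(1)[OF u] L2D(1)[OF G] borel_measurable_continuous_onI[OF F'] borel_measurable_continuous_onI[OF Fc]
    L2D(1)[OF test_function_L2(1)[OF \<phi>]] L2D(1)[OF test_function_L2(2)[OF \<phi>]]
  have "M \<ge> 0" using M[of 0] by linarith
  have lipF: "\<bar>F s - F t\<bar> \<le> M * \<bar>s - t\<bar>" for s t
    using field_differentiable_bound[of UNIV F F' M s t] F M by simp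
  define \<epsilon> where "\<epsilon> = (\<lambda>k::nat. 1 / real (Suc k))"
  have \<epsilon>: "\<epsilon> k > 0" for k by (simp add: \<epsilon>_def)
  have \<epsilon>0: "\<epsilon> \<longlonglongrightarrow> 0" unfolding \<epsilon>_def using LIMSEQ_inverse_real_of_nat by (simp add: inverse_eq_divide)
  define C where "C = (\<lambda>k a n. \<forall>x. \<bar>F (\<phi> k x) - (\<Sum>i\<le>n. (a i / Suc i) * \<phi> k x ^ Suc i)\<bar> \<le> \<epsilon> k * \<bar>\<phi> k x\<bar> \<and>
      \<bar>F' (\<phi> k x) - (\<Sum>i\<le>n. a i * \<phi> k x ^ i)\<bar> \<le> \<epsilon> k)"
  have "\<exists>a n. C k a n" for k
  proof -
    have "compact (\<phi> k ` closure \<Omega>)" using bounded_domain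
      by (intro compact_continuous_image continuous_on_subset[OF \<phi>c subset_UNIV]) (simp add: compact_closure)
    then obtain K where K: "K > 0" "\<forall>t\<in>\<phi> k ` closure \<Omega>. norm t \<le> K"
      using compact_imp_bounded bounded_pos by blast
    have Kb: "\<bar>\<phi> k x\<bar> \<le> K" for x
    proof (cases "x \<in> \<Omega>")
      case True
      then have "x \<in> closure \<Omega>" using closure_subset by blast
      then show ?thesis using K(2) by auto
    next
      case False
      then show ?thesis using Cc_infinity_zero(1)[OF \<phi>] K(1) by simp
    qed
    show ?thesis
    proof (rule polynomial_C1_approximation[OF F F' \<open>F 0 = 0\<close> \<epsilon>[of k], where K=K])
      fix a n assume "\<And>t. \<bar>t\<bar> \<le> K \<Longrightarrow> \<bar>F t - (\<Sum>i\<le>n. (a i / Suc i) * t ^ Suc i)\<bar> \<le> \<epsilon> k * \<bar>t\<bar>"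
        "\<And>t. \<bar>t\<bar> \<le> K \<Longrightarrow> \<bar>F' t - (\<Sum>i\<le>n. a i * t ^ i)\<bar> \<le> \<epsilon> k"
      then have "C k a n" using Kb by (simp add: C_def)
      then show "\<exists>a n. C k a n" by blast
    qed
  qed
  then have "\<forall>k. \<exists>a. \<exists>n. C k a n" by blast
  from choice[OF this] obtain a where "\<forall>k. \<exists>n. C k (a k) n" ..
  from choice[OF this] obtain n where "\<forall>k. C k (a k) (n k)" ..
  then have an: "\<bar>F (\<phi> k x) - (\<Sum>i\<le>n k. (a k i / Suc i) * \<phi> k x ^ Suc i)\<bar> \<le> \<epsilon> k * \<bar>\<phi> k x\<bar>"
      "\<bar>F' (\<phi> k x) - (\<Sum>i\<le>n k. a k i * \<phi> k x ^ i)\<bar> \<le> \<epsilon> k" for k x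
    by (simp_all add: C_def)
  define p where "p = (\<lambda>k t. \<Sum>i\<le>n k. a k i * t ^ i)"
  define \<psi> where "\<psi> = (\<lambda>k x. \<Sum>i\<le>n k. (a k i / Suc i) * \<phi> k x ^ Suc i)"
  have \<psi>: "\<psi> k \<in> Cc_infinity \<Omega>" for k unfolding \<psi>_def by (rule polynomial_test_function[OF \<phi>])
  have X\<psi>: "X_gradient X (\<psi> k) x = p k (\<phi> k x) *\<^sub>R X_gradient X (\<phi> k) x" for k x
    unfolding \<psi>_def
  proof (rule X_gradient_compose[OF C1_onD(2)[OF \<phi>C1]])
    have "((\<lambda>t. \<Sum>i\<le>n k. (a k i / Suc i) * t ^ Suc i) has_real_derivative (\<Sum>i\<le>n k. (a k i / Suc i) * (Suc i * \<phi> k x ^ i))) (at (\<phi> k x))"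
      by (intro DERIV_sum DERIV_cmult) (use DERIV_power_Suc[OF DERIV_ident, where x="\<phi> k x"] in auto)
    then show "((\<lambda>t. \<Sum>i\<le>n k. (a k i / Suc i) * t ^ Suc i) has_real_derivative p k (\<phi> k x)) (at (\<phi> k x))"
      by (simp add: p_def)
  qed
  define Iu where "Iu = (\<integral>x. (norm (u x))\<^sup>2 \<partial>\<mu>)"
  define IG where "IG = (\<integral>x. (norm (G x))\<^sup>2 \<partial>\<mu>)"
  define eu where "eu = (\<lambda>k. \<integral>x. (norm (\<phi> k x - u x))\<^sup>2 \<partial>\<mu>)"
  define eG where "eG = (\<lambda>k. \<integral>x. (norm (X_gradient X (\<phi> k) x - G x))\<^sup>2 \<partial>\<mu>)"
  have e0: "eu \<longlonglongrightarrow> 0" "eG \<longlonglongrightarrow> 0" using lim by (simp_all add: eu_def eG_def)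
  have n\<phi>: "(\<integral>x. (norm (\<phi> k x))\<^sup>2 \<partial>\<mu>) \<le> 2 * Iu + 2 * eu k" for k
    using L2_add(2)[OF u L2_diff[OF test_function_L2(1)[OF \<phi>[of k]] u]] by (simp add: Iu_def eu_def)
  have nX\<phi>: "(\<integral>x. (norm (X_gradient X (\<phi> k) x))\<^sup>2 \<partial>\<mu>) \<le> 2 * IG + 2 * eG k" for k
    using L2_add(2)[OF G L2_diff[OF test_function_L2(2)[OF \<phi>[of k]] G]] by (simp add: IG_def eG_def)
  have FL2: "L2 \<mu> (\<lambda>x. F (u x))"
  proof (rule L2_bound)
    show "integrable \<mu> (\<lambda>x. M\<^sup>2 * (norm (u x))\<^sup>2)" using L2D(2)[OF u] by simp
    show "AE x in \<mu>. (norm (F (u x)))\<^sup>2 \<le> M\<^sup>2 * (norm (u x))\<^sup>2"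
    proof (rule AE_I2)
      fix x
      have "\<bar>F (u x)\<bar> \<le> M * \<bar>u x\<bar>" using lipF[of "u x" 0] \<open>F 0 = 0\<close> by simp
      then have "\<bar>F (u x)\<bar>\<^sup>2 \<le> (M * \<bar>u x\<bar>)\<^sup>2" by (intro power_mono) auto
      then show "(norm (F (u x)))\<^sup>2 \<le> M\<^sup>2 * (norm (u x))\<^sup>2" by (simp add: power_mult_distrib)
    qed
  qed measurable
  have GL2: "L2 \<mu> (\<lambda>x. F' (u x) *\<^sub>R G x)"
    by (rule L2_scale(1)[OF G _ M]) measurable
  have conv1: "(\<lambda>k. \<integral>x. (norm (\<psi> k x - F (u x)))\<^sup>2 \<partial>\<mu>) \<longlonglongrightarrow> 0"
  proof (rule tendsto_sandwich[OF always_eventually always_eventually tendsto_const])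
    show "\<forall>k. 0 \<le> (\<integral>x. (norm (\<psi> k x - F (u x)))\<^sup>2 \<partial>\<mu>)" by simp
    show "\<forall>k. (\<integral>x. (norm (\<psi> k x - F (u x)))\<^sup>2 \<partial>\<mu>) \<le> 2 * ((\<epsilon> k)\<^sup>2 * (2 * Iu + 2 * eu k)) + 2 * (M\<^sup>2 * eu k)"
    proof
      fix k
      have i: "integrable \<mu> (\<lambda>x. 2 * ((\<epsilon> k)\<^sup>2 * (norm (\<phi> k x))\<^sup>2) + 2 * (M\<^sup>2 * (norm (\<phi> k x - u x))\<^sup>2))"
        using L2D(2)[OF test_function_L2(1)[OF \<phi>[of k]]] L2D(2)[OF L2_diff[OF test_function_L2(1)[OF \<phi>[of k]] u]] by simp
      have "(\<integral>x. (norm (\<psi> k x - F (u x)))\<^sup>2 \<partial>\<mu>) \<le> (\<integral>x. 2 * ((\<epsilon> k)\<^sup>2 * (norm (\<phi> k x))\<^sup>2) + 2 * (M\<^sup>2 * (norm (\<phi> k x - u x))\<^sup>2) \<partial>\<mu>)"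
      proof (rule integral_mono[OF L2D(2)[OF L2_diff[OF test_function_L2(1)[OF \<psi>] FL2]] i])
        fix x
        have "(norm (\<psi> k x - F (u x)))\<^sup>2 = (norm ((\<psi> k x - F (\<phi> k x)) + (F (\<phi> k x) - F (u x))))\<^sup>2" by simp
        also have "\<dots> \<le> 2 * (norm (\<psi> k x - F (\<phi> k x)))\<^sup>2 + 2 * (norm (F (\<phi> k x) - F (u x)))\<^sup>2"
          by (rule norm_add_square_le)
        also have "\<dots> \<le> 2 * (\<epsilon> k * \<bar>\<phi> k x\<bar>)\<^sup>2 + 2 * (M * \<bar>\<phi> k x - u x\<bar>)\<^sup>2"
          using an(1)[of k x] lipF[of "\<phi> k x" "u x"]
          by (intro add_mono mult_left_mono power_mono) (auto simp: \<psi>_def abs_minus_commute)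
        finally show "(norm (\<psi> k x - F (u x)))\<^sup>2 \<le> 2 * ((\<epsilon> k)\<^sup>2 * (norm (\<phi> k x))\<^sup>2) + 2 * (M\<^sup>2 * (norm (\<phi> k x - u x))\<^sup>2)"
          by (simp add: power_mult_distrib)
      qed
      also have "\<dots> = 2 * ((\<epsilon> k)\<^sup>2 * (\<integral>x. (norm (\<phi> k x))\<^sup>2 \<partial>\<mu>)) + 2 * (M\<^sup>2 * eu k)"
        using L2D(2)[OF test_function_L2(1)[OF \<phi>[of k]]] L2D(2)[OF L2_diff[OF test_function_L2(1)[OF \<phi>[of k]] u]]
        by (simp add: eu_def)
      also have "\<dots> \<le> 2 * ((\<epsilon> k)\<^sup>2 * (2 * Iu + 2 * eu k)) + 2 * (M\<^sup>2 * eu k)"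
        using n\<phi> by (intro add_mono mult_left_mono) auto
      finally show "(\<integral>x. (norm (\<psi> k x - F (u x)))\<^sup>2 \<partial>\<mu>) \<le> 2 * ((\<epsilon> k)\<^sup>2 * (2 * Iu + 2 * eu k)) + 2 * (M\<^sup>2 * eu k)" .
    qed
    have "(\<lambda>k. 2 * ((\<epsilon> k)\<^sup>2 * (2 * Iu + 2 * eu k)) + 2 * (M\<^sup>2 * eu k)) \<longlonglongrightarrow> 2 * (0\<^sup>2 * (2 * Iu + 2 * 0)) + 2 * (M\<^sup>2 * 0)"
      by (intro tendsto_intros \<epsilon>0 e0)
    then show "(\<lambda>k. 2 * ((\<epsilon> k)\<^sup>2 * (2 * Iu + 2 * eu k)) + 2 * (M\<^sup>2 * eu k)) \<longlonglongrightarrow> 0" by simp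
  qed
  define R where "R = (\<lambda>k x. (F' (\<phi> k x) - F' (u x)) *\<^sub>R G x)"
  have R2M: "\<bar>F' (\<phi> k x) - F' (u x)\<bar> \<le> 2 * M" for k x using M[of "\<phi> k x"] M[of "u x"] by linarith
  have RL2: "L2 \<mu> (R k)" for k unfolding R_def by (rule L2_scale(1)[OF G _ R2M]) measurable
  have Rlim: "(\<lambda>k. \<integral>x. (norm (R k x))\<^sup>2 \<partial>\<mu>) \<longlonglongrightarrow> 0"
  proof -
    have "(\<lambda>k. \<integral>x. (norm (R k x))\<^sup>2 \<partial>\<mu>) \<longlonglongrightarrow> (\<integral>x. 0 \<partial>\<mu>)"
    proof (rule integral_dominated_convergence[where w="\<lambda>x. (2 * M)\<^sup>2 * (norm (G x))\<^sup>2"])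
      show "integrable \<mu> (\<lambda>x. (2 * M)\<^sup>2 * (norm (G x))\<^sup>2)" using L2D(2)[OF G] by simp
      show "(\<lambda>x. (norm (R k x))\<^sup>2) \<in> borel_measurable \<mu>" for k unfolding R_def by measurable
      show "AE x in \<mu>. norm ((norm (R k x))\<^sup>2) \<le> (2 * M)\<^sup>2 * (norm (G x))\<^sup>2" for k
      proof (rule AE_I2)
        fix x
        have "\<bar>F' (\<phi> k x) - F' (u x)\<bar>\<^sup>2 \<le> (2 * M)\<^sup>2" using R2M by (intro power_mono) auto
        then have "\<bar>F' (\<phi> k x) - F' (u x)\<bar>\<^sup>2 * (norm (G x))\<^sup>2 \<le> (2 * M)\<^sup>2 * (norm (G x))\<^sup>2" by (rule mult_right_mono) simp
        then show "norm ((norm (R k x))\<^sup>2) \<le> (2 * M)\<^sup>2 * (norm (G x))\<^sup>2" by (simp add: R_def power_mult_distrib)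
      qed
      show "AE x in \<mu>. (\<lambda>k. (norm (R k x))\<^sup>2) \<longlonglongrightarrow> 0"
        using ae
      proof eventually_elim
        fix x assume "(\<lambda>k. \<phi> k x) \<longlonglongrightarrow> u x"
        then have "(\<lambda>k. F' (\<phi> k x)) \<longlonglongrightarrow> F' (u x)"
          using F' by (intro isCont_tendsto_compose[of "u x" F']) (auto simp: continuous_on_eq_continuous_at)
        then have "(\<lambda>k. (norm ((F' (\<phi> k x) - F' (u x)) *\<^sub>R G x))\<^sup>2) \<longlonglongrightarrow> (norm ((F' (u x) - F' (u x)) *\<^sub>R G x))\<^sup>2"
          by (intro tendsto_intros)
        then show "(\<lambda>k. (norm (R k x))\<^sup>2) \<longlonglongrightarrow> 0" by (simp add: R_def)
      qed
    qed simp
    then show ?thesis by simp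
  qed
  have conv2: "(\<lambda>k. \<integral>x. (norm (X_gradient X (\<psi> k) x - F' (u x) *\<^sub>R G x))\<^sup>2 \<partial>\<mu>) \<longlonglongrightarrow> 0"
  proof (rule tendsto_sandwich[OF always_eventually always_eventually tendsto_const])
    show "\<forall>k. 0 \<le> (\<integral>x. (norm (X_gradient X (\<psi> k) x - F' (u x) *\<^sub>R G x))\<^sup>2 \<partial>\<mu>)" by simp
    show "\<forall>k. (\<integral>x. (norm (X_gradient X (\<psi> k) x - F' (u x) *\<^sub>R G x))\<^sup>2 \<partial>\<mu>)
      \<le> 2 * ((\<epsilon> k)\<^sup>2 * (2 * IG + 2 * eG k)) + 2 * (2 * (M\<^sup>2 * eG k) + 2 * (\<integral>x. (norm (R k x))\<^sup>2 \<partial>\<mu>))"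
    proof
      fix k
      note T = test_function_L2(2)[OF \<phi>[of k]]
      define a1 where "a1 = (\<lambda>x. (p k (\<phi> k x) - F' (\<phi> k x)) *\<^sub>R X_gradient X (\<phi> k) x)"
      define a2 where "a2 = (\<lambda>x. F' (\<phi> k x) *\<^sub>R (X_gradient X (\<phi> k) x - G x))"
      have pe: "\<bar>p k (\<phi> k x) - F' (\<phi> k x)\<bar> \<le> \<epsilon> k" for x using an(2)[of k x] by (simp add: p_def abs_minus_commute)
      have a1: "L2 \<mu> a1" "(\<integral>x. (norm (a1 x))\<^sup>2 \<partial>\<mu>) \<le> (\<epsilon> k)\<^sup>2 * (\<integral>x. (norm (X_gradient X (\<phi> k) x))\<^sup>2 \<partial>\<mu>)"
        unfolding a1_def by (rule L2_scale[OF T _ pe]; simp add: p_def; measurable)+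
      have a2: "L2 \<mu> a2" "(\<integral>x. (norm (a2 x))\<^sup>2 \<partial>\<mu>) \<le> M\<^sup>2 * eG k"
        unfolding a2_def eG_def by (rule L2_scale[OF L2_diff[OF T G] _ M]; measurable)+
      have eq: "X_gradient X (\<psi> k) x - F' (u x) *\<^sub>R G x = a1 x + (a2 x + R k x)" for x
        by (simp add: X\<psi> a1_def a2_def R_def algebra_simps)
      have "(\<integral>x. (norm (X_gradient X (\<psi> k) x - F' (u x) *\<^sub>R G x))\<^sup>2 \<partial>\<mu>) \<le> 2 * (\<integral>x. (norm (a1 x))\<^sup>2 \<partial>\<mu>) + 2 * (\<integral>x. (norm (a2 x + R k x))\<^sup>2 \<partial>\<mu>)"
        unfolding eq by (rule L2_add(2)[OF a1(1) L2_add(1)[OF a2(1) RL2]])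
      also have "\<dots> \<le> 2 * ((\<epsilon> k)\<^sup>2 * (2 * IG + 2 * eG k)) + 2 * (2 * (M\<^sup>2 * eG k) + 2 * (\<integral>x. (norm (R k x))\<^sup>2 \<partial>\<mu>))"
      proof (intro add_mono mult_left_mono)
        show "(\<integral>x. (norm (a1 x))\<^sup>2 \<partial>\<mu>) \<le> (\<epsilon> k)\<^sup>2 * (2 * IG + 2 * eG k)"
          using a1(2) mult_left_mono[OF nX\<phi>[of k], of "(\<epsilon> k)\<^sup>2"] by simp
        show "(\<integral>x. (norm (a2 x + R k x))\<^sup>2 \<partial>\<mu>) \<le> 2 * (M\<^sup>2 * eG k) + 2 * (\<integral>x. (norm (R k x))\<^sup>2 \<partial>\<mu>)"
          using L2_add(2)[OF a2(1) RL2[of k]] a2(2) by simp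
      qed auto
      finally show "(\<integral>x. (norm (X_gradient X (\<psi> k) x - F' (u x) *\<^sub>R G x))\<^sup>2 \<partial>\<mu>)
        \<le> 2 * ((\<epsilon> k)\<^sup>2 * (2 * IG + 2 * eG k)) + 2 * (2 * (M\<^sup>2 * eG k) + 2 * (\<integral>x. (norm (R k x))\<^sup>2 \<partial>\<mu>))" .
    qed
    have "(\<lambda>k. 2 * ((\<epsilon> k)\<^sup>2 * (2 * IG + 2 * eG k)) + 2 * (2 * (M\<^sup>2 * eG k) + 2 * (\<integral>x. (norm (R k x))\<^sup>2 \<partial>\<mu>)))
      \<longlonglongrightarrow> 2 * (0\<^sup>2 * (2 * IG + 2 * 0)) + 2 * (2 * (M\<^sup>2 * 0) + 2 * 0)"
      by (intro tendsto_intros \<epsilon>0 e0 Rlim)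
    then show "(\<lambda>k. 2 * ((\<epsilon> k)\<^sup>2 * (2 * IG + 2 * eG k)) + 2 * (2 * (M\<^sup>2 * eG k) + 2 * (\<integral>x. (norm (R k x))\<^sup>2 \<partial>\<mu>))) \<longlonglongrightarrow> 0"
      by simp
  qed
  show ?thesis unfolding W0_gradient_2_iff using FL2 GL2 \<psi> conv1 conv2 by blast
qed

end

section \<open>The estimate for solutions\<close>

text \<open>Young's inequality for the functions divided by their norms.\<close>
lemma holder_integral:
  fixes f g :: "'a \<Rightarrow> real"
  assumes pq: "p > 1" "q > 1" "1/p + 1/q = 1"
    and [measurable]: "f \<in> borel_measurable M" "g \<in> borel_measurable M"
    and f: "integrable M (\<lambda>x. \<bar>f x\<bar> powr p)" and g: "integrable M (\<lambda>x. \<bar>g x\<bar> powr q)"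
  shows "integrable M (\<lambda>x. f x * g x)"
    "(\<integral>x. \<bar>f x * g x\<bar> \<partial>M) \<le> (\<integral>x. \<bar>f x\<bar> powr p \<partial>M) powr (1/p) * (\<integral>x. \<bar>g x\<bar> powr q \<partial>M) powr (1/q)"
proof -
  have young: "\<bar>a * b\<bar> \<le> \<bar>a\<bar> powr p / p + \<bar>b\<bar> powr q / q" for a b :: real
    using Youngs_inequality[OF pq, of "\<bar>a\<bar>" "\<bar>b\<bar>"] by (simp add: abs_mult)
  have ipq: "integrable M (\<lambda>x. \<bar>f x\<bar> powr p / p + \<bar>g x\<bar> powr q / q)" using f g by simp
  show fg: "integrable M (\<lambda>x. f x * g x)"
    by (rule Bochner_Integration.integrable_bound[OF ipq]) (use young in \<open>auto intro: order_trans[OF _ abs_ge_self]\<close>)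
  define F where "F = (\<integral>x. \<bar>f x\<bar> powr p \<partial>M)"
  define H where "H = (\<integral>x. \<bar>g x\<bar> powr q \<partial>M)"
  have FH: "F \<ge> 0" "H \<ge> 0" by (simp_all add: F_def H_def)
  have "(\<integral>x. \<bar>f x * g x\<bar> \<partial>M) \<le> F powr (1/p) * H powr (1/q)"
  proof (cases "F = 0 \<or> H = 0")
    case True
    have "AE x in M. \<bar>f x * g x\<bar> = 0"
    proof (cases "F = 0")
      case True
      then have "AE x in M. \<bar>f x\<bar> powr p = 0"
        using integral_nonneg_eq_0_iff_AE[OF f] by (simp add: F_def)
      then show ?thesis by eventually_elim simp
    next
      case False
      then have "AE x in M. \<bar>g x\<bar> powr q = 0"
        using True integral_nonneg_eq_0_iff_AE[OF g] by (simp add: H_def)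
      then show ?thesis by eventually_elim simp
    qed
    then have "(\<integral>x. \<bar>f x * g x\<bar> \<partial>M) = 0" by (rule integral_eq_zero_AE)
    then show ?thesis by simp
  next
    case False
    then have pos: "F > 0" "H > 0" using FH by auto
    define a where "a = F powr (1/p)"
    define b where "b = H powr (1/q)"
    have ab: "a > 0" "b > 0" "a powr p = F" "b powr q = H" using pos pq by (simp_all add: a_def b_def powr_powr)
    have "(\<integral>x. \<bar>f x * g x\<bar> \<partial>M) \<le> (\<integral>x. (a * b) * (\<bar>f x\<bar> powr p / (p * F) + \<bar>g x\<bar> powr q / (q * H)) \<partial>M)"
    proof (rule integral_mono)
      show "integrable M (\<lambda>x. \<bar>f x * g x\<bar>)" using fg by simp
      show "integrable M (\<lambda>x. (a * b) * (\<bar>f x\<bar> powr p / (p * F) + \<bar>g x\<bar> powr q / (q * H)))" using f g by simp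
      fix x
      have "\<bar>f x * g x\<bar> = (a * b) * \<bar>(f x / a) * (g x / b)\<bar>" using ab by (simp add: abs_mult)
      also have "\<dots> \<le> (a * b) * (\<bar>f x / a\<bar> powr p / p + \<bar>g x / b\<bar> powr q / q)"
        using ab by (intro mult_left_mono young) auto
      also have "\<bar>f x / a\<bar> powr p / p = \<bar>f x\<bar> powr p / (p * F)"
        using ab by (simp add: powr_divide mult.commute)
      also have "\<bar>g x / b\<bar> powr q / q = \<bar>g x\<bar> powr q / (q * H)"
        using ab by (simp add: powr_divide mult.commute)
      finally show "\<bar>f x * g x\<bar> \<le> (a * b) * (\<bar>f x\<bar> powr p / (p * F) + \<bar>g x\<bar> powr q / (q * H))" .
    qed
    also have "\<dots> = (a * b) * (F / (p * F) + H / (q * H))" using f g by (simp add: F_def H_def)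
    also have "\<dots> = a * b" using pos pq by simp
    finally show ?thesis by (simp add: a_def b_def)
  qed
  then show "(\<integral>x. \<bar>f x * g x\<bar> \<partial>M) \<le> (\<integral>x. \<bar>f x\<bar> powr p \<partial>M) powr (1/p) * (\<integral>x. \<bar>g x\<bar> powr q \<partial>M) powr (1/q)"
    by (simp add: F_def H_def)
qed

definition signed_power :: "real \<Rightarrow> real \<Rightarrow> real" where
  "signed_power a t = sgn t * \<bar>t\<bar> powr a"

text \<open>The case distinction is needed because \<open>0 powr 0 = 0\<close>.\<close>
definition signed_power_deriv :: "real \<Rightarrow> real \<Rightarrow> real" where
  "signed_power_deriv a t = (if a = 1 then 1 else a * \<bar>t\<bar> powr (a - 1))"

lemma abs_signed_power: "\<bar>signed_power a t\<bar> = \<bar>t\<bar> powr a"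
  by (cases "t = 0") (simp_all add: signed_power_def abs_mult abs_sgn_eq)

lemma has_derivative_signed_power:
  assumes "a \<ge> 1"
  shows "(signed_power a has_real_derivative signed_power_deriv a t) (at t)"
proof (cases "a = 1")
  case True
  have "signed_power 1 = (\<lambda>t. t)" by (auto simp: signed_power_def fun_eq_iff sgn_if)
  then show ?thesis using True by (simp add: signed_power_deriv_def)
next
  case False
  then have "a > 1" using assms by simp
  consider "t > 0" | "t < 0" | "t = 0" by linarith
  then show ?thesis
  proof cases
    case 1
    have "((\<lambda>t. t powr a) has_real_derivative a * t powr (a - 1)) (at t)"
      using 1 by (rule has_real_derivative_powr)
    then have "(signed_power a has_real_derivative a * t powr (a - 1)) (at t)"
      by (rule has_field_derivative_transform_within_open[of _ _ _ "{0<..}"]) (use 1 in \<open>auto simp: signed_power_def\<close>)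
    then show ?thesis using 1 False by (simp add: signed_power_deriv_def)
  next
    case 2
    have "((\<lambda>t. - ((- t) powr a)) has_real_derivative a * (- t) powr (a - 1)) (at t)"
      using 2 by (auto intro!: derivative_eq_intros)
    then have "(signed_power a has_real_derivative a * (- t) powr (a - 1)) (at t)"
      by (rule has_field_derivative_transform_within_open[of _ _ _ "{..<0}"]) (use 2 in \<open>auto simp: signed_power_def\<close>)
    then show ?thesis using 2 False by (simp add: signed_power_deriv_def)
  next
    case 3
    have "(\<lambda>h::real. (signed_power a h - signed_power a 0) / (h - 0)) \<midarrow>0\<rightarrow> 0"
    proof (rule Lim_null_comparison)
      show "\<forall>\<^sub>F h in at 0. norm ((signed_power a h - signed_power a 0) / (h - 0)) \<le> \<bar>h\<bar> powr (a - 1)"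
      proof (intro always_eventually allI)
        fix h :: real
        show "norm ((signed_power a h - signed_power a 0) / (h - 0)) \<le> \<bar>h\<bar> powr (a - 1)"
        proof (cases "h = 0")
          case False
          have "norm ((signed_power a h - signed_power a 0) / (h - 0)) = \<bar>h\<bar> powr a / \<bar>h\<bar>"
            by (simp add: abs_signed_power) (simp add: signed_power_def abs_mult abs_sgn_eq False)
          also have "\<dots> = \<bar>h\<bar> powr (a - 1)" using False by (simp add: powr_diff)
          finally show ?thesis by simp
        qed simp
      qed
      have "((\<lambda>h::real. \<bar>h\<bar> powr (a - 1)) \<longlongrightarrow> \<bar>0\<bar> powr (a - 1)) (at 0)"
        using \<open>a > 1\<close> by (intro tendsto_powr2 tendsto_rabs tendsto_ident_at tendsto_const) auto
      then show "(\<lambda>h::real. \<bar>h\<bar> powr (a - 1)) \<midarrow>0\<rightarrow> 0" using \<open>a > 1\<close> by simp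
    qed
    then show ?thesis using 3 False \<open>a > 1\<close> by (simp add: has_field_derivative_iff signed_power_deriv_def)
  qed
qed

lemma continuous_on_signed_power_deriv:
  assumes "a \<ge> 1" shows "continuous_on UNIV (signed_power_deriv a)"
proof (cases "a = 1")
  case True
  then have "signed_power_deriv a = (\<lambda>_. 1)" by (auto simp: signed_power_deriv_def)
  then show ?thesis by simp
next
  case False
  then have "signed_power_deriv a = (\<lambda>t. a * \<bar>t\<bar> powr (a - 1))" by (auto simp: signed_power_deriv_def)
  then show ?thesis using False assms by (auto intro!: continuous_intros continuous_on_powr')
qed

text \<open>A bounded smooth substitute for truncation at height \<open>n\<close>, with slope between \<open>0\<close> and \<open>1\<close>.\<close>
definition soft_truncation :: "real \<Rightarrow> real \<Rightarrow> real" where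
  "soft_truncation n t = n * arctan (t / n)"

lemma soft_truncation_derivative:
  assumes "n > 0"
  shows "(soft_truncation n has_real_derivative 1 / (1 + (t / n)\<^sup>2)) (at t)"
  unfolding soft_truncation_def using assms
  by (auto intro!: derivative_eq_intros simp: divide_inverse)

lemma soft_truncation_slope: "0 < 1 / (1 + (t / n)\<^sup>2)" "1 / (1 + (t / n)\<^sup>2) \<le> (1::real)"
proof -
  have "1 + (t / n)\<^sup>2 \<ge> 1" by simp
  then show "0 < 1 / (1 + (t / n)\<^sup>2)" "1 / (1 + (t / n)\<^sup>2) \<le> (1::real)" by (simp_all add: add_pos_nonneg)
qed

lemma abs_soft_truncation_le: "n > 0 \<Longrightarrow> \<bar>soft_truncation n t\<bar> \<le> 2 * n"
proof -
  assume "n > 0"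
  have "\<bar>arctan (t / n)\<bar> \<le> 2" using arctan_bounded[of "t / n"] pi_less_4 by linarith
  then show ?thesis using \<open>n > 0\<close> by (simp add: soft_truncation_def abs_mult)
qed

lemma soft_truncation_tendsto: "(\<lambda>k. soft_truncation (real (Suc k)) t) \<longlonglongrightarrow> t"
proof (cases "t = 0")
  case False
  have "(arctan has_real_derivative 1) (at 0)" using DERIV_arctan[of 0] by simp
  then have lim: "(\<lambda>h. arctan h / h) \<midarrow>0\<rightarrow> 1" by (simp add: has_field_derivative_iff)
  have "(\<lambda>k. t * (1 / real (Suc k))) \<longlonglongrightarrow> t * 0"
    using LIMSEQ_inverse_real_of_nat by (intro tendsto_intros) (simp add: inverse_eq_divide)
  then have "filterlim (\<lambda>k. t / real (Suc k)) (at 0) sequentially"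
    using False by (auto simp: filterlim_at intro!: always_eventually)
  from filterlim_compose[OF lim this]
  have "(\<lambda>k. t * (arctan (t / real (Suc k)) / (t / real (Suc k)))) \<longlonglongrightarrow> t * 1" by (intro tendsto_intros)
  then show ?thesis using False by (simp add: soft_truncation_def mult.commute)
qed (simp add: soft_truncation_def)

lemma truncated_power_properties:
  assumes "a \<ge> 1" "n > 0"
  defines "F \<equiv> \<lambda>t. signed_power a (soft_truncation n t)"
    and "F' \<equiv> \<lambda>t. signed_power_deriv a (soft_truncation n t) * (1 / (1 + (t / n)\<^sup>2))"
  shows "(F has_real_derivative F' t) (at t)" "continuous_on UNIV F'" "F 0 = 0"
    "0 \<le> F' t" "\<bar>F' t\<bar> \<le> a * (2 * n) powr (a - 1)"
proof -
  show "(F has_real_derivative F' t) (at t)"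
    unfolding F_def F'_def
    by (rule DERIV_chain2[OF has_derivative_signed_power[OF assms(1)] soft_truncation_derivative[OF assms(2)]])
  have "1 + (t / n)\<^sup>2 \<noteq> 0" for t using soft_truncation_slope(1)[of t n] by auto
  moreover have "continuous_on UNIV (soft_truncation n)"
    using soft_truncation_derivative[OF assms(2)] by (meson DERIV_continuous continuous_at_imp_continuous_on)
  ultimately show "continuous_on UNIV F'"
    unfolding F'_def using \<open>n > 0\<close>
    by (intro continuous_intros continuous_on_compose2[OF continuous_on_signed_power_deriv[OF assms(1)]]) auto
  show "F 0 = 0" by (simp add: F_def signed_power_def soft_truncation_def)
  have d: "0 \<le> signed_power_deriv a s" for s using assms(1) by (simp add: signed_power_deriv_def)
  then show F0: "0 \<le> F' t" unfolding F'_def using soft_truncation_slope(1)[of t n] by (intro mult_nonneg_nonneg) auto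
  have "signed_power_deriv a (soft_truncation n t) \<le> a * (2 * n) powr (a - 1)"
    using assms(1,2) abs_soft_truncation_le[OF assms(2), of t]
    by (auto simp: signed_power_deriv_def intro!: powr_mono2)
  then have "F' t \<le> (a * (2 * n) powr (a - 1)) * 1"
    unfolding F'_def using soft_truncation_slope[of t n] assms d by (intro mult_mono) auto
  then show "\<bar>F' t\<bar> \<le> a * (2 * n) powr (a - 1)" using F0 by simp
qed

text \<open>With \<open>\<Phi>\<close> and \<open>\<Psi>\<close> the truncated powers of exponents \<open>s\<close> and \<open>2 s - 1\<close>, this says
  \<open>(\<Phi>')\<^sup>2 \<le> s\<^sup>2 / (2 s - 1) \<Psi>'\<close>: the energy of \<open>\<Phi>(u)\<close> is what testing with \<open>\<Psi>(u)\<close> controls.\<close>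
lemma truncated_power_energy:
  assumes "s \<ge> 1"
  shows "(signed_power_deriv s (soft_truncation n t) * (1 / (1 + (t / n)\<^sup>2)))\<^sup>2
    \<le> s\<^sup>2 / (2 * s - 1) * (signed_power_deriv (2 * s - 1) (soft_truncation n t) * (1 / (1 + (t / n)\<^sup>2)))"
proof -
  define y where "y = soft_truncation n t"
  define m where "m = 1 / (1 + (t / n)\<^sup>2)"
  have m: "0 < m" "m \<le> 1" using soft_truncation_slope[of t n] by (auto simp: m_def)
  have eq: "(signed_power_deriv s y)\<^sup>2 = s\<^sup>2 / (2 * s - 1) * signed_power_deriv (2 * s - 1) y"
  proof (cases "s = 1")
    case False
    have "(\<bar>y\<bar> powr (s - 1))\<^sup>2 = \<bar>y\<bar> powr (2 * s - 1 - 1)"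
      by (simp add: power2_eq_square algebra_simps flip: powr_add)
    then show ?thesis using False assms by (simp add: signed_power_deriv_def power_mult_distrib)
  qed (simp add: signed_power_deriv_def)
  have "m\<^sup>2 \<le> m" using m by (simp add: power2_eq_square mult_left_le)
  then have "(signed_power_deriv s y)\<^sup>2 * m\<^sup>2 \<le> (signed_power_deriv s y)\<^sup>2 * m" by (intro mult_left_mono) auto
  then show ?thesis unfolding y_def[symmetric] m_def[symmetric] eq by (simp add: power_mult_distrib eq mult.assoc)
qed

lemma elliptic_form_measurable:
  fixes A :: "'a \<Rightarrow> real^'m^'m" and G H :: "'a \<Rightarrow> real^'m"
  assumes "A \<in> borel_measurable M" and "G \<in> borel_measurable M" and "H \<in> borel_measurable M"
  shows "(\<lambda>x. (A x *v G x) \<bullet> H x) \<in> borel_measurable M"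
proof -
  have "(\<lambda>x. A x *v G x) \<in> borel_measurable M"
    by (rule borel_measurable_continuous_Pair[OF assms(1,2)])
       (unfold matrix_vector_mult_def, intro continuous_intros)
  then show ?thesis using assms(3) by measurable
qed

context cc_space begin

text \<open>Here \<open>Y\<close> is the integral of the truncated \<open>|u| powr r\<close> and \<open>Z\<close> the energy. Testing the equation gives
  \<open>\<alpha> Z \<le> N Y powr (1/q)\<close>, the Sobolev inequality gives \<open>Y powr (1/t) \<le> const Z\<close>, and
  \<open>1/t - 1/q = 1/r\<close>, so that \<open>Y powr (1/r) \<le> C N\<close> with a constant that does not depend on the
  truncation.\<close>
theorem solution_bound:
  fixes p \<alpha> :: real
  assumes p: "2 * Q / (Q + 2) \<le> p" "p < Q / 2" and "\<alpha> > 0"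
  obtains C where "C > 0"
    "\<And>\<beta> A f u. \<lbrakk>elliptic_coefficients \<Omega> \<alpha> \<beta> A; f \<in> Lp_on \<Omega> p; weak_solution X \<Omega> A f u\<rbrakk> \<Longrightarrow>
      u \<in> Lp_on \<Omega> (p * Q / (Q - 2 * p)) \<and> Lp_norm \<Omega> (p * Q / (Q - 2 * p)) u \<le> C * Lp_norm \<Omega> p f"
proof -
  obtain S where S: "S > 0"
    "\<And>u G. W0_gradient X \<Omega> 2 u G \<Longrightarrow> (\<integral>\<^sup>+x. ennreal (\<bar>u x\<bar> powr (2 * Q / (Q - 2))) \<partial>\<mu>)
       \<le> ennreal (S * (\<integral>x. (norm (G x))\<^sup>2 \<partial>\<mu>) powr (Q / (Q - 2)))"
    using sobolev_W0 by blast
  interpret finite_measure \<mu> by (rule finite_measure_domain)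
  have Q: "Q > 2" by (rule dimension_gt_2)
  have "1 < 2 * Q / (Q + 2)" using Q by (simp add: field_simps)
  then have "p > 1" using p by simp
  have d: "Q - 2 * p > 0" using p by simp
  define r where "r = p * Q / (Q - 2 * p)"
  define s where "s = p * (Q - 2) / (2 * (Q - 2 * p))"
  define q where "q = p / (p - 1)"
  define t where "t = Q / (Q - 2)"
  have "t > 0" using Q by (simp add: t_def)
  have "r > 0" using \<open>p > 1\<close> Q d by (simp add: r_def)
  have "s \<ge> 1"
  proof -
    have "2 * Q \<le> p * (Q + 2)" using p(1) Q by (simp add: field_simps)
    then have "2 * (Q - 2 * p) \<le> p * (Q - 2)" by (simp add: algebra_simps)
    then show ?thesis using d by (simp add: s_def)
  qed
  then have s2: "2 * s - 1 \<ge> 1" by simp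
  have q: "q > 1" "1/p + 1/q = 1" using \<open>p > 1\<close> by (auto simp: q_def field_simps)
  have sr: "s * (2 * Q / (Q - 2)) = r"
  proof -
    have *: "p * a / (2 * b) * (2 * Q / a) = p * Q / b" if "a \<noteq> 0" "b \<noteq> 0" for a b
      using that by (simp add: field_simps)
    show ?thesis unfolding s_def r_def by (rule *) (use Q d in auto)
  qed
  have sq: "(2 * s - 1) * q = r"
  proof -
    have "2 * s - 1 = Q * (p - 1) / (Q - 2 * p)" using d by (simp add: s_def field_simps)
    then show ?thesis using \<open>p > 1\<close> by (simp add: q_def r_def)
  qed
  have tq: "1/t - 1/q = 1/r"
    using Q d \<open>p > 1\<close> by (simp add: t_def q_def r_def field_simps)
  define k where "k = s\<^sup>2 / (2 * s - 1)"
  have "k > 0" using \<open>s \<ge> 1\<close> by (simp add: k_def)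
  define C where "C = S powr (1/t) * (k / \<alpha>)"
  have "C > 0" using S \<open>k > 0\<close> \<open>\<alpha> > 0\<close> by (simp add: C_def)
  moreover have "u \<in> Lp_on \<Omega> r \<and> Lp_norm \<Omega> r u \<le> C * Lp_norm \<Omega> p f"
    if A: "elliptic_coefficients \<Omega> \<alpha> \<beta> A" and f: "f \<in> Lp_on \<Omega> p" and u: "weak_solution X \<Omega> A f u" for \<beta> A f u
  proof -
    obtain G where W: "W0_gradient X \<Omega> 2 u G" and weak: "\<And>v H. W0_gradient X \<Omega> 2 v H \<Longrightarrow>
      (LINT x|\<mu>. (A x *v G x) \<bullet> H x) = (LINT x|\<mu>. f x * v x)"
      using u unfolding weak_solution_def by blast
    have Am: "A \<in> borel_measurable \<mu>" and ell: "\<And>x \<eta>. x \<in> \<Omega> \<Longrightarrow> \<alpha> * (norm \<eta>)\<^sup>2 \<le> (A x *v \<eta>) \<bullet> \<eta>"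
      "\<And>x \<eta>. x \<in> \<Omega> \<Longrightarrow> (A x *v \<eta>) \<bullet> \<eta> \<le> \<beta> * (norm \<eta>)\<^sup>2"
      using A unfolding elliptic_coefficients_def by auto
    have uL2: "L2 \<mu> u" and GL2: "L2 \<mu> G" using W unfolding W0_gradient_2_iff by auto
    have fm: "f \<in> borel_measurable \<mu>" and fi: "integrable \<mu> (\<lambda>x. \<bar>f x\<bar> powr p)"
      using f by (auto simp: Lp_on_def)
    note [measurable] = L2D(1)[OF uL2] L2D(1)[OF GL2] fm
    define N where "N = Lp_norm \<Omega> p f"
    have "N \<ge> 0" by (simp add: N_def Lp_norm_def)
    have bound: "(\<integral>x. \<bar>soft_truncation n (u x)\<bar> powr r \<partial>\<mu>) \<le> (C * N) powr r"
        "integrable \<mu> (\<lambda>x. \<bar>soft_truncation n (u x)\<bar> powr r)" if "n > 0" for n :: real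
    proof -
      define \<Phi> where "\<Phi> = (\<lambda>t. signed_power s (soft_truncation n t))"
      define \<Phi>' where "\<Phi>' = (\<lambda>t. signed_power_deriv s (soft_truncation n t) * (1 / (1 + (t / n)\<^sup>2)))"
      define \<Psi> where "\<Psi> = (\<lambda>t. signed_power (2 * s - 1) (soft_truncation n t))"
      define \<Psi>' where "\<Psi>' = (\<lambda>t. signed_power_deriv (2 * s - 1) (soft_truncation n t) * (1 / (1 + (t / n)\<^sup>2)))"
      have P\<Phi>: "(\<Phi> has_real_derivative \<Phi>' y) (at y)" "continuous_on UNIV \<Phi>'" "\<Phi> 0 = 0"
          "0 \<le> \<Phi>' y" "\<bar>\<Phi>' y\<bar> \<le> s * (2 * n) powr (s - 1)" for y
        unfolding \<Phi>_def \<Phi>'_def by (rule truncated_power_properties[OF \<open>s \<ge> 1\<close> \<open>n > 0\<close>])+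
      have P\<Psi>: "(\<Psi> has_real_derivative \<Psi>' y) (at y)" "continuous_on UNIV \<Psi>'" "\<Psi> 0 = 0"
          "0 \<le> \<Psi>' y" "\<bar>\<Psi>' y\<bar> \<le> (2 * s - 1) * (2 * n) powr (2 * s - 1 - 1)" for y
        unfolding \<Psi>_def \<Psi>'_def by (rule truncated_power_properties[OF s2 \<open>n > 0\<close>])+
      have W\<Phi>: "W0_gradient X \<Omega> 2 (\<lambda>x. \<Phi> (u x)) (\<lambda>x. \<Phi>' (u x) *\<^sub>R G x)"
        by (rule W0_gradient_chain_rule[OF W P\<Phi>(1,2,3,5)])
      have W\<Psi>: "W0_gradient X \<Omega> 2 (\<lambda>x. \<Psi> (u x)) (\<lambda>x. \<Psi>' (u x) *\<^sub>R G x)"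
        by (rule W0_gradient_chain_rule[OF W P\<Psi>(1,2,3,5)])
      have [measurable]: "soft_truncation n \<in> borel_measurable borel"
        using soft_truncation_derivative[OF \<open>n > 0\<close>]
        by (intro borel_measurable_continuous_onI) (meson DERIV_continuous continuous_at_imp_continuous_on)
      have [measurable]: "\<Psi> \<in> borel_measurable borel"
        using P\<Psi>(1) by (intro borel_measurable_continuous_onI) (meson DERIV_continuous continuous_at_imp_continuous_on)
      have [measurable]: "\<Psi>' \<in> borel_measurable borel" "\<Phi>' \<in> borel_measurable borel"
        using P\<Psi>(2) P\<Phi>(2) by (auto intro: borel_measurable_continuous_onI)
      define Y where "Y = (\<integral>x. \<bar>soft_truncation n (u x)\<bar> powr r \<partial>\<mu>)"
      have "Y \<ge> 0" by (simp add: Y_def)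
      show iY: "integrable \<mu> (\<lambda>x. \<bar>soft_truncation n (u x)\<bar> powr r)"
      proof (rule integrable_const_bound[where B="(2 * n) powr r"])
        show "AE x in \<mu>. norm (\<bar>soft_truncation n (u x)\<bar> powr r) \<le> (2 * n) powr r"
          using abs_soft_truncation_le[OF \<open>n > 0\<close>] \<open>r > 0\<close> by (auto intro!: powr_mono2)
      qed measurable
      define Z where "Z = (\<integral>x. \<Psi>' (u x) * (norm (G x))\<^sup>2 \<partial>\<mu>)"
      have "Z \<ge> 0" unfolding Z_def using P\<Psi>(4) by simp
      define b where "b = (2 * s - 1) * (2 * n) powr (2 * s - 1 - 1)"
      have \<Psi>b: "\<Psi>' y \<le> b" for y using P\<Psi>(5)[of y] unfolding b_def by linarith
      have iZ: "integrable \<mu> (\<lambda>x. \<Psi>' (u x) * (norm (G x))\<^sup>2)"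
      proof (rule Bochner_Integration.integrable_bound)
        show "integrable \<mu> (\<lambda>x. b * (norm (G x))\<^sup>2)" using L2D(2)[OF GL2] by simp
        show "AE x in \<mu>. norm (\<Psi>' (u x) * (norm (G x))\<^sup>2) \<le> norm (b * (norm (G x))\<^sup>2)"
          using \<Psi>b P\<Psi>(4) by (auto simp: abs_mult intro!: mult_right_mono order_trans[OF _ abs_ge_self])
      qed measurable
      have step1: "\<alpha> * Z \<le> N * Y powr (1/q)"
      proof -
        have form: "(A x *v G x) \<bullet> (\<Psi>' (u x) *\<^sub>R G x) = \<Psi>' (u x) * ((A x *v G x) \<bullet> G x)" for x by simp
        have lower: "\<alpha> * (\<Psi>' (u x) * (norm (G x))\<^sup>2) \<le> \<Psi>' (u x) * ((A x *v G x) \<bullet> G x)" if "x \<in> \<Omega>" for x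
          using mult_left_mono[OF ell(1)[OF that] P\<Psi>(4)] by (simp add: mult_ac)
        have upper: "\<Psi>' (u x) * ((A x *v G x) \<bullet> G x) \<le> \<beta> * (\<Psi>' (u x) * (norm (G x))\<^sup>2)" if "x \<in> \<Omega>" for x
          using mult_left_mono[OF ell(2)[OF that] P\<Psi>(4)] by (simp add: mult_ac)
        have iA: "integrable \<mu> (\<lambda>x. \<Psi>' (u x) * ((A x *v G x) \<bullet> G x))"
        proof (rule Bochner_Integration.integrable_bound)
          show "integrable \<mu> (\<lambda>x. \<beta> * (\<Psi>' (u x) * (norm (G x))\<^sup>2))" using iZ by simp
          show "(\<lambda>x. \<Psi>' (u x) * ((A x *v G x) \<bullet> G x)) \<in> borel_measurable \<mu>"
            using elliptic_form_measurable[OF Am L2D(1)[OF GL2] L2D(1)[OF GL2]] by measurable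
          show "AE x in \<mu>. norm (\<Psi>' (u x) * ((A x *v G x) \<bullet> G x)) \<le> norm (\<beta> * (\<Psi>' (u x) * (norm (G x))\<^sup>2))"
          proof (rule AE_I2)
            fix x assume "x \<in> space \<mu>"
            then have x: "x \<in> \<Omega>" by simp
            have "0 \<le> \<alpha> * (\<Psi>' (u x) * (norm (G x))\<^sup>2)" using \<open>\<alpha> > 0\<close> P\<Psi>(4) by simp
            then show "norm (\<Psi>' (u x) * ((A x *v G x) \<bullet> G x)) \<le> norm (\<beta> * (\<Psi>' (u x) * (norm (G x))\<^sup>2))"
              using lower[OF x] upper[OF x] unfolding real_norm_def by linarith
          qed
        qed
        have "\<alpha> * Z = (\<integral>x. \<alpha> * (\<Psi>' (u x) * (norm (G x))\<^sup>2) \<partial>\<mu>)" by (simp add: Z_def)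
        also have "\<dots> \<le> (\<integral>x. \<Psi>' (u x) * ((A x *v G x) \<bullet> G x) \<partial>\<mu>)"
          using iZ iA lower by (intro integral_mono) auto
        also have "\<dots> = (\<integral>x. f x * \<Psi> (u x) \<partial>\<mu>)" using weak[OF W\<Psi>] unfolding form .
        also have "\<dots> \<le> (\<integral>x. \<bar>f x * \<Psi> (u x)\<bar> \<partial>\<mu>)"
          using integral_abs_bound[of \<mu> "\<lambda>x. f x * \<Psi> (u x)"] by linarith
        also have "\<dots> \<le> (\<integral>x. \<bar>f x\<bar> powr p \<partial>\<mu>) powr (1/p) * (\<integral>x. \<bar>\<Psi> (u x)\<bar> powr q \<partial>\<mu>) powr (1/q)"
        proof (rule holder_integral(2)[OF \<open>p > 1\<close> q _ _ fi])
          show "integrable \<mu> (\<lambda>x. \<bar>\<Psi> (u x)\<bar> powr q)"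
            using iY by (simp add: \<Psi>_def abs_signed_power powr_powr sq)
        qed measurable
        also have "(\<integral>x. \<bar>\<Psi> (u x)\<bar> powr q \<partial>\<mu>) = Y"
          by (simp add: \<Psi>_def abs_signed_power powr_powr sq Y_def)
        also have "(\<integral>x. \<bar>f x\<bar> powr p \<partial>\<mu>) powr (1/p) = N" by (simp add: N_def Lp_norm_def)
        finally show ?thesis .
      qed
      have step2: "Y \<le> S * (k * Z) powr t"
      proof -
        have "ennreal Y = (\<integral>\<^sup>+x. ennreal (\<bar>soft_truncation n (u x)\<bar> powr r) \<partial>\<mu>)"
          unfolding Y_def by (rule nn_integral_eq_integral[symmetric, OF iY]) simp
        also have "\<dots> = (\<integral>\<^sup>+x. ennreal (\<bar>\<Phi> (u x)\<bar> powr (2 * Q / (Q - 2))) \<partial>\<mu>)"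
          by (simp only: \<Phi>_def abs_signed_power powr_powr sr)
        also have "\<dots> \<le> ennreal (S * (\<integral>x. (norm (\<Phi>' (u x) *\<^sub>R G x))\<^sup>2 \<partial>\<mu>) powr t)"
          unfolding t_def by (rule S(2)[OF W\<Phi>])
        finally have "Y \<le> S * (\<integral>x. (norm (\<Phi>' (u x) *\<^sub>R G x))\<^sup>2 \<partial>\<mu>) powr t"
          using S(1) by simp
        also have "\<dots> \<le> S * (k * Z) powr t"
        proof (intro mult_left_mono powr_mono2)
          have "L2 \<mu> (\<lambda>x. \<Phi>' (u x) *\<^sub>R G x)" using W\<Phi> unfolding W0_gradient_2_iff by blast
          then have "(\<integral>x. (norm (\<Phi>' (u x) *\<^sub>R G x))\<^sup>2 \<partial>\<mu>) \<le> (\<integral>x. k * (\<Psi>' (u x) * (norm (G x))\<^sup>2) \<partial>\<mu>)"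
          proof (rule integral_mono[OF L2D(2)])
            show "integrable \<mu> (\<lambda>x. k * (\<Psi>' (u x) * (norm (G x))\<^sup>2))" using iZ by simp
            fix x
            have "(\<Phi>' (u x))\<^sup>2 \<le> k * \<Psi>' (u x)"
              unfolding \<Phi>'_def \<Psi>'_def k_def by (rule truncated_power_energy[OF \<open>s \<ge> 1\<close>])
            then have "(\<Phi>' (u x))\<^sup>2 * (norm (G x))\<^sup>2 \<le> (k * \<Psi>' (u x)) * (norm (G x))\<^sup>2" by (rule mult_right_mono) simp
            then show "(norm (\<Phi>' (u x) *\<^sub>R G x))\<^sup>2 \<le> k * (\<Psi>' (u x) * (norm (G x))\<^sup>2)"
              by (simp add: power_mult_distrib mult.assoc)
          qed
          then show "(\<integral>x. (norm (\<Phi>' (u x) *\<^sub>R G x))\<^sup>2 \<partial>\<mu>) \<le> k * Z" by (simp add: Z_def)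
        qed (use S \<open>t > 0\<close> in auto)
        finally show ?thesis .
      qed
      have "Y \<le> (C * N) powr r"
      proof (cases "Y = 0")
        case False
        then have "Y > 0" using \<open>Y \<ge> 0\<close> by simp
        have "Z \<le> N * Y powr (1/q) / \<alpha>" using step1 \<open>\<alpha> > 0\<close> by (simp add: field_simps)
        then have "k * Z \<le> k * (N * Y powr (1/q) / \<alpha>)" using \<open>k > 0\<close> by (intro mult_left_mono) auto
        have "Y powr (1/t) \<le> (S * (k * Z) powr t) powr (1/t)"
          using step2 \<open>Y > 0\<close> \<open>t > 0\<close> by (intro powr_mono2) auto
        also have "\<dots> = S powr (1/t) * (k * Z)"
          using S(1) \<open>k > 0\<close> \<open>Z \<ge> 0\<close> \<open>t > 0\<close> by (simp add: powr_mult powr_powr)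
        also have "\<dots> \<le> S powr (1/t) * (k * (N * Y powr (1/q) / \<alpha>))"
          using \<open>k * Z \<le> k * (N * Y powr (1/q) / \<alpha>)\<close> by (rule mult_left_mono) simp
        also have "\<dots> = (C * N) * Y powr (1/q)" by (simp add: C_def)
        finally have "Y powr (1/t) / Y powr (1/q) \<le> C * N" using \<open>Y > 0\<close> by (simp add: field_simps)
        then have "Y powr (1/r) \<le> C * N" using \<open>Y > 0\<close> by (simp add: powr_diff flip: tq)
        then have "(Y powr (1/r)) powr r \<le> (C * N) powr r" using \<open>r > 0\<close> by (intro powr_mono2) auto
        then show ?thesis using \<open>Y > 0\<close> \<open>r > 0\<close> by (simp add: powr_powr)
      qed simp
      then show "(\<integral>x. \<bar>soft_truncation n (u x)\<bar> powr r \<partial>\<mu>) \<le> (C * N) powr r" by (simp add: Y_def)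
    qed
    have st_meas: "soft_truncation (real (Suc k)) \<in> borel_measurable borel" for k
      using soft_truncation_derivative[of "real (Suc k)"]
      by (intro borel_measurable_continuous_onI) (meson DERIV_continuous continuous_at_imp_continuous_on of_nat_0_less_iff zero_less_Suc)
    have "(\<integral>\<^sup>+x. ennreal (\<bar>u x\<bar> powr r) \<partial>\<mu>)
       = (\<integral>\<^sup>+x. liminf (\<lambda>k. ennreal (\<bar>soft_truncation (real (Suc k)) (u x)\<bar> powr r)) \<partial>\<mu>)"
    proof (rule nn_integral_cong)
      fix x
      have "(\<lambda>k. ennreal (\<bar>soft_truncation (real (Suc k)) (u x)\<bar> powr r)) \<longlonglongrightarrow> ennreal (\<bar>u x\<bar> powr r)"
        using \<open>r > 0\<close> by (intro tendsto_ennrealI tendsto_powr2 tendsto_rabs soft_truncation_tendsto) auto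
      then show "ennreal (\<bar>u x\<bar> powr r) = liminf (\<lambda>k. ennreal (\<bar>soft_truncation (real (Suc k)) (u x)\<bar> powr r))"
        by (intro lim_imp_Liminf[symmetric]) auto
    qed
    also have "\<dots> \<le> liminf (\<lambda>k. \<integral>\<^sup>+x. ennreal (\<bar>soft_truncation (real (Suc k)) (u x)\<bar> powr r) \<partial>\<mu>)"
    proof (rule nn_integral_liminf)
      fix k
      have [measurable]: "(\<lambda>x. soft_truncation (real (Suc k)) (u x)) \<in> borel_measurable \<mu>"
        by (rule measurable_compose[OF L2D(1)[OF uL2] st_meas])
      show "(\<lambda>x. ennreal (\<bar>soft_truncation (real (Suc k)) (u x)\<bar> powr r)) \<in> borel_measurable \<mu>" by measurable
    qed
    also have "\<dots> \<le> liminf (\<lambda>k::nat. ennreal ((C * N) powr r))"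
    proof (intro Liminf_mono always_eventually allI)
      fix k
      have "(\<integral>\<^sup>+x. ennreal (\<bar>soft_truncation (real (Suc k)) (u x)\<bar> powr r) \<partial>\<mu>)
         = ennreal (\<integral>x. \<bar>soft_truncation (real (Suc k)) (u x)\<bar> powr r \<partial>\<mu>)"
        by (rule nn_integral_eq_integral[OF bound(2)]) auto
      also have "\<dots> \<le> ennreal ((C * N) powr r)" by (intro ennreal_leI bound(1)) simp
      finally show "(\<integral>\<^sup>+x. ennreal (\<bar>soft_truncation (real (Suc k)) (u x)\<bar> powr r) \<partial>\<mu>) \<le> ennreal ((C * N) powr r)" .
    qed
    also have "\<dots> = ennreal ((C * N) powr r)" by (simp add: Liminf_const)
    finally have nn: "(\<integral>\<^sup>+x. ennreal (\<bar>u x\<bar> powr r) \<partial>\<mu>) \<le> ennreal ((C * N) powr r)" .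
    have iu: "integrable \<mu> (\<lambda>x. \<bar>u x\<bar> powr r)"
    proof (rule integrableI_nonneg)
      show "(\<integral>\<^sup>+x. ennreal (\<bar>u x\<bar> powr r) \<partial>\<mu>) < \<infinity>" using nn by (rule order.strict_trans1) simp
    qed auto
    then have "ennreal (\<integral>x. \<bar>u x\<bar> powr r \<partial>\<mu>) \<le> ennreal ((C * N) powr r)"
      using nn by (simp add: nn_integral_eq_integral)
    then have "(\<integral>x. \<bar>u x\<bar> powr r \<partial>\<mu>) \<le> (C * N) powr r" by simp
    then have "(\<integral>x. \<bar>u x\<bar> powr r \<partial>\<mu>) powr (1/r) \<le> ((C * N) powr r) powr (1/r)"
      using \<open>r > 0\<close> by (intro powr_mono2) auto
    then have "Lp_norm \<Omega> r u \<le> C * N" using \<open>r > 0\<close> \<open>C > 0\<close> \<open>N \<ge> 0\<close> by (simp add: Lp_norm_def powr_powr)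
    moreover have "u \<in> Lp_on \<Omega> r" using iu by (simp add: Lp_on_def)
    ultimately show ?thesis by (simp add: N_def)
  qed
  ultimately show thesis using that unfolding r_def by blast
qed

end

theorem theorem4p4:
  fixes X :: "'m::finite \<Rightarrow> real^'n \<Rightarrow> real^'n"
    and \<Omega> :: "(real^'n) set"
    and Q p \<alpha> :: real
  assumes "CARD('n) \<ge> 2"
    and "open \<Omega>" and "bounded \<Omega>"
    and "\<And>j. locally_lipschitz (X j)"
    and "subunit_connected X \<Omega>"
    and "cc_continuous X \<Omega>"
    and "Q > 2" and "cc_doubling X \<Omega> Q"
    and "cc_poincare X \<Omega>"
    and "2 * Q / (Q + 2) \<le> p" and "p < Q / 2"
    and "\<alpha> > 0"
  shows "\<exists>C. \<forall>\<beta> A f u.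
    \<alpha> < \<beta> \<and> elliptic_coefficients \<Omega> \<alpha> \<beta> A \<and> f \<in> Lp_on \<Omega> p \<and> weak_solution X \<Omega> A f u \<longrightarrow>
      u \<in> Lp_on \<Omega> (p * Q / (Q - 2 * p)) \<and>
      Lp_norm \<Omega> (p * Q / (Q - 2 * p)) u \<le> C * Lp_norm \<Omega> p f"
proof (cases "\<Omega> = {}")
  case True
  have "u \<in> Lp_on {} r" "Lp_norm {} r u = 0" for u :: "real^'n \<Rightarrow> real" and r
    by (simp_all add: Lp_on_def Lp_norm_def integrable_restrict_space integral_restrict_space measurable_def)
  then show ?thesis using True by (intro exI[of _ 0]) auto
next
  case False
  then interpret cc_space X \<Omega> Q using assms by unfold_locales auto
  show ?thesis
  proof (rule solution_bound[OF assms(10-12)])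
    fix C assume C: "\<And>\<beta> A f u. \<lbrakk>elliptic_coefficients \<Omega> \<alpha> \<beta> A; f \<in> Lp_on \<Omega> p; weak_solution X \<Omega> A f u\<rbrakk> \<Longrightarrow>
      u \<in> Lp_on \<Omega> (p * Q / (Q - 2 * p)) \<and> Lp_norm \<Omega> (p * Q / (Q - 2 * p)) u \<le> C * Lp_norm \<Omega> p f"
    show ?thesis
    proof (intro exI[of _ C] allI impI, elim conjE)
      fix \<beta> A f u
      assume "elliptic_coefficients \<Omega> \<alpha> \<beta> A" "f \<in> Lp_on \<Omega> p" "weak_solution X \<Omega> A f u"
      then show "u \<in> Lp_on \<Omega> (p * Q / (Q - 2 * p)) \<and> Lp_norm \<Omega> (p * Q / (Q - 2 * p)) u \<le> C * Lp_norm \<Omega> p f"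
        by (rule C)
    qed
  qed
qed

end
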